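(* For every real number $\alpha$ with $0<\alpha<1$ we have $$A(\alpha)\cap\mathcal M_{i,0}^*\neq\emptyset\qquad\text{and}\qquad \emptyset\neq B(\alpha)\subseteq\mathcal M_{i,0}^*.$$
   Context: $\mathcal M^*$ denotes the set of positive Borel measures on $\mathbb R$ with infinite support and finite moments of every order. A measure $\mu\in\mathcal M^*$ is determinate if it is the only measure in $\mathcal M^*$ with the moments $s_n=\int x^n\,d\mu(x)$, $n\ge 0$; otherwise it is indeterminate. $\mathcal M_d^*$ and $\mathcal M_i^*$ denote the sets of determinate, respectively indeterminate, measures in $\mathcal M^*$. An indeterminate measure $\mu$ is called N-extremal if (after normalization to mass 1) it is one of the solutions of its moment problem corresponding to a constant parameter $t\in\mathbb R\cup\{\infty\}$ in the Nevanlinna parametrization; by a theorem of M. Riesz this is equivalent to $\mathbb C[x]$ being dense in $L^2(\mu)$. $\mathcal M_{i,0}^*$ denotes the set of measures in $\mathcal M^*$ that are indeterminate and N-extremal. For $0\le\alpha\le 1$ put $$A(\alpha)=\{\mu\in\mathcal M_i^*\mid (1+x^2)^{-\alpha}d\mu(x)\in\mathcal M_i^*\},\qquad B(\alpha)=\{\mu\in\mathcal M_i^*\mid (1+x^2)^{-\alpha}d\mu(x)\in\mathcal M_d^*\}.$$ *)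

theory Defs
  imports "HOL-Analysis.Analysis" "HOL-Computational_Algebra.Polynomial"
begin

definition msupport :: "real measure \<Rightarrow> real set" where
  "msupport \<mu> = {x. \<forall>U. open U \<and> x \<in> U \<longrightarrow> emeasure \<mu> U > 0}"

definition moment :: "real measure \<Rightarrow> nat \<Rightarrow> real" where
  "moment \<mu> n = (\<integral>x. x ^ n \<partial>\<mu>)"

definition M_star :: "real measure set" where
  "M_star = {\<mu>. sets \<mu> = sets borel \<and> infinite (msupport \<mu>) \<and> (\<forall>n::nat. integrable \<mu> (\<lambda>x. x ^ n))}"

definition M_star_d :: "real measure set" where
  "M_star_d = {\<mu> \<in> M_star. \<forall>\<nu> \<in> M_star. (\<forall>n. moment \<nu> n = moment \<mu> n) \<longrightarrow> \<nu> = \<mu>}"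

definition M_star_i :: "real measure set" where
  "M_star_i = M_star - M_star_d"

definition orthonormal_polys :: "real measure \<Rightarrow> (nat \<Rightarrow> real poly) \<Rightarrow> bool" where
  "orthonormal_polys \<mu> P \<longleftrightarrow>
     (\<forall>n. degree (P n) = n \<and> lead_coeff (P n) > 0) \<and>
     (\<forall>m n. (\<integral>x. poly (P m) x * poly (P n) x \<partial>\<mu>) = (if m = n then 1 else 0))"

definition orth_poly :: "real measure \<Rightarrow> nat \<Rightarrow> complex poly" where
  "orth_poly \<mu> n = map_poly complex_of_real ((THE P. orthonormal_polys \<mu> P) n)"

abbreviation pP :: "real measure \<Rightarrow> nat \<Rightarrow> complex \<Rightarrow> complex" where
  "pP \<mu> n z \<equiv> poly (orth_poly \<mu> n) z"

text \<open>Polynomials of the second kind,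
  \<open>Q\<^sub>n(z) = \<integral> (P\<^sub>n(z) - P\<^sub>n(x)) / (z - x) d\<mu>(x)\<close>.  The difference quotient is taken as the polynomial
  \<^const>\<open>synthetic_div\<close> in \<open>x\<close>, so that it has the right value at \<open>x = z\<close>, which matters
  when \<open>\<mu>\<close> has an atom at a real point \<open>z\<close>.\<close>

definition pQ :: "real measure \<Rightarrow> nat \<Rightarrow> complex \<Rightarrow> complex" where
  "pQ \<mu> n z = (\<integral>x. poly (synthetic_div (orth_poly \<mu> n) z) (complex_of_real x) \<partial>\<mu>)"

text \<open>The entire functions of the Nevanlinna matrix of a measure of mass 1; they depend only on its
  moments.\<close>

definition nevA :: "real measure \<Rightarrow> complex \<Rightarrow> complex" where
  "nevA \<mu> z = z * (\<Sum>k. pQ \<mu> k 0 * pQ \<mu> k z)"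

definition nevB :: "real measure \<Rightarrow> complex \<Rightarrow> complex" where
  "nevB \<mu> z = - 1 + z * (\<Sum>k. pQ \<mu> k 0 * pP \<mu> k z)"

definition nevC :: "real measure \<Rightarrow> complex \<Rightarrow> complex" where
  "nevC \<mu> z = 1 + z * (\<Sum>k. pP \<mu> k 0 * pQ \<mu> k z)"

definition nevD :: "real measure \<Rightarrow> complex \<Rightarrow> complex" where
  "nevD \<mu> z = z * (\<Sum>k. pP \<mu> k 0 * pP \<mu> k z)"

definition stieltjes :: "real measure \<Rightarrow> complex \<Rightarrow> complex" where
  "stieltjes \<mu> z = (\<integral>x. 1 / (complex_of_real x - z) \<partial>\<mu>)"

text \<open>In the Nevanlinna parametrization the solution with parameter \<open>\<phi>\<close> (a Pick function or
  \<open>\<infinity>\<close>) has Stieltjes transform \<open>- (A \<phi> - C) / (B \<phi> - D)\<close> off the real axis, read as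
  \<open>- A / B\<close> for \<open>\<phi> = \<infinity>\<close>.  Below, \<open>None\<close> stands for the constant parameter \<open>\<infinity>\<close>.\<close>

definition nevanlinna_const :: "real measure \<Rightarrow> real option \<Rightarrow> complex \<Rightarrow> complex" where
  "nevanlinna_const \<mu> t z =
     (case t of
        Some r \<Rightarrow> - (nevA \<mu> z * of_real r - nevC \<mu> z) / (nevB \<mu> z * of_real r - nevD \<mu> z)
      | None \<Rightarrow> - nevA \<mu> z / nevB \<mu> z)"

definition normalized :: "real measure \<Rightarrow> real measure" where
  "normalized \<mu> = scale_measure (inverse (emeasure \<mu> UNIV)) \<mu>"

definition N_extremal :: "real measure \<Rightarrow> bool" where
  "N_extremal \<mu> \<longleftrightarrow>
     (\<exists>t. \<forall>z. z \<notin> \<real> \<longrightarrow> stieltjes (normalized \<mu>) z = nevanlinna_const (normalized \<mu>) t z)"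

definition M_star_i0 :: "real measure set" where
  "M_star_i0 = {\<mu> \<in> M_star_i. N_extremal \<mu>}"

definition weighted :: "real \<Rightarrow> real measure \<Rightarrow> real measure" where
  "weighted \<alpha> \<mu> = density \<mu> (\<lambda>x. ennreal ((1 + x\<^sup>2) powr (- \<alpha>)))"

definition class_A :: "real \<Rightarrow> real measure set" where
  "class_A \<alpha> = {\<mu> \<in> M_star_i. weighted \<alpha> \<mu> \<in> M_star_i}"

definition class_B :: "real \<Rightarrow> real measure set" where
  "class_B \<alpha> = {\<mu> \<in> M_star_i. weighted \<alpha> \<mu> \<in> M_star_d}"

end

theory Submission
  imports
    Defs
    "HOL-Probability.Helly_Selection"
    "HOL-Computational_Algebra.Fundamental_Theorem_Algebra"
    "HOL-Real_Asymp.Real_Asymp"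
begin

text \<open>Everything is expressed through boundedness of the evaluation \<open>p \<mapsto> p(z)\<close> on polynomials in the
  \<open>L\<^sup>2(\<mu>)\<close>-norm. At a nonreal \<open>z\<close> it is bounded iff \<open>\<mu>\<close> is indeterminate: a second solution
  bounds it through the difference of the Stieltjes transforms, and conversely boundedness spreads
  from \<open>z\<close> to every real \<open>x\<^sub>0\<close>, where quadrature rules with node \<open>x\<^sub>0\<close> have a weak limit that is a
  solution with an atom at \<open>x\<^sub>0\<close>.

  If \<open>(1 + x\<^sup>2)\<^bsup>-\<alpha>\<^esup> d\<mu>\<close> is determinate with \<open>\<alpha> \<le> 1\<close>, unboundedness of its evaluation at \<open>z\<close> says that
  \<open>1 / (x - z)\<close> is an \<open>L\<^sup>2(\<mu>)\<close>-limit of polynomials, and Parseval's identity for these kernels yields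
  the Nevanlinna formula with a constant parameter. The two examples are carried by the points \<open>2\<^sup>k\<close>
  with masses \<open>2\<^bsup>tk - k(k+1)\<^esup>\<close>: such a measure is indeterminate for \<open>t > 0\<close> and determinate for
  \<open>t < 0\<close>, and the factor \<open>(1 + x\<^sup>2)\<^bsup>-\<alpha>\<^esup>\<close> replaces \<open>t\<close> by \<open>t - 2\<alpha>\<close>. Taking \<open>t = \<alpha>\<close> gives an element
  of \<open>B(\<alpha>)\<close>, taking \<open>t = 1 + \<alpha>\<close> one of \<open>A(\<alpha>) \<inter> B(1)\<close>.\<close>

section \<open>Cauchy--Schwarz inequalities and integration of polynomials\<close>

text \<open>\<open>N_extremal\<close> is an explicit formula in the series \<open>nevA\<close> to
  \<open>nevD\<close>, not density of polynomials, so the formula itself has to be produced. The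
  bridge is that \<open>pQ \<mu> k z + stieltjes \<mu> z * pP \<mu> k z\<close> is the k-th Fourier
  coefficient of 1/(x - z). Bessel makes these square summable for every measure; Parseval,
  available once the kernel lies in the closure of the polynomials, turns the resolvent identity
  into an equation between two values of the Stieltjes transform and the orthogonal series.
  Indeterminacy from a bounded evaluation at x0 rests on choosing x0 outside the atoms of \<mu>: a
  solution with an atom at x0 then differs from \<mu>. The masses come from Lagrange interpolation
  at 2^0, ..., 2^N: the basis polynomial of the node 2^k has size about 2^(-k(k+1)/2) at 0,
  uniformly in N. Its square is the mass for t = 0, so evaluation at 0 is governed by the geometric
  series of 2^(-tk), and the sign of t decides.\<close>

lemma integral_Cauchy_Schwarz:
  fixes f g :: "'a \<Rightarrow> complex"
  assumes [measurable]: "f \<in> borel_measurable M" "g \<in> borel_measurable M"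
    and f: "integrable M (\<lambda>x. (cmod (f x))\<^sup>2)" and g: "integrable M (\<lambda>x. (cmod (g x))\<^sup>2)"
  shows "integrable M (\<lambda>x. f x * g x)"
    and "(cmod (\<integral>x. f x * g x \<partial>M))\<^sup>2
           \<le> (\<integral>x. (cmod (f x))\<^sup>2 \<partial>M) * (\<integral>x. (cmod (g x))\<^sup>2 \<partial>M)"
proof -
  have abs: "integrable M (\<lambda>x. cmod (f x) * cmod (g x))"
  proof (rule Bochner_Integration.integrable_bound)
    show "integrable M (\<lambda>x. (cmod (f x))\<^sup>2 + (cmod (g x))\<^sup>2)" using f g by simp
    have "a * b \<le> a\<^sup>2 + b\<^sup>2" if "a \<ge> 0" "b \<ge> 0" for a b :: real
      using sum_squares_bound[of a b] that mult_nonneg_nonneg[OF that] by linarith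
    then show "AE x in M. norm (cmod (f x) * cmod (g x)) \<le> norm ((cmod (f x))\<^sup>2 + (cmod (g x))\<^sup>2)"
      by simp
  qed simp
  show fg: "integrable M (\<lambda>x. f x * g x)"
    by (rule Bochner_Integration.integrable_bound[OF abs]) (auto simp: norm_mult)
  let ?I = "\<integral>x. cmod (f x) * cmod (g x) \<partial>M"
  let ?F = "\<integral>x. (cmod (f x))\<^sup>2 \<partial>M" and ?G = "\<integral>x. (cmod (g x))\<^sup>2 \<partial>M"
  have "(ennreal ?I)\<^sup>2 \<le> ennreal ?F * ennreal ?G"
  proof -
    have "ennreal ?I = (\<integral>\<^sup>+x. ennreal (cmod (f x)) * ennreal (cmod (g x)) \<partial>M)"
      using abs by (subst nn_integral_eq_integral[symmetric]) (auto simp: ennreal_mult')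
    moreover have "ennreal ?F = (\<integral>\<^sup>+x. (ennreal (cmod (f x)))\<^sup>2 \<partial>M)"
      using f by (subst nn_integral_eq_integral[symmetric]) (auto simp: ennreal_power)
    moreover have "ennreal ?G = (\<integral>\<^sup>+x. (ennreal (cmod (g x)))\<^sup>2 \<partial>M)"
      using g by (subst nn_integral_eq_integral[symmetric]) (auto simp: ennreal_power)
    ultimately show ?thesis
      using Cauchy_Schwarz_nn_integral[of "\<lambda>x. ennreal (cmod (f x))" M "\<lambda>x. ennreal (cmod (g x))"]
      by simp
  qed
  moreover have "?I \<ge> 0" "?F \<ge> 0" "?G \<ge> 0" by simp_all
  ultimately have "?I\<^sup>2 \<le> ?F * ?G"
    by (simp add: ennreal_power ennreal_mult'[symmetric])
  moreover have "cmod (\<integral>x. f x * g x \<partial>M) \<le> ?I"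
    by (rule order_trans[OF integral_norm_bound]) (simp add: norm_mult)
  ultimately show "(cmod (\<integral>x. f x * g x \<partial>M))\<^sup>2 \<le> ?F * ?G"
    by (meson norm_ge_zero order_trans power_mono)
qed

lemma sum_Cauchy_Schwarz_cmod:
  fixes a b :: "'i \<Rightarrow> complex"
  shows "(cmod (\<Sum>i\<in>I. a i * b i))\<^sup>2 \<le> (\<Sum>i\<in>I. (cmod (a i))\<^sup>2) * (\<Sum>i\<in>I. (cmod (b i))\<^sup>2)"
proof -
  have "cmod (\<Sum>i\<in>I. a i * b i) \<le> (\<Sum>i\<in>I. cmod (a i) * cmod (b i))"
    by (rule order_trans[OF norm_sum]) (simp add: norm_mult)
  then have "(cmod (\<Sum>i\<in>I. a i * b i))\<^sup>2 \<le> (\<Sum>i\<in>I. cmod (a i) * cmod (b i))\<^sup>2"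
    by (simp add: power_mono)
  also have "\<dots> \<le> (\<Sum>i\<in>I. (cmod (a i))\<^sup>2) * (\<Sum>i\<in>I. (cmod (b i))\<^sup>2)"
    by (rule Cauchy_Schwarz_ineq_sum)
  finally show ?thesis .
qed

lemma summable_mult_cmod:
  fixes a b :: "nat \<Rightarrow> complex"
  assumes "summable (\<lambda>k. (cmod (a k))\<^sup>2)" "summable (\<lambda>k. (cmod (b k))\<^sup>2)"
  shows "summable (\<lambda>k. a k * b k)"
proof (rule summable_comparison_test')
  show "summable (\<lambda>k. (cmod (a k))\<^sup>2 + (cmod (b k))\<^sup>2)" using assms by (rule summable_add)
  show "norm (a k * b k) \<le> (cmod (a k))\<^sup>2 + (cmod (b k))\<^sup>2" for k
    using sum_squares_bound[of "cmod (a k)" "cmod (b k)"]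
      mult_nonneg_nonneg[OF norm_ge_zero[of "a k"] norm_ge_zero[of "b k"]]
    unfolding norm_mult by linarith
qed

lemma suminf_Cauchy_Schwarz_cmod:
  fixes a b :: "nat \<Rightarrow> complex"
  assumes a: "summable (\<lambda>k. (cmod (a k))\<^sup>2)" and b: "summable (\<lambda>k. (cmod (b k))\<^sup>2)"
  shows "(cmod (\<Sum>k. a k * b k))\<^sup>2 \<le> (\<Sum>k. (cmod (a k))\<^sup>2) * (\<Sum>k. (cmod (b k))\<^sup>2)"
proof (rule LIMSEQ_le)
  show "(\<lambda>n. (cmod (\<Sum>k<n. a k * b k))\<^sup>2) \<longlonglongrightarrow> (cmod (\<Sum>k. a k * b k))\<^sup>2"
    by (intro tendsto_intros summable_LIMSEQ summable_mult_cmod a b)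
  show "(\<lambda>n. (\<Sum>k<n. (cmod (a k))\<^sup>2) * (\<Sum>k<n. (cmod (b k))\<^sup>2))
      \<longlonglongrightarrow> (\<Sum>k. (cmod (a k))\<^sup>2) * (\<Sum>k. (cmod (b k))\<^sup>2)"
    by (intro tendsto_intros summable_LIMSEQ a b)
  show "\<exists>N. \<forall>n\<ge>N. (cmod (\<Sum>k<n. a k * b k))\<^sup>2 \<le> (\<Sum>k<n. (cmod (a k))\<^sup>2) * (\<Sum>k<n. (cmod (b k))\<^sup>2)"
    using sum_Cauchy_Schwarz_cmod by blast
qed

lemma summable_cmod_add_sq:
  fixes a b :: "nat \<Rightarrow> complex"
  assumes "summable (\<lambda>k. (cmod (a k))\<^sup>2)" "summable (\<lambda>k. (cmod (b k))\<^sup>2)"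
  shows "summable (\<lambda>k. (cmod (a k + b k))\<^sup>2)"
proof (rule summable_comparison_test')
  show "summable (\<lambda>k. 2 * (cmod (a k))\<^sup>2 + 2 * (cmod (b k))\<^sup>2)"
    using assms by (intro summable_add summable_mult)
  show "norm ((cmod (a k + b k))\<^sup>2) \<le> 2 * (cmod (a k))\<^sup>2 + 2 * (cmod (b k))\<^sup>2" for k
  proof -
    have "(cmod (a k + b k))\<^sup>2 \<le> (cmod (a k) + cmod (b k))\<^sup>2"
      by (simp add: norm_triangle_ineq power_mono)
    also have "\<dots> \<le> 2 * (cmod (a k))\<^sup>2 + 2 * (cmod (b k))\<^sup>2"
      using sum_squares_bound[of "cmod (a k)" "cmod (b k)"] by (simp add: power2_sum)
    finally show ?thesis by simp
  qed
qed

lemma integrable_poly_real: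
  assumes "\<mu> \<in> M_star"
  shows "integrable \<mu> (\<lambda>x. poly p x)"
  using assms unfolding poly_altdef M_star_def by (auto intro!: Bochner_Integration.integrable_sum)

lemma M_star_measurable:
  assumes "\<mu> \<in> M_star"
  shows "borel_measurable \<mu> = borel_measurable borel" "space \<mu> = UNIV"
  using assms by (auto simp: M_star_def intro: measurable_cong_sets dest: sets_eq_imp_space_eq)

lemma M_star_finite_measure:
  assumes "\<mu> \<in> M_star"
  shows "finite_measure \<mu>"
proof
  have "integrable \<mu> (\<lambda>x. x ^ 0)" using assms unfolding M_star_def by blast
  then show "emeasure \<mu> (space \<mu>) \<noteq> \<infinity>" by (simp add: integrable_iff_bounded)
qed

lemma integrable_poly_complex:
  assumes "\<mu> \<in> M_star"
  shows "integrable \<mu> (\<lambda>x. poly p (complex_of_real x))"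
proof -
  have "integrable \<mu> (\<lambda>x. complex_of_real (x ^ n))" for n
    using assms unfolding M_star_def by (intro integrable_of_real) blast
  then show ?thesis unfolding poly_altdef
    by (intro Bochner_Integration.integrable_sum integrable_mult_right) simp
qed

lemma poly_map_poly_cnj: "poly (map_poly cnj p) (complex_of_real x) = cnj (poly p (complex_of_real x))"
  by (metis complex_cnj_complex_of_real poly_cnj)

text \<open>On the real line |p|^2 is again a polynomial, so its integrability and its integral are
  controlled by the moments.\<close>

lemma cmod_poly_squared:
  "complex_of_real ((cmod (poly p (complex_of_real x)))\<^sup>2) = poly (p * map_poly cnj p) (complex_of_real x)"
  by (simp add: poly_map_poly_cnj complex_norm_square del: of_real_power)

lemma integrable_cmod_poly_squared:
  assumes "\<mu> \<in> M_star"
  shows "integrable \<mu> (\<lambda>x. (cmod (poly p (complex_of_real x)))\<^sup>2)"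
proof -
  have "integrable \<mu> (\<lambda>x. Re (poly (p * map_poly cnj p) (complex_of_real x)))"
    by (intro integrable_Re integrable_poly_complex assms)
  then show ?thesis unfolding cmod_poly_squared[symmetric] Re_complex_of_real .
qed

lemma measurable_poly_complex [measurable]: "(\<lambda>x. poly p (complex_of_real x)) \<in> borel_measurable borel"
  unfolding poly_altdef by measurable

lemma measurable_poly_real [measurable]: "(\<lambda>x::real. poly p x) \<in> borel_measurable borel"
  unfolding poly_altdef by measurable

text \<open>If the integral were 0, the complement of the zero set would be an open null set, and
  the infinite support would lie in a finite set.\<close>

lemma integral_pos_if_finite_zeros:
  assumes mu: "\<mu> \<in> M_star" and int: "integrable \<mu> h" and h: "\<And>x. h x \<ge> 0"
    and fin: "finite {x::real. h x = (0::real)}"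
  shows "(\<integral>x. h x \<partial>\<mu>) > 0"
proof (rule ccontr)
  assume "\<not> ?thesis"
  moreover have "(\<integral>x. h x \<partial>\<mu>) \<ge> 0" using h by simp
  ultimately have "(\<integral>x. h x \<partial>\<mu>) = 0" by linarith
  then have "AE x in \<mu>. h x = 0" using integral_nonneg_eq_0_iff_AE[OF int] h by simp
  moreover have sets: "sets \<mu> = sets borel" using mu by (simp add: M_star_def)
  let ?Z = "{x. h x = 0}"
  have op: "open (- ?Z)" using fin by (simp add: finite_imp_closed open_Compl)
  ultimately have null: "emeasure \<mu> (- ?Z) = 0"
    using AE_iff_measurable[of "- ?Z" \<mu> "\<lambda>x. h x = 0"] sets_eq_imp_space_eq[OF sets]
    by (auto simp: sets Compl_eq)
  have "msupport \<mu> \<subseteq> ?Z"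
  proof
    fix x assume "x \<in> msupport \<mu>"
    then show "x \<in> ?Z" using op null unfolding msupport_def by fastforce
  qed
  with fin have "finite (msupport \<mu>)" by (rule finite_subset[rotated])
  with mu show False by (simp add: M_star_def)
qed

section \<open>Orthonormal polynomials\<close>

text \<open>Existence witness for the \<open>THE\<close> in \<open>orth_poly\<close>; dividing by
  the norm is legitimate because no nonzero polynomial has norm 0 for a measure in
  \<open>M_star\<close>.\<close>

fun gram_schmidt :: "real measure \<Rightarrow> nat \<Rightarrow> real poly" where
  "gram_schmidt \<mu> n =
     (let q = monom 1 n - (\<Sum>k<n. smult (\<integral>x. x ^ n * poly (gram_schmidt \<mu> k) x \<partial>\<mu>) (gram_schmidt \<mu> k))
      in smult (1 / sqrt (\<integral>x. (poly q x)\<^sup>2 \<partial>\<mu>)) q)"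

declare gram_schmidt.simps [simp del]

lemma integrable_poly_real_mult:
  "\<mu> \<in> M_star \<Longrightarrow> integrable \<mu> (\<lambda>x. poly p x * poly q x)"
  using integrable_poly_real[of \<mu> "p * q"] by simp

lemma integral_poly_real_sq_pos:
  assumes mu: "\<mu> \<in> M_star" and p: "p \<noteq> 0"
  shows "(\<integral>x. (poly p x)\<^sup>2 \<partial>\<mu>) > 0"
  using integrable_poly_real_mult[OF mu, of p p] p
  by (intro integral_pos_if_finite_zeros[OF mu]) (simp_all add: power2_eq_square poly_roots_finite)

lemma gram_schmidt_orthonormal:
  assumes mu: "\<mu> \<in> M_star"
  shows "degree (gram_schmidt \<mu> n) = n \<and> lead_coeff (gram_schmidt \<mu> n) > 0 \<and>
    (\<forall>j\<le>n. (\<integral>x. poly (gram_schmidt \<mu> n) x * poly (gram_schmidt \<mu> j) x \<partial>\<mu>) = (if n = j then 1 else 0))"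
proof (induction n rule: less_induct)
  case (less n)
  let ?P = "gram_schmidt \<mu>"
  define c where "c k = (\<integral>x. x ^ n * poly (?P k) x \<partial>\<mu>)" for k
  define q where "q = monom 1 n - (\<Sum>k<n. smult (c k) (?P k))"
  have P: "?P n = smult (1 / sqrt (\<integral>x. (poly q x)\<^sup>2 \<partial>\<mu>)) q"
    by (simp add: gram_schmidt.simps[of _ n] q_def c_def Let_def)
  have co: "coeff q n = 1"
    using less by (simp add: q_def coeff_sum coeff_eq_0)
  have "degree q \<le> n" unfolding q_def
    using less by (intro degree_diff_le degree_sum_le) (auto simp: degree_monom_le less_imp_le)
  with co have deg: "degree q = n" by (metis le_antisym le_degree zero_neq_one)
  with co have q0: "q \<noteq> 0" by auto
  let ?N = "\<integral>x. (poly q x)\<^sup>2 \<partial>\<mu>"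
  have N: "?N > 0" by (rule integral_poly_real_sq_pos[OF mu q0])
  have orth: "(\<integral>x. poly q x * poly (?P j) x \<partial>\<mu>) = 0" if "j < n" for j
  proof -
    have *: "(\<integral>x. poly (?P k) x * poly (?P j) x \<partial>\<mu>) = (if k = j then 1 else 0)" if "k < n" for k
      using less[OF \<open>j < n\<close>] less[OF that]
      by (cases "j \<le> k") (auto simp: mult.commute[of "poly (?P k) _"])
    have "poly q x * poly (?P j) x = x ^ n * poly (?P j) x - (\<Sum>k<n. c k * (poly (?P k) x * poly (?P j) x))" for x
      by (simp add: q_def poly_sum poly_monom algebra_simps sum_distrib_left)
    then have "(\<integral>x. poly q x * poly (?P j) x \<partial>\<mu>)
      = (\<integral>x. x ^ n * poly (?P j) x \<partial>\<mu>) - (\<Sum>k<n. c k * (\<integral>x. poly (?P k) x * poly (?P j) x \<partial>\<mu>))"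
      using integrable_poly_real_mult[OF mu, of "monom 1 n" "?P j"]
      by (simp add: poly_monom integrable_poly_real_mult[OF mu])
    also have "\<dots> = c j - (\<Sum>k<n. c k * (if k = j then 1 else 0))"
      using * by (simp add: c_def)
    also have "\<dots> = 0" using \<open>j < n\<close> by (simp add: if_distrib cong: if_cong)
    finally show ?thesis .
  qed
  have norm: "(\<integral>x. poly (?P n) x * poly (?P n) x \<partial>\<mu>) = 1"
  proof -
    have "poly (?P n) x * poly (?P n) x = (poly q x)\<^sup>2 / ?N" for x
      unfolding P using N by (simp add: power2_eq_square field_simps)
    then show ?thesis using N by simp
  qed
  have "(\<integral>x. poly (?P n) x * poly (?P j) x \<partial>\<mu>) = 0" if "j < n" for j
    using orth[OF that] by (simp add: P)
  with norm have "\<forall>j\<le>n. (\<integral>x. poly (?P n) x * poly (?P j) x \<partial>\<mu>) = (if n = j then 1 else 0)"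
    by (metis le_neq_implies_less)
  moreover have "degree (?P n) = n" using deg N by (simp add: P)
  moreover have "lead_coeff (?P n) > 0" using deg N co by (simp add: P)
  ultimately show ?case by blast
qed

lemma orthonormal_polys_gram_schmidt:
  assumes "\<mu> \<in> M_star"
  shows "orthonormal_polys \<mu> (gram_schmidt \<mu>)"
  unfolding orthonormal_polys_def
proof (intro conjI allI)
  fix m n
  show "(\<integral>x. poly (gram_schmidt \<mu> m) x * poly (gram_schmidt \<mu> n) x \<partial>\<mu>) = (if m = n then 1 else 0)"
    using gram_schmidt_orthonormal[OF assms, of m] gram_schmidt_orthonormal[OF assms, of n]
    by (cases "n \<le> m") (auto simp: mult.commute[of "poly (gram_schmidt \<mu> m) _"])
qed (use gram_schmidt_orthonormal[OF assms] in blast)+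

lemma orthonormal_polysD:
  assumes "orthonormal_polys \<mu> P"
  shows "degree (P k) = k" "lead_coeff (P k) > 0" "P k \<noteq> 0"
    and "(\<integral>x. poly (P j) x * poly (P k) x \<partial>\<mu>) = (if j = k then 1 else 0)"
proof -
  show "lead_coeff (P k) > 0" using assms unfolding orthonormal_polys_def by blast
  then show "P k \<noteq> 0" by auto
qed (use assms in \<open>auto simp: orthonormal_polys_def\<close>)

text \<open>The bound on p is phrased through vanishing coefficients instead of
  \<open>degree p < n\<close>, so that the zero polynomial is covered when n = 0.\<close>

lemma poly_graded_expansion:
  fixes P :: "nat \<Rightarrow> 'a::field poly"
  assumes deg: "\<And>k. degree (P k) = k" and nz: "\<And>k. P k \<noteq> 0"
    and "\<And>i. i \<ge> n \<Longrightarrow> coeff p i = 0"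
  shows "\<exists>c. p = (\<Sum>k<n. smult (c k) (P k))"
  using assms(3)
proof (induction n arbitrary: p)
  case 0
  then have "p = 0" by (simp add: poly_eq_iff)
  then show ?case by simp
next
  case (Suc n)
  define a where "a = coeff p n / lead_coeff (P n)"
  have l: "lead_coeff (P n) \<noteq> 0" using nz by simp
  have "coeff (p - smult a (P n)) i = 0" if "i \<ge> n" for i
  proof (cases "i = n")
    case True
    then show ?thesis using l deg[of n] by (simp add: a_def)
  next
    case False
    then show ?thesis using Suc.prems[of i] that deg[of n] by (simp add: coeff_eq_0)
  qed
  from Suc.IH[OF this] obtain c where c: "p - smult a (P n) = (\<Sum>k<n. smult (c k) (P k))" by auto
  have "p = (\<Sum>k<Suc n. smult ((c(n := a)) k) (P k))"
    using c by (simp add: algebra_simps)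
  then show ?case by blast
qed

text \<open>With c the quotient of the leading coefficients, \<open>P n - smult c (P' n)\<close> has
  degree below n. It is orthogonal to \<open>P n\<close> and to \<open>P' n\<close>, hence to
  itself, hence 0. Equal norms and positive leading coefficients then force c = 1.\<close>

lemma orthonormal_polys_unique:
  assumes mu: "\<mu> \<in> M_star" and P: "orthonormal_polys \<mu> P" and P': "orthonormal_polys \<mu> P'"
  shows "P = P'"
proof
  fix n
  have dP: "degree (P k) = k" "P k \<noteq> 0" "lead_coeff (P k) > 0" for k
    by (rule orthonormal_polysD[OF P])+
  have dP': "degree (P' k) = k" "P' k \<noteq> 0" "lead_coeff (P' k) > 0" for k
    by (rule orthonormal_polysD[OF P'])+
  have oP: "(\<integral>x. poly (P j) x * poly (P k) x \<partial>\<mu>) = (if j = k then 1 else 0)" for j k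
    by (rule orthonormal_polysD[OF P])+
  have oP': "(\<integral>x. poly (P' j) x * poly (P' k) x \<partial>\<mu>) = (if j = k then 1 else 0)" for j k
    by (rule orthonormal_polysD[OF P'])+
  define c where "c = lead_coeff (P n) / lead_coeff (P' n)"
  have c: "c > 0" using dP dP' by (simp add: c_def)
  define d where "d = P n - smult c (P' n)"
  have low: "coeff d i = 0" if "i \<ge> n" for i
  proof (cases "i = n")
    case True
    then show ?thesis using dP'(3)[of n] dP(1)[of n] dP'(1)[of n] by (simp add: d_def c_def)
  next
    case False
    then show ?thesis using that dP(1)[of n] dP'(1)[of n] by (simp add: d_def coeff_eq_0)
  qed
  have perp: "(\<integral>x. poly d x * poly (R n) x \<partial>\<mu>) = 0"
    if R: "\<And>k. degree (R k) = k" "\<And>k. R k \<noteq> 0"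
      "\<And>j k. (\<integral>x. poly (R j) x * poly (R k) x \<partial>\<mu>) = (if j = k then 1 else 0)" for R
  proof -
    obtain a where "d = (\<Sum>k<n. smult (a k) (R k))"
      using poly_graded_expansion[of R n d, OF R(1,2) low] by blast
    then have "(\<integral>x. poly d x * poly (R n) x \<partial>\<mu>) = (\<Sum>k<n. a k * (\<integral>x. poly (R k) x * poly (R n) x \<partial>\<mu>))"
      by (simp add: poly_sum sum_distrib_right integrable_poly_real_mult[OF mu] mult.assoc)
    then show ?thesis by (simp add: R)
  qed
  have "(\<integral>x. (poly d x)\<^sup>2 \<partial>\<mu>)
      = (\<integral>x. poly d x * poly (P n) x \<partial>\<mu>) - c * (\<integral>x. poly d x * poly (P' n) x \<partial>\<mu>)"
    by (subst integral_mult_right_zero[symmetric], subst Bochner_Integration.integral_diff[symmetric])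
       (simp_all add: d_def integrable_poly_real_mult[OF mu] power2_eq_square algebra_simps
          integrable_poly_real_mult[OF mu, of "P n - smult c (P' n)", simplified algebra_simps, simplified])
  also have "\<dots> = 0" using perp[of P] perp[of P'] dP dP' oP oP' by simp
  finally have "d = 0" using integral_poly_real_sq_pos[OF mu, of d] by force
  then have eq: "P n = smult c (P' n)" by (simp add: d_def)
  have "1 = c\<^sup>2 * (\<integral>x. poly (P' n) x * poly (P' n) x \<partial>\<mu>)"
    using oP[of n n] unfolding eq by (simp add: power2_eq_square algebra_simps)
  then have "c = 1" using oP'[of n n] c by (simp add: power2_eq_1_iff)
  with eq show "P n = P' n" by simp
qed

definition real_orth_poly :: "real measure \<Rightarrow> nat \<Rightarrow> real poly" where
  "real_orth_poly \<mu> = (THE P. orthonormal_polys \<mu> P)"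

lemma orthonormal_real_orth_poly:
  assumes "\<mu> \<in> M_star"
  shows "orthonormal_polys \<mu> (real_orth_poly \<mu>)"
  unfolding real_orth_poly_def
  using orthonormal_polys_gram_schmidt[OF assms] orthonormal_polys_unique[OF assms]
  by (metis theI')

lemma orth_poly_eq: "orth_poly \<mu> n = map_poly of_real (real_orth_poly \<mu> n)"
  by (simp add: orth_poly_def real_orth_poly_def)

lemma poly_map_poly_of_real:
  "poly (map_poly complex_of_real p) (of_real x) = of_real (poly p x)"
  by (induction p) (auto simp: map_poly_pCons)

lemma pP_of_real: "pP \<mu> n (of_real x) = of_real (poly (real_orth_poly \<mu> n) x)"
  by (simp add: orth_poly_eq poly_map_poly_of_real)

lemma degree_orth_poly:
  assumes "\<mu> \<in> M_star"
  shows "degree (orth_poly \<mu> n) = n" "orth_poly \<mu> n \<noteq> 0"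
proof -
  have "degree (real_orth_poly \<mu> n) = n" and l: "lead_coeff (real_orth_poly \<mu> n) > 0"
    by (rule orthonormal_polysD[OF orthonormal_real_orth_poly[OF assms]])+
  then show "degree (orth_poly \<mu> n) = n" by (simp add: orth_poly_eq degree_map_poly)
  have "coeff (orth_poly \<mu> n) n = of_real (lead_coeff (real_orth_poly \<mu> n))"
    using \<open>degree (real_orth_poly \<mu> n) = n\<close> by (simp add: orth_poly_eq coeff_map_poly)
  with l show "orth_poly \<mu> n \<noteq> 0" by auto
qed

text \<open>The pairing is bilinear, without conjugates, because real coefficients make
  \<open>pP \<mu> k\<close> real on the line. This is the form in which products occur in
  \<open>nevA\<close> to \<open>nevD\<close>.\<close>

lemma integral_orth_poly:
  assumes "\<mu> \<in> M_star"
  shows "(\<integral>x. pP \<mu> m (of_real x) * pP \<mu> n (of_real x) \<partial>\<mu>) = (if m = n then 1 else 0)"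
proof -
  have "(\<integral>x. pP \<mu> m (of_real x) * pP \<mu> n (of_real x) \<partial>\<mu>)
      = complex_of_real (\<integral>x. poly (real_orth_poly \<mu> m) x * poly (real_orth_poly \<mu> n) x \<partial>\<mu>)"
    unfolding pP_of_real of_real_mult[symmetric] by (rule integral_complex_of_real)
  then show ?thesis using orthonormal_real_orth_poly[OF assms] by (simp add: orthonormal_polys_def)
qed

lemma integrable_poly_complex_mult:
  "\<mu> \<in> M_star \<Longrightarrow> integrable \<mu> (\<lambda>x. poly p (complex_of_real x) * poly q (of_real x))"
  using integrable_poly_complex[of \<mu> "p * q"] by simp

lemma orth_poly_expansion:
  assumes mu: "\<mu> \<in> M_star" and low: "\<And>i. i \<ge> n \<Longrightarrow> coeff p i = 0"
  shows "p = (\<Sum>k<n. smult (\<integral>x. poly p (of_real x) * pP \<mu> k (of_real x) \<partial>\<mu>) (orth_poly \<mu> k))"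
proof -
  obtain c where c: "p = (\<Sum>k<n. smult (c k) (orth_poly \<mu> k))"
    using poly_graded_expansion[of "orth_poly \<mu>" n p] degree_orth_poly[OF mu] low by blast
  have "(\<integral>x. poly p (of_real x) * pP \<mu> k (of_real x) \<partial>\<mu>) = c k" if "k < n" for k
  proof -
    have "(\<integral>x. poly p (of_real x) * pP \<mu> k (of_real x) \<partial>\<mu>)
        = (\<Sum>j<n. c j * (\<integral>x. pP \<mu> j (of_real x) * pP \<mu> k (of_real x) \<partial>\<mu>))"
      unfolding c by (simp add: poly_sum sum_distrib_right mult.assoc integrable_poly_complex_mult[OF mu])
    then show ?thesis using that by (simp add: integral_orth_poly[OF mu] if_distrib cong: if_cong)
  qed
  then show ?thesis by (subst c) (auto intro!: sum.cong)
qed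

lemma integral_orth_poly_sum_sq:
  assumes mu: "\<mu> \<in> M_star"
  shows "(\<integral>x. (cmod (\<Sum>k<n. c k * pP \<mu> k (of_real x)))\<^sup>2 \<partial>\<mu>) = (\<Sum>k<n. (cmod (c k))\<^sup>2)"
proof -
  have "complex_of_real ((cmod (\<Sum>k<n. c k * pP \<mu> k (of_real x)))\<^sup>2)
      = (\<Sum>j<n. \<Sum>k<n. c j * cnj (c k) * (pP \<mu> j (of_real x) * pP \<mu> k (of_real x)))" for x
    unfolding complex_norm_square by (simp add: pP_of_real sum_product algebra_simps)
  then have "complex_of_real (\<integral>x. (cmod (\<Sum>k<n. c k * pP \<mu> k (of_real x)))\<^sup>2 \<partial>\<mu>)
      = (\<Sum>j<n. \<Sum>k<n. c j * cnj (c k) * (if j = k then 1 else 0))"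
    unfolding integral_complex_of_real[symmetric]
    by (simp add: integrable_poly_complex_mult[OF mu] integral_orth_poly[OF mu] del: of_real_power)
  also have "\<dots> = complex_of_real (\<Sum>k<n. (cmod (c k))\<^sup>2)"
    unfolding of_real_sum complex_norm_square
    by (intro sum.cong refl) (simp add: if_distrib cong: if_cong)
  finally show ?thesis by (simp only: of_real_eq_iff)
qed

lemma orth_poly_parseval:
  assumes mu: "\<mu> \<in> M_star" and low: "\<And>i. i \<ge> n \<Longrightarrow> coeff p i = 0"
  shows "(\<integral>x. (cmod (poly p (of_real x)))\<^sup>2 \<partial>\<mu>)
    = (\<Sum>k<n. (cmod (\<integral>x. poly p (of_real x) * pP \<mu> k (of_real x) \<partial>\<mu>))\<^sup>2)"
proof -
  define c where "c k = (\<integral>x. poly p (of_real x) * pP \<mu> k (of_real x) \<partial>\<mu>)" for k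
  have "poly p (of_real x) = (\<Sum>k<n. c k * pP \<mu> k (of_real x))" for x
    using arg_cong[OF orth_poly_expansion[OF mu, of n p], where f = "\<lambda>p. poly p (of_real x)"] low
    by (simp add: poly_sum c_def)
  then show ?thesis unfolding c_def[symmetric] by (simp add: integral_orth_poly_sum_sq[OF mu])
qed

text \<open>T is the orthogonal projection of g to the span of the first n orthonormal polynomials;
  the claim is 0 \<le> ||g - T||^2 multiplied out.\<close>

lemma orth_poly_bessel:
  assumes mu: "\<mu> \<in> M_star" and [measurable]: "g \<in> borel_measurable borel"
    and g: "integrable \<mu> (\<lambda>x. (cmod (g x))\<^sup>2)"
  shows "(\<Sum>k<n. (cmod (\<integral>x. g x * pP \<mu> k (of_real x) \<partial>\<mu>))\<^sup>2) \<le> (\<integral>x. (cmod (g x))\<^sup>2 \<partial>\<mu>)"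
proof -
  have [measurable]: "g \<in> borel_measurable \<mu>" "\<And>p. (\<lambda>x. poly p (complex_of_real x)) \<in> borel_measurable \<mu>"
    using assms(2) measurable_poly_complex by (simp_all add: M_star_measurable(1)[OF mu])
  define c where "c k = (\<integral>x. g x * pP \<mu> k (of_real x) \<partial>\<mu>)" for k
  define T where "T = (\<Sum>k<n. smult (c k) (orth_poly \<mu> k))"
  have T: "poly T z = (\<Sum>k<n. c k * pP \<mu> k z)" for z by (simp add: T_def poly_sum)
  have int: "integrable \<mu> (\<lambda>x. g x * poly p (of_real x))" for p
    by (intro integral_Cauchy_Schwarz(1) g integrable_cmod_poly_squared mu) simp_all
  have intT: "integrable \<mu> (\<lambda>x. g x * cnj (poly T (of_real x)))"
    using int[of "map_poly cnj T"] by (simp add: poly_map_poly_cnj)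
  have cross: "(\<integral>x. g x * cnj (poly T (of_real x)) \<partial>\<mu>) = of_real (\<Sum>k<n. (cmod (c k))\<^sup>2)"
  proof -
    have "g x * cnj (poly T (of_real x)) = (\<Sum>k<n. cnj (c k) * (g x * pP \<mu> k (of_real x)))" for x
      by (simp add: T pP_of_real sum_distrib_left algebra_simps)
    then have "(\<integral>x. g x * cnj (poly T (of_real x)) \<partial>\<mu>) = (\<Sum>k<n. cnj (c k) * c k)"
      using int by (simp add: c_def)
    then show ?thesis unfolding of_real_sum complex_norm_square by (simp add: mult.commute)
  qed
  have sq: "(cmod (g x - poly T (of_real x)))\<^sup>2
      = (cmod (g x))\<^sup>2 - 2 * Re (g x * cnj (poly T (of_real x))) + (cmod (poly T (of_real x)))\<^sup>2" for x
    unfolding cmod_power2 by (simp add: power2_eq_square algebra_simps)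
  have "0 \<le> (\<integral>x. (cmod (g x - poly T (of_real x)))\<^sup>2 \<partial>\<mu>)" by simp
  also have "\<dots> = (\<integral>x. (cmod (g x))\<^sup>2 \<partial>\<mu>) - 2 * Re (\<integral>x. g x * cnj (poly T (of_real x)) \<partial>\<mu>)
      + (\<integral>x. (cmod (poly T (of_real x)))\<^sup>2 \<partial>\<mu>)"
    unfolding sq using g intT integrable_cmod_poly_squared[OF mu, of T] integral_Re[OF intT] integrable_Re[OF intT]
    by (simp del: times_complex.sel)
  also have "(\<integral>x. (cmod (poly T (of_real x)))\<^sup>2 \<partial>\<mu>) = (\<Sum>k<n. (cmod (c k))\<^sup>2)"
    unfolding T by (rule integral_orth_poly_sum_sq[OF mu])
  finally show ?thesis unfolding cross c_def by simp
qed

section \<open>Bounded point evaluations\<close>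

definition bounded_eval :: "real measure \<Rightarrow> complex \<Rightarrow> bool" where
  "bounded_eval \<mu> z \<longleftrightarrow>
     (\<exists>C. \<forall>p. (cmod (poly p z))\<^sup>2 \<le> C * (\<integral>x. (cmod (poly p (complex_of_real x)))\<^sup>2 \<partial>\<mu>))"

text \<open>The natural constant is the reproducing kernel on the diagonal, the sum of |P_k(z)|^2.
  It bounds the evaluation by Cauchy-Schwarz in the orthonormal expansion, and its truncations are
  attained by the truncated kernels.\<close>

lemma bounded_eval_iff_summable:
  assumes mu: "\<mu> \<in> M_star"
  shows "bounded_eval \<mu> z \<longleftrightarrow> summable (\<lambda>k. (cmod (pP \<mu> k z))\<^sup>2)"
proof
  assume "bounded_eval \<mu> z"
  then obtain C where C: "\<And>p. (cmod (poly p z))\<^sup>2 \<le> C * (\<integral>x. (cmod (poly p (complex_of_real x)))\<^sup>2 \<partial>\<mu>)"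
    unfolding bounded_eval_def by blast
  have bound: "(\<Sum>k<n. (cmod (pP \<mu> k z))\<^sup>2) \<le> max C 0" for n
  proof -
    define S where "S = (\<Sum>k<n. (cmod (pP \<mu> k z))\<^sup>2)"
    \<comment> \<open>Truncated reproducing kernel at z: p(z) and the squared norm of p both equal
      S, so the hypothesis reads S^2 \<le> C S.\<close>
    define p where "p = (\<Sum>k<n. smult (cnj (pP \<mu> k z)) (orth_poly \<mu> k))"
    have p: "poly p y = (\<Sum>k<n. cnj (pP \<mu> k z) * pP \<mu> k y)" for y by (simp add: p_def poly_sum)
    have "poly p z = of_real S"
      unfolding p S_def of_real_sum complex_norm_square by (simp add: mult.commute)
    moreover have "(\<integral>x. (cmod (poly p (complex_of_real x)))\<^sup>2 \<partial>\<mu>) = S"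
      unfolding p integral_orth_poly_sum_sq[OF mu] by (simp add: S_def)
    ultimately have "S * S \<le> C * S" using C[of p] by (simp add: power2_eq_square)
    moreover have "S \<ge> 0" by (simp add: S_def sum_nonneg)
    ultimately have "S \<le> max C 0"
      using mult_right_le_imp_le[of S S C] by (cases "S = 0") (auto simp: le_max_iff_disj)
    then show ?thesis by (simp add: S_def)
  qed
  show "summable (\<lambda>k. (cmod (pP \<mu> k z))\<^sup>2)"
    by (rule summableI_nonneg_bounded[of _ "max C 0"]) (simp_all only: bound zero_le_power2)
next
  assume s: "summable (\<lambda>k. (cmod (pP \<mu> k z))\<^sup>2)"
  have "(cmod (poly p z))\<^sup>2 \<le> (\<Sum>k. (cmod (pP \<mu> k z))\<^sup>2) * (\<integral>x. (cmod (poly p (complex_of_real x)))\<^sup>2 \<partial>\<mu>)" for p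
  proof -
    define n where "n = Suc (degree p)"
    have low: "coeff p i = 0" if "i \<ge> n" for i using that by (simp add: n_def coeff_eq_0)
    define c where "c k = (\<integral>x. poly p (of_real x) * pP \<mu> k (of_real x) \<partial>\<mu>)" for k
    have "poly p z = (\<Sum>k<n. pP \<mu> k z * c k)"
      using arg_cong[OF orth_poly_expansion[OF mu, of n p], where f = "\<lambda>p. poly p z"] low
      by (simp add: poly_sum c_def mult.commute)
    then have "(cmod (poly p z))\<^sup>2 \<le> (\<Sum>k<n. (cmod (pP \<mu> k z))\<^sup>2) * (\<Sum>k<n. (cmod (c k))\<^sup>2)"
      using sum_Cauchy_Schwarz_cmod by metis
    also have "\<dots> \<le> (\<Sum>k. (cmod (pP \<mu> k z))\<^sup>2) * (\<Sum>k<n. (cmod (c k))\<^sup>2)"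
      using s by (intro mult_right_mono sum_le_suminf) (auto simp: sum_nonneg)
    also have "(\<Sum>k<n. (cmod (c k))\<^sup>2) = (\<integral>x. (cmod (poly p (complex_of_real x)))\<^sup>2 \<partial>\<mu>)"
      unfolding c_def by (rule orth_poly_parseval[OF mu low, symmetric])
    finally show ?thesis .
  qed
  then show "bounded_eval \<mu> z" unfolding bounded_eval_def by blast
qed

section \<open>Polynomials of the second kind and variation of constants\<close>

lemma poly_synthetic_div: "(x - c) * poly (synthetic_div p c) x = poly p x - poly p c"
  for c :: "'a::comm_ring_1"
  using arg_cong[OF synthetic_div_correct'[of c p], where f = "\<lambda>p. poly p x"] by (simp add: algebra_simps)

lemma coeff_synthetic_div_eq_0:
  assumes "degree p \<le> n" "i \<ge> n"
  shows "coeff (synthetic_div p (c::'a::comm_semiring_0)) i = 0"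
proof (cases "degree p = 0")
  case True
  then show ?thesis using synthetic_div_eq_0_iff[of p c] by simp
next
  case False
  then show ?thesis using assms by (intro coeff_eq_0) (simp add: degree_synthetic_div)
qed

lemma orth_poly_perp:
  assumes mu: "\<mu> \<in> M_star" and low: "\<And>i. i \<ge> n \<Longrightarrow> coeff p i = 0" and "n \<le> k"
  shows "(\<integral>x. poly p (of_real x) * pP \<mu> k (of_real x) \<partial>\<mu>) = 0"
proof -
  obtain c where c: "p = (\<Sum>k<n. smult (c k) (orth_poly \<mu> k))"
    using orth_poly_expansion[OF mu, of n p, OF low]
    by (rule that[of "\<lambda>k. \<integral>x. poly p (of_real x) * pP \<mu> k (of_real x) \<partial>\<mu>"])
  show ?thesis using \<open>n \<le> k\<close>
    unfolding c by (simp add: poly_sum sum_distrib_right mult.assoc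
        integrable_poly_complex_mult[OF mu] integral_orth_poly[OF mu])
qed

text \<open>The coefficients that carry solutions of the three-term recurrence from the spectral parameter
  \<open>c\<close> to another one (variation of constants), obtained here without the recurrence itself.\<close>

definition transfer_coeff :: "real measure \<Rightarrow> complex \<Rightarrow> nat \<Rightarrow> nat \<Rightarrow> complex" where
  "transfer_coeff \<mu> c k j = pQ \<mu> k c * pP \<mu> j c - pP \<mu> k c * pQ \<mu> j c"

text \<open>Write s_k for the difference quotient of P_k at c. Inserting P = P(c) + (y - c) s on
  both sides shows s_k P_j = P_j(c) s_k + s_j P_k - P_k(c) s_j. For j < k the middle product
  integrates to 0 by orthogonality, and the integrals of s_k and s_j are by definition Q_k(c) and
  Q_j(c).\<close>

lemma synthetic_div_orth_poly:
  assumes mu: "\<mu> \<in> M_star"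
  shows "synthetic_div (orth_poly \<mu> k) c = (\<Sum>j<k. smult (transfer_coeff \<mu> c k j) (orth_poly \<mu> j))"
proof -
  let ?s = "\<lambda>k. synthetic_div (orth_poly \<mu> k) c"
  have low: "coeff (?s j) i = 0" if "i \<ge> j" for i j
    using that degree_orth_poly[OF mu] by (intro coeff_synthetic_div_eq_0[of _ j]) auto
  have "(\<integral>x. poly (?s k) (of_real x) * pP \<mu> j (of_real x) \<partial>\<mu>) = transfer_coeff \<mu> c k j" if "j < k" for j
  proof -
    have eq: "poly (?s k) y * pP \<mu> j y
        = pP \<mu> j c * poly (?s k) y + (poly (?s j) y * pP \<mu> k y - pP \<mu> k c * poly (?s j) y)" for y
    proof -
      have j: "pP \<mu> j y = pP \<mu> j c + (y - c) * poly (?s j) y"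
        and k: "pP \<mu> k y = pP \<mu> k c + (y - c) * poly (?s k) y"
        by (simp_all add: poly_synthetic_div)
      show ?thesis unfolding j k by (simp only: algebra_simps)
    qed
    have perp: "(\<integral>x. poly (?s j) (of_real x) * pP \<mu> k (of_real x) \<partial>\<mu>) = 0"
      by (rule orth_poly_perp[of \<mu> j, OF mu low]) (use that in auto)
    show ?thesis unfolding eq transfer_coeff_def pQ_def
      by (simp add: perp integrable_poly_complex[OF mu] integrable_poly_complex_mult[OF mu])
  qed
  then have "(\<Sum>j<k. smult (\<integral>x. poly (?s k) (of_real x) * pP \<mu> j (of_real x) \<partial>\<mu>) (orth_poly \<mu> j))
      = (\<Sum>j<k. smult (transfer_coeff \<mu> c k j) (orth_poly \<mu> j))"
    by (intro sum.cong refl) simp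
  with orth_poly_expansion[of \<mu> k "?s k", OF mu low] show ?thesis by (rule trans)
qed

lemma pP_transfer:
  assumes mu: "\<mu> \<in> M_star"
  shows "pP \<mu> k z = pP \<mu> k c + (z - c) * (\<Sum>j<k. transfer_coeff \<mu> c k j * pP \<mu> j z)"
  using poly_synthetic_div[of z c "orth_poly \<mu> k"]
  by (simp add: synthetic_div_orth_poly[OF mu] poly_sum)

text \<open>Difference quotient at z of the identity for P: R is what that identity predicts for
  \<open>synthetic_div (orth_poly \<mu> k) z\<close>, and the two agree after multiplication by y -
  z. Integrating R gives the claim.\<close>

lemma pQ_transfer:
  assumes mu: "\<mu> \<in> M_star"
  shows "pQ \<mu> k z = pQ \<mu> k c + (z - c) * (\<Sum>j<k. transfer_coeff \<mu> c k j * pQ \<mu> j z)"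
proof -
  let ?t = "transfer_coeff \<mu> c k"
  define R where "R = synthetic_div (orth_poly \<mu> k) c
    + smult (z - c) (\<Sum>j<k. smult (?t j) (synthetic_div (orth_poly \<mu> j) z))"
  have "poly ([:-z, 1:] * synthetic_div (orth_poly \<mu> k) z) y = poly ([:-z, 1:] * R) y" for y
  proof -
    define D where "D = poly (synthetic_div (orth_poly \<mu> k) c) y"
    have D: "D = (\<Sum>j<k. ?t j * pP \<mu> j y)"
      by (simp add: D_def synthetic_div_orth_poly[OF mu] poly_sum)
    have D': "(y - c) * D = pP \<mu> k y - pP \<mu> k c"
      by (simp add: D_def poly_synthetic_div)
    have "poly ([:-z, 1:] * R) y
        = (y - z) * D + (z - c) * (\<Sum>j<k. ?t j * ((y - z) * poly (synthetic_div (orth_poly \<mu> j) z) y))"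
      by (simp add: R_def D_def poly_sum sum_distrib_left algebra_simps)
    also have "\<dots> = (y - z) * D + (z - c) * D - (z - c) * (\<Sum>j<k. ?t j * pP \<mu> j z)"
      unfolding poly_synthetic_div D by (simp add: sum_subtractf algebra_simps sum_distrib_left)
    also have "\<dots> = (pP \<mu> k y - pP \<mu> k c) - (pP \<mu> k z - pP \<mu> k c)"
      unfolding D'[symmetric] pP_transfer[OF mu, of k z c] by (simp add: algebra_simps)
    also have "\<dots> = poly ([:-z, 1:] * synthetic_div (orth_poly \<mu> k) z) y"
      using poly_synthetic_div[of y z "orth_poly \<mu> k"] by (simp add: algebra_simps)
    finally show ?thesis ..
  qed
  then have "[:-z, 1:] * synthetic_div (orth_poly \<mu> k) z = [:-z, 1:] * R"
    using poly_eq_poly_eq_iff by blast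
  then have R: "synthetic_div (orth_poly \<mu> k) z = R"
    using mult_left_cancel[of "[:-z, 1:]"] by (metis one_neq_zero pCons_eq_0_iff)
  show ?thesis
    unfolding pQ_def[of _ k z] R
    by (simp add: R_def pQ_def poly_sum integrable_poly_complex[OF mu])
qed

lemma discrete_gronwall:
  fixes s u e :: "nat \<Rightarrow> real"
  assumes s: "\<And>k. s k \<ge> 0" and e: "\<And>k. e k \<ge> 0" and u: "\<And>k. u k \<ge> 0"
    and step: "\<And>k. s k \<le> u k + e k * (\<Sum>j<k. s j)"
  shows "(\<Sum>k<n. s k) \<le> exp (\<Sum>k<n. u k + e k)"
proof -
  \<comment> \<open>The added 1 lets the inhomogeneous term u n be absorbed in the growth factor: 1
    + S + u + e S \<le> (1 + S)(1 + u + e) for nonnegative S, u, e.\<close>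
  have "1 + (\<Sum>k<n. s k) \<le> exp (\<Sum>k<n. u k + e k)"
  proof (induction n)
    case (Suc n)
    let ?S = "\<Sum>k<n. s k"
    have "1 + (\<Sum>k<Suc n. s k) \<le> 1 + ?S + u n + e n * ?S" using step[of n] by simp
    also have "\<dots> \<le> (1 + ?S) * (1 + (u n + e n))"
      using e[of n] u[of n] sum_nonneg[of "{..<n}" s] s by (simp add: algebra_simps)
    also have "\<dots> \<le> exp (\<Sum>k<n. u k + e k) * exp (u n + e n)"
      using Suc exp_ge_add_one_self[of "u n + e n"] e[of n] u[of n] by (intro mult_mono) auto
    finally show ?case by (simp add: exp_add mult.commute)
  qed simp
  then show ?thesis by linarith
qed

text \<open>Cauchy-Schwarz on each half of the kernel q_k p_j - p_k q_j bounds |U_k - u_k|^2 by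
  |h|^2 E_k times the partial sum of |U_j|^2. As E is summable, Gronwall applies. The bound on U
  depends on r but not on h, and the difference is of order |h|; both uniformities are needed when
  the spectral parameter tends to 0.\<close>

lemma transfer_square_summable:
  fixes p q u U :: "nat \<Rightarrow> complex"
  assumes p: "summable (\<lambda>k. (cmod (p k))\<^sup>2)" and q: "summable (\<lambda>k. (cmod (q k))\<^sup>2)"
    and u: "summable (\<lambda>k. (cmod (u k))\<^sup>2)"
  defines "E \<equiv> \<lambda>k. 2 * ((cmod (q k))\<^sup>2 * (\<Sum>j. (cmod (p j))\<^sup>2) + (cmod (p k))\<^sup>2 * (\<Sum>j. (cmod (q j))\<^sup>2))"
  assumes U: "\<And>k. U k = u k + h * (\<Sum>j<k. (q k * p j - p k * q j) * U j)" and h: "cmod h \<le> r"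
  shows "summable (\<lambda>k. (cmod (U k))\<^sup>2)"
    and "(\<Sum>k. (cmod (U k))\<^sup>2) \<le> exp (\<Sum>k. 2 * (cmod (u k))\<^sup>2 + 2 * r\<^sup>2 * E k)"
    and "summable (\<lambda>k. (cmod (U k - u k))\<^sup>2)"
    and "(\<Sum>k. (cmod (U k - u k))\<^sup>2)
      \<le> (cmod h)\<^sup>2 * ((\<Sum>k. E k) * exp (\<Sum>k. 2 * (cmod (u k))\<^sup>2 + 2 * r\<^sup>2 * E k))"
proof -
  have E0: "E k \<ge> 0" for k unfolding E_def using p q by (simp add: suminf_nonneg)
  have sE: "summable E" unfolding E_def by (intro summable_mult summable_add summable_mult2 p q)
  define S where "S k = (\<Sum>j<k. (cmod (U j))\<^sup>2)" for k
  have S0: "S k \<ge> 0" for k by (simp add: S_def sum_nonneg)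
  have par: "(cmod (a + b))\<^sup>2 \<le> 2 * (cmod a)\<^sup>2 + 2 * (cmod b)\<^sup>2" for a b :: complex
  proof -
    have "(cmod (a + b))\<^sup>2 \<le> (cmod a + cmod b)\<^sup>2" by (simp add: norm_triangle_ineq power_mono)
    also have "\<dots> \<le> 2 * (cmod a)\<^sup>2 + 2 * (cmod b)\<^sup>2"
      using sum_squares_bound[of "cmod a" "cmod b"] by (simp add: power2_sum)
    finally show ?thesis .
  qed
  have diff: "(cmod (U k - u k))\<^sup>2 \<le> (cmod h)\<^sup>2 * (E k * S k)" for k
  proof -
    have cs: "(cmod (\<Sum>j<k. v j * U j))\<^sup>2 \<le> (\<Sum>j. (cmod (v j))\<^sup>2) * S k"
      if "summable (\<lambda>k. (cmod (v k))\<^sup>2)" for v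
      unfolding S_def using that
      by (intro order_trans[OF sum_Cauchy_Schwarz_cmod] mult_right_mono sum_le_suminf) (auto simp: sum_nonneg)
    have "(\<Sum>j<k. (q k * p j - p k * q j) * U j)
        = q k * (\<Sum>j<k. p j * U j) + - (p k * (\<Sum>j<k. q j * U j))"
      by (simp add: sum_subtractf sum_distrib_left algebra_simps)
    then have "(cmod (\<Sum>j<k. (q k * p j - p k * q j) * U j))\<^sup>2
        \<le> 2 * ((cmod (q k))\<^sup>2 * (cmod (\<Sum>j<k. p j * U j))\<^sup>2) + 2 * ((cmod (p k))\<^sup>2 * (cmod (\<Sum>j<k. q j * U j))\<^sup>2)"
      using par[of "q k * (\<Sum>j<k. p j * U j)" "- (p k * (\<Sum>j<k. q j * U j))"]
      by (simp add: norm_mult power_mult_distrib)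
    also have "\<dots> \<le> 2 * ((cmod (q k))\<^sup>2 * ((\<Sum>j. (cmod (p j))\<^sup>2) * S k))
        + 2 * ((cmod (p k))\<^sup>2 * ((\<Sum>j. (cmod (q j))\<^sup>2) * S k))"
      by (intro add_mono mult_left_mono cs p q) auto
    also have "\<dots> = E k * S k" by (simp add: E_def algebra_simps)
    finally have "(cmod h)\<^sup>2 * (cmod (\<Sum>j<k. (q k * p j - p k * q j) * U j))\<^sup>2 \<le> (cmod h)\<^sup>2 * (E k * S k)"
      by (intro mult_left_mono) auto
    then show ?thesis by (subst U) (simp add: norm_mult power_mult_distrib)
  qed
  have hr: "(cmod h)\<^sup>2 \<le> r\<^sup>2" using h by (simp add: power_mono)
  let ?X = "\<Sum>k. 2 * (cmod (u k))\<^sup>2 + 2 * r\<^sup>2 * E k"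
  have step: "(cmod (U k))\<^sup>2 \<le> 2 * (cmod (u k))\<^sup>2 + 2 * r\<^sup>2 * E k * (\<Sum>j<k. (cmod (U j))\<^sup>2)" for k
  proof -
    have "(cmod (U k))\<^sup>2 \<le> 2 * (cmod (u k))\<^sup>2 + 2 * (cmod (U k - u k))\<^sup>2"
      using par[of "u k" "U k - u k"] by simp
    also have "\<dots> \<le> 2 * (cmod (u k))\<^sup>2 + 2 * (r\<^sup>2 * (E k * S k))"
      using diff[of k] mult_right_mono[OF hr, of "E k * S k"] E0[of k] S0[of k] by auto
    finally show ?thesis by (simp add: S_def mult.assoc)
  qed
  have SX: "S n \<le> exp ?X" for n
  proof -
    have "S n \<le> exp (\<Sum>k<n. 2 * (cmod (u k))\<^sup>2 + 2 * r\<^sup>2 * E k)"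
      unfolding S_def by (rule discrete_gronwall) (use E0 step in auto)
    also have "\<dots> \<le> exp ?X"
      using E0 by (auto intro!: sum_le_suminf summable_add summable_mult u sE)
    finally show ?thesis .
  qed
  show sU: "summable (\<lambda>k. (cmod (U k))\<^sup>2)"
    using SX by (intro summableI_nonneg_bounded[of _ "exp ?X"]) (simp_all add: S_def)
  show "(\<Sum>k. (cmod (U k))\<^sup>2) \<le> exp ?X"
    using SX by (intro suminf_le_const sU) (simp add: S_def)
  have d: "(cmod (U k - u k))\<^sup>2 \<le> (cmod h)\<^sup>2 * exp ?X * E k" for k
    using order_trans[OF diff[of k] mult_left_mono[OF mult_left_mono[OF SX E0]]] by (simp add: mult_ac)
  have sd: "summable (\<lambda>k. (cmod h)\<^sup>2 * exp ?X * E k)" by (intro summable_mult sE)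
  show sUu: "summable (\<lambda>k. (cmod (U k - u k))\<^sup>2)"
    using d by (intro summable_comparison_test'[OF sd]) simp
  have "(\<Sum>k. (cmod (U k - u k))\<^sup>2) \<le> (\<Sum>k. (cmod h)\<^sup>2 * exp ?X * E k)"
    by (intro suminf_le d sUu sd)
  also have "\<dots> = (cmod h)\<^sup>2 * exp ?X * (\<Sum>k. E k)" by (rule suminf_mult[OF sE])
  finally show "(\<Sum>k. (cmod (U k - u k))\<^sup>2) \<le> (cmod h)\<^sup>2 * ((\<Sum>k. E k) * exp ?X)"
    by (simp add: mult_ac)
qed

lemma square_summable_transfer:
  assumes mu: "\<mu> \<in> M_star"
    and P: "summable (\<lambda>k. (cmod (pP \<mu> k c))\<^sup>2)" and Q: "summable (\<lambda>k. (cmod (pQ \<mu> k c))\<^sup>2)"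
  shows "summable (\<lambda>k. (cmod (pP \<mu> k z))\<^sup>2)" "summable (\<lambda>k. (cmod (pQ \<mu> k z))\<^sup>2)"
  using transfer_square_summable(1)[OF P Q P pP_transfer[OF mu, of _ z c, unfolded transfer_coeff_def] order_refl]
    transfer_square_summable(1)[OF P Q Q pQ_transfer[OF mu, of _ z c, unfolded transfer_coeff_def] order_refl]
  by blast+

section \<open>The Cauchy kernel\<close>

lemma cmod_inverse_diff_le:
  assumes "z \<notin> \<real>"
  shows "cmod (1 / (complex_of_real x - z)) \<le> 1 / \<bar>Im z\<bar>"
proof -
  have "\<bar>Im z\<bar> > 0" using assms by (simp add: complex_is_Real_iff)
  moreover have "\<bar>Im z\<bar> \<le> cmod (complex_of_real x - z)"
    using abs_Im_le_cmod[of "complex_of_real x - z"] by simp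
  ultimately show ?thesis by (simp add: norm_divide frac_le)
qed

lemma measurable_cauchy_kernel [measurable]:
  "(\<lambda>x. 1 / (complex_of_real x - z)) \<in> borel_measurable borel"
  by measurable

lemma integrable_cauchy_kernel:
  assumes mu: "\<mu> \<in> M_star" and z: "z \<notin> \<real>"
  shows "integrable \<mu> (\<lambda>x. 1 / (complex_of_real x - z))"
    "integrable \<mu> (\<lambda>x. (cmod (1 / (complex_of_real x - z)))\<^sup>2)"
    "integrable \<mu> (\<lambda>x. poly p (of_real x) * (1 / (complex_of_real x - z)))"
proof -
  interpret finite_measure \<mu> by (rule M_star_finite_measure[OF mu])
  have [measurable]: "(\<lambda>x. 1 / (complex_of_real x - z)) \<in> borel_measurable \<mu>"
    "(\<lambda>x. poly p (complex_of_real x)) \<in> borel_measurable \<mu>"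
    using measurable_cauchy_kernel measurable_poly_complex by (simp_all only: M_star_measurable(1)[OF mu])
  show "integrable \<mu> (\<lambda>x. 1 / (complex_of_real x - z))"
    using cmod_inverse_diff_le[OF z] by (intro integrable_const_bound[where B = "1 / \<bar>Im z\<bar>"]) auto
  show i: "integrable \<mu> (\<lambda>x. (cmod (1 / (complex_of_real x - z)))\<^sup>2)"
    using power_mono[OF cmod_inverse_diff_le[OF z] norm_ge_zero, of _ 2]
    by (intro integrable_const_bound[where B = "(1 / \<bar>Im z\<bar>)\<^sup>2"]) auto
  show "integrable \<mu> (\<lambda>x. poly p (of_real x) * (1 / (complex_of_real x - z)))"
    by (intro integral_Cauchy_Schwarz(1) i integrable_cmod_poly_squared mu) simp_all
qed

lemma integral_poly_cauchy_kernel: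
  assumes mu: "\<mu> \<in> M_star" and z: "z \<notin> \<real>"
  shows "(\<integral>x. poly p (of_real x) * (1 / (complex_of_real x - z)) \<partial>\<mu>)
    = (\<integral>x. poly (synthetic_div p z) (of_real x) \<partial>\<mu>) + poly p z * stieltjes \<mu> z"
proof -
  have "poly p (of_real x) * (1 / (complex_of_real x - z))
      = poly (synthetic_div p z) (of_real x) + poly p z * (1 / (complex_of_real x - z))" for x
  proof -
    have "complex_of_real x - z \<noteq> 0" using z by (metis Reals_of_real eq_iff_diff_eq_0)
    then show ?thesis using poly_synthetic_div[of "of_real x" z p] by (simp add: field_simps)
  qed
  then show ?thesis unfolding stieltjes_def
    by (simp only: Bochner_Integration.integral_add integral_mult_right_zero
        integrable_poly_complex[OF mu] integrable_mult_right integrable_cauchy_kernel(1)[OF mu z])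
qed

text \<open>Q_k(z) + w(z) P_k(z), with w the Stieltjes transform, is the Fourier coefficient of the
  Cauchy kernel. Bessel makes it square summable, and subtracting w(z) P_k(z) leaves Q_k(z).\<close>

lemma square_summable_pQ_nonreal:
  assumes mu: "\<mu> \<in> M_star" and z: "z \<notin> \<real>" and P: "summable (\<lambda>k. (cmod (pP \<mu> k z))\<^sup>2)"
  shows "summable (\<lambda>k. (cmod (pQ \<mu> k z))\<^sup>2)"
proof -
  define c where "c k = (\<integral>x. 1 / (complex_of_real x - z) * pP \<mu> k (of_real x) \<partial>\<mu>)" for k
  have sc: "summable (\<lambda>k. (cmod (c k))\<^sup>2)"
    using orth_poly_bessel[OF mu measurable_cauchy_kernel integrable_cauchy_kernel(2)[OF mu z]]
    unfolding c_def[symmetric] by (intro summableI_nonneg_bounded) simp_all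
  have "pQ \<mu> k z = c k + (- stieltjes \<mu> z) * pP \<mu> k z" for k
    using integral_poly_cauchy_kernel[OF mu z, of "orth_poly \<mu> k"]
    by (simp add: c_def pQ_def mult.commute)
  moreover have "summable (\<lambda>k. (cmod ((- stieltjes \<mu> z) * pP \<mu> k z))\<^sup>2)"
    unfolding norm_mult power_mult_distrib by (intro summable_mult P)
  ultimately show ?thesis using summable_cmod_add_sq[OF sc] by presburger
qed

lemma bounded_eval_nonreal_imp_square_summable:
  assumes mu: "\<mu> \<in> M_star" and c: "c \<notin> \<real>" "bounded_eval \<mu> c"
  shows "summable (\<lambda>k. (cmod (pP \<mu> k z))\<^sup>2)" "summable (\<lambda>k. (cmod (pQ \<mu> k z))\<^sup>2)"
proof -
  have P: "summable (\<lambda>k. (cmod (pP \<mu> k c))\<^sup>2)" using c bounded_eval_iff_summable[OF mu] by blast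
  show "summable (\<lambda>k. (cmod (pP \<mu> k z))\<^sup>2)" "summable (\<lambda>k. (cmod (pQ \<mu> k z))\<^sup>2)"
    by (rule square_summable_transfer[OF mu P square_summable_pQ_nonreal[OF mu c(1) P]])+
qed

lemma bounded_eval_nonreal_imp_bounded_eval:
  assumes "\<mu> \<in> M_star" "c \<notin> \<real>" "bounded_eval \<mu> c"
  shows "bounded_eval \<mu> z"
  using bounded_eval_nonreal_imp_square_summable(1)[OF assms] bounded_eval_iff_summable[OF assms(1)] by blast

section \<open>Indeterminacy implies bounded point evaluations\<close>

lemma Im_cauchy_kernel: "Im (1 / (complex_of_real x - Complex t y)) = y / ((t - x)\<^sup>2 + y\<^sup>2)"
  by (simp add: Im_divide power2_commute)

lemma nn_integral_arctan_diff:
  fixes \<mu> :: "real measure"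
  assumes fin: "finite_measure \<mu>" and sets: "sets \<mu> = sets borel" and y: "y > 0" and ab: "a \<le> b"
  shows "(\<integral>\<^sup>+x. ennreal (arctan ((b - x) / y) - arctan ((a - x) / y)) \<partial>\<mu>)
    = (\<integral>\<^sup>+t. ennreal (Im (stieltjes \<mu> (Complex t y))) * indicator {a..b} t \<partial>lborel)"
proof -
  interpret finite_measure \<mu> by fact
  interpret pair_sigma_finite lborel \<mu> ..
  note [measurable_cong] = sets
  let ?k = "\<lambda>t x. y / ((t - x)\<^sup>2 + y\<^sup>2)"
  have pos: "(t - x)\<^sup>2 + y\<^sup>2 > 0" for t x using y by (simp add: sum_power2_gt_zero_iff)
  have k0: "?k t x \<ge> 0" for t x using y pos[of t x] by simp
  have "(\<integral>\<^sup>+t. ennreal (?k t x) * indicator {a..b} t \<partial>lborel) = ennreal (arctan ((b - x) / y) - arctan ((a - x) / y))" for x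
  proof (rule nn_integral_FTC_Icc)
    fix t
    have "((\<lambda>t. arctan ((t - x) / y)) has_real_derivative (1 / y) / (1 + ((t - x) / y)\<^sup>2)) (at t)"
      by (auto intro!: derivative_eq_intros simp: divide_inverse)
    moreover have "(1 / y) / (1 + ((t - x) / y)\<^sup>2) = ?k t x"
      using y pos[of t x] by (simp add: field_simps power2_eq_square)
    ultimately show "((\<lambda>t. arctan ((t - x) / y)) has_real_derivative ?k t x) (at t)" by simp
  qed (use k0 ab in auto)
  then have "(\<integral>\<^sup>+x. ennreal (arctan ((b - x) / y) - arctan ((a - x) / y)) \<partial>\<mu>)
      = (\<integral>\<^sup>+x. \<integral>\<^sup>+t. ennreal (?k t x) * indicator {a..b} t \<partial>lborel \<partial>\<mu>)" by simp
  also have "\<dots> = (\<integral>\<^sup>+t. \<integral>\<^sup>+x. ennreal (?k t x) * indicator {a..b} t \<partial>\<mu> \<partial>lborel)"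
    by (rule Fubini') measurable
  also have "\<dots> = (\<integral>\<^sup>+t. ennreal (Im (stieltjes \<mu> (Complex t y))) * indicator {a..b} t \<partial>lborel)"
  proof (rule nn_integral_cong)
    fix t
    have z: "Complex t y \<notin> \<real>" using y by (simp add: complex_is_Real_iff)
    have i: "integrable \<mu> (\<lambda>x. 1 / (complex_of_real x - Complex t y))"
      using cmod_inverse_diff_le[OF z] by (intro integrable_const_bound[where B = "1 / \<bar>Im (Complex t y)\<bar>"]) auto
    have "(\<integral>\<^sup>+x. ennreal (?k t x) \<partial>\<mu>) = ennreal (\<integral>x. ?k t x \<partial>\<mu>)"
      using integrable_Im[OF i] k0 unfolding Im_cauchy_kernel by (intro nn_integral_eq_integral) auto
    also have "(\<integral>x. ?k t x \<partial>\<mu>) = Im (stieltjes \<mu> (Complex t y))"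
      unfolding stieltjes_def Im_cauchy_kernel[symmetric] by (rule integral_Im[OF i])
    finally show "(\<integral>\<^sup>+x. ennreal (?k t x) * indicator {a..b} t \<partial>\<mu>)
        = ennreal (Im (stieltjes \<mu> (Complex t y))) * indicator {a..b} t"
      by (simp add: nn_integral_multc)
  qed
  finally show ?thesis .
qed

text \<open>The height 1/n^2 is much smaller than the shift 1/n of the left endpoint. Hence x = b
  lies on the side where both arctangents tend to pi/2, and the limit is the indicator of the open
  ray with no half weight for an atom at b.\<close>

lemma arctan_step_limit:
  "(\<lambda>n. arctan ((real n - x) / (1 / (real n)\<^sup>2)) - arctan ((b + 1 / real n - x) / (1 / (real n)\<^sup>2)))
     \<longlonglongrightarrow> pi * indicator {b<..} x"
proof -
  have 1: "(\<lambda>n. arctan ((real n - x) / (1 / (real n)\<^sup>2))) \<longlonglongrightarrow> pi / 2"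
    by (rule filterlim_compose[OF tendsto_arctan_at_top]) real_asymp
  show ?thesis
  proof (cases "b < x")
    case True
    then have "x - b > 0" by simp
    then have "filterlim (\<lambda>n. - (x - b - 1 / real n) * (real n)\<^sup>2) at_bot sequentially" by real_asymp
    then have "(\<lambda>n. arctan ((b + 1 / real n - x) / (1 / (real n)\<^sup>2))) \<longlonglongrightarrow> - (pi / 2)"
      by (intro filterlim_compose[OF tendsto_arctan_at_bot]) (simp add: algebra_simps)
    from tendsto_diff[OF 1 this] True show ?thesis by simp
  next
    case False
    have "filterlim (\<lambda>n. (b + 1 / real n - x) / (1 / (real n)\<^sup>2)) at_top sequentially"
    proof (rule filterlim_at_top_mono)
      show "filterlim (\<lambda>n. real n) at_top sequentially" by real_asymp
      show "eventually (\<lambda>n. real n \<le> (b + 1 / real n - x) / (1 / (real n)\<^sup>2)) sequentially"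
      proof (rule eventually_mono[OF eventually_gt_at_top[of 0]])
        fix n :: nat assume "n > 0"
        then show "real n \<le> (b + 1 / real n - x) / (1 / (real n)\<^sup>2)"
          using False by (simp add: field_simps power2_eq_square)
      qed
    qed
    then have "(\<lambda>n. arctan ((b + 1 / real n - x) / (1 / (real n)\<^sup>2))) \<longlonglongrightarrow> pi / 2"
      by (rule filterlim_compose[OF tendsto_arctan_at_top])
    from tendsto_diff[OF 1 this] False show ?thesis by simp
  qed
qed

lemma stieltjes_inversion:
  fixes \<mu> :: "real measure"
  assumes fin: "finite_measure \<mu>" and sets: "sets \<mu> = sets borel"
  shows "(\<lambda>n. enn2real (\<integral>\<^sup>+t. ennreal (Im (stieltjes \<mu> (Complex t (1 / (real n)\<^sup>2))))
            * indicator {b + 1 / real n..real n} t \<partial>lborel)) \<longlonglongrightarrow> pi * measure \<mu> {b<..}"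
proof -
  interpret finite_measure \<mu> by fact
  note [measurable_cong] = sets
  let ?g = "\<lambda>n x. arctan ((real n - x) / (1 / (real n)\<^sup>2)) - arctan ((b + 1 / real n - x) / (1 / (real n)\<^sup>2))"
  have bd: "\<bar>?g n x\<bar> \<le> pi" for n x
    using arctan_bounded[of "(real n - x) / (1 / (real n)\<^sup>2)"]
      arctan_bounded[of "(b + 1 / real n - x) / (1 / (real n)\<^sup>2)"] by (simp only: abs_le_iff) linarith
  have lim: "(\<lambda>n. \<integral>x. ?g n x \<partial>\<mu>) \<longlonglongrightarrow> (\<integral>x. pi * indicator {b<..} x \<partial>\<mu>)"
    by (rule integral_dominated_convergence[where w = "\<lambda>_. pi"])
       (use bd arctan_step_limit in \<open>auto simp del: divide_divide_eq_right\<close>)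
  have val: "(\<integral>x. pi * indicator {b<..} x \<partial>\<mu>) = pi * measure \<mu> {b<..}"
    using sets by simp
  have ev: "eventually (\<lambda>n. (\<integral>x. ?g n x \<partial>\<mu>) = enn2real (\<integral>\<^sup>+t. ennreal (Im (stieltjes \<mu> (Complex t (1 / (real n)\<^sup>2))))
            * indicator {b + 1 / real n..real n} t \<partial>lborel)) sequentially"
  proof -
    have "eventually (\<lambda>n. b + 1 / real n \<le> real n) sequentially" by real_asymp
    then show ?thesis using eventually_gt_at_top[of 0]
    proof eventually_elim
      fix n :: nat assume n: "b + 1 / real n \<le> real n" "0 < n"
      have g0: "?g n x \<ge> 0" for x
        using n by (intro diff_ge_0_iff_ge[THEN iffD2] arctan_monotone' divide_right_mono) auto
      have "(\<integral>x. ?g n x \<partial>\<mu>) = enn2real (\<integral>\<^sup>+x. ennreal (?g n x) \<partial>\<mu>)"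
        using g0 by (intro integral_eq_nn_integral) auto
      also have "\<dots> = enn2real (\<integral>\<^sup>+t. ennreal (Im (stieltjes \<mu> (Complex t (1 / (real n)\<^sup>2))))
            * indicator {b + 1 / real n..real n} t \<partial>lborel)"
        using n by (subst nn_integral_arctan_diff[OF fin sets]) auto
      finally show "(\<integral>x. ?g n x \<partial>\<mu>) = enn2real (\<integral>\<^sup>+t. ennreal (Im (stieltjes \<mu> (Complex t (1 / (real n)\<^sup>2))))
            * indicator {b + 1 / real n..real n} t \<partial>lborel)" .
    qed
  qed
  show ?thesis by (rule Lim_transform_eventually[OF lim[unfolded val] ev])
qed

lemma stieltjes_unique:
  fixes \<mu> \<nu> :: "real measure"
  assumes fin: "finite_measure \<mu>" "finite_measure \<nu>" and sets: "sets \<mu> = sets borel" "sets \<nu> = sets borel"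
    and eq: "\<And>z. z \<notin> \<real> \<Longrightarrow> stieltjes \<mu> z = stieltjes \<nu> z"
  shows "\<mu> = \<nu>"
proof (rule measure_eqI_lessThan[OF sets])
  interpret m: finite_measure \<mu> by fact
  interpret n: finite_measure \<nu> by fact
  fix b :: real
  show "emeasure \<mu> {b<..} < \<infinity>" by (simp add: less_top[symmetric])
  have e: "eventually (\<lambda>n::nat. enn2real (\<integral>\<^sup>+t. ennreal (Im (stieltjes \<mu> (Complex t (1 / (real n)\<^sup>2))))
            * indicator {b + 1 / real n..real n} t \<partial>lborel)
      = enn2real (\<integral>\<^sup>+t. ennreal (Im (stieltjes \<nu> (Complex t (1 / (real n)\<^sup>2))))
            * indicator {b + 1 / real n..real n} t \<partial>lborel)) sequentially"
    using eventually_gt_at_top[of 0]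
    by eventually_elim (simp add: eq complex_is_Real_iff)
  have "pi * measure \<mu> {b<..} = pi * measure \<nu> {b<..}"
    by (rule LIMSEQ_unique[OF stieltjes_inversion[OF fin(1) sets(1)]
          Lim_transform_eventually[OF stieltjes_inversion[OF fin(2) sets(2)]]])
       (use e in \<open>auto elim: eventually_mono\<close>)
  then show "emeasure \<mu> {b<..} = emeasure \<nu> {b<..}"
    by (simp add: m.emeasure_eq_measure n.emeasure_eq_measure)
qed

lemma integral_poly_complex_eq:
  assumes mu: "\<mu> \<in> M_star" and nu: "\<nu> \<in> M_star" and mom: "\<And>n. moment \<nu> n = moment \<mu> n"
  shows "(\<integral>x. poly p (complex_of_real x) \<partial>\<nu>) = (\<integral>x. poly p (complex_of_real x) \<partial>\<mu>)"
proof -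
  have "(\<integral>x. poly p (complex_of_real x) \<partial>m) = (\<Sum>i\<le>degree p. coeff p i * of_real (moment m i))"
    if m: "m \<in> M_star" for m
  proof -
    have "integrable m (\<lambda>x. complex_of_real (x ^ n))" for n
      using m unfolding M_star_def by (intro integrable_of_real) blast
    then show ?thesis unfolding poly_altdef moment_def of_real_power[symmetric]
      by (simp add: Bochner_Integration.integral_sum del: of_real_power)
  qed
  then show ?thesis using mu nu mom by simp
qed

text \<open>For two solutions the integrals of p(x)/(x - z) differ exactly by p(z) times the
  difference G of the Stieltjes transforms, since the remaining terms are integrals of one
  polynomial. Cauchy-Schwarz bounds each integral by the norm of p, which is the same for both
  measures. Stieltjes inversion supplies a nonreal z with G nonzero.\<close>

lemma indeterminate_imp_bounded_eval:
  assumes "\<mu> \<in> M_star_i"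
  shows "\<exists>z. z \<notin> \<real> \<and> bounded_eval \<mu> z"
proof -
  from assms obtain \<nu> where mu: "\<mu> \<in> M_star" and nu: "\<nu> \<in> M_star"
    and mom: "\<And>n. moment \<nu> n = moment \<mu> n" and ne: "\<nu> \<noteq> \<mu>"
    by (auto simp: M_star_i_def M_star_d_def)
  have "\<not> (\<forall>z. z \<notin> \<real> \<longrightarrow> stieltjes \<nu> z = stieltjes \<mu> z)"
    using stieltjes_unique[OF nu[THEN M_star_finite_measure] mu[THEN M_star_finite_measure]] mu nu ne
    by (auto simp: M_star_def)
  then obtain z where z: "z \<notin> \<real>" and G: "stieltjes \<nu> z - stieltjes \<mu> z \<noteq> 0" by auto
  define G where "G = stieltjes \<nu> z - stieltjes \<mu> z"
  let ?f = "\<lambda>x. 1 / (complex_of_real x - z)"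
  let ?I = "\<lambda>m p. \<integral>x. poly p (of_real x) * ?f x \<partial>m"
  define K where "K = (\<integral>x. (cmod (?f x))\<^sup>2 \<partial>\<nu>) + (\<integral>x. (cmod (?f x))\<^sup>2 \<partial>\<mu>)"
  have cs: "(cmod (?I m p))\<^sup>2 \<le> (\<integral>x. (cmod (poly p (complex_of_real x)))\<^sup>2 \<partial>m) * (\<integral>x. (cmod (?f x))\<^sup>2 \<partial>m)"
    if m: "m \<in> M_star" for m p
    using measurable_cauchy_kernel[of z] measurable_poly_complex[of p]
    by (intro integral_Cauchy_Schwarz(2) integrable_cmod_poly_squared integrable_cauchy_kernel m z)
       (simp_all only: M_star_measurable(1)[OF m])
  have "(cmod (poly p z))\<^sup>2 \<le> 2 * K / (cmod G)\<^sup>2 * (\<integral>x. (cmod (poly p (complex_of_real x)))\<^sup>2 \<partial>\<mu>)" for p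
  proof -
    define N where "N = (\<integral>x. (cmod (poly p (complex_of_real x)))\<^sup>2 \<partial>\<mu>)"
    have N: "(\<integral>x. (cmod (poly p (complex_of_real x)))\<^sup>2 \<partial>\<nu>) = N"
      using integral_poly_complex_eq[OF mu nu mom, of "p * map_poly cnj p"]
      unfolding cmod_poly_squared[symmetric] N_def by (simp only: integral_complex_of_real of_real_eq_iff)
    have "poly p z * G = ?I \<nu> p - ?I \<mu> p"
      unfolding integral_poly_cauchy_kernel[OF mu z] integral_poly_cauchy_kernel[OF nu z]
      by (simp add: integral_poly_complex_eq[OF mu nu mom] G_def algebra_simps)
    then have "(cmod (poly p z))\<^sup>2 * (cmod G)\<^sup>2 = (cmod (?I \<nu> p - ?I \<mu> p))\<^sup>2"
      by (metis norm_mult power_mult_distrib)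
    also have "\<dots> \<le> (cmod (?I \<nu> p) + cmod (?I \<mu> p))\<^sup>2"
      by (simp add: norm_triangle_ineq4 power_mono)
    also have "\<dots> \<le> 2 * (cmod (?I \<nu> p))\<^sup>2 + 2 * (cmod (?I \<mu> p))\<^sup>2"
      using sum_squares_bound[of "cmod (?I \<nu> p)" "cmod (?I \<mu> p)"] by (simp add: power2_sum)
    also have "\<dots> \<le> 2 * K * N"
      using cs[OF nu, of p] cs[OF mu, of p] unfolding N N_def[symmetric] K_def by (simp add: algebra_simps)
    finally show ?thesis using G by (simp add: G_def N_def field_simps)
  qed
  then have "bounded_eval \<mu> z" unfolding bounded_eval_def by blast
  with z show ?thesis by blast
qed

section \<open>Quadrature with a prescribed node\<close>

lemma map_poly_of_real_mult:
  "map_poly complex_of_real (p * q) = map_poly of_real p * map_poly of_real q"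
  by (rule poly_eqI) (simp add: coeff_map_poly coeff_mult)

lemma map_poly_of_real_add:
  "map_poly complex_of_real (p + q) = map_poly of_real p + map_poly of_real q"
  by (rule poly_eqI) (simp add: coeff_map_poly)

text \<open>The factor is h(x) = (x - Re z)^2 + (Im z)^2. The remainder of p modulo h is a real
  polynomial of degree at most 1 that vanishes at the nonreal point z, so it is 0.\<close>

lemma nonreal_root_imp_quadratic_factor:
  fixes p :: "real poly"
  assumes root: "poly (map_poly complex_of_real p) z = 0" and z: "Im z \<noteq> 0"
  shows "\<exists>h. h dvd p \<and> degree h = 2 \<and> (\<forall>x. poly h x \<ge> 0)"
proof -
  define h where "h = [:(Re z)\<^sup>2 + (Im z)\<^sup>2, - 2 * Re z, 1:]"
  have deg: "degree h = 2" by (simp add: h_def)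
  have hz: "poly (map_poly complex_of_real h) z = 0"
    by (simp add: h_def map_poly_pCons complex_eq_iff power2_eq_square algebra_simps)
  define r where "r = p mod h"
  have "degree r < 2 \<or> r = 0"
    using degree_mod_less[of h p] deg by (fastforce simp: r_def)
  then have "degree r \<le> 1" by auto
  define a b where "a = coeff r 0" and "b = coeff r 1"
  have r: "r = [:a, b:]"
  proof (rule poly_eqI)
    fix i
    show "coeff r i = coeff [:a, b:] i"
      using \<open>degree r \<le> 1\<close> by (cases i; cases "i - 1") (auto simp: a_def b_def coeff_eq_0)
  qed
  have "p = h * (p div h) + r" by (simp add: r_def)
  then have "poly (map_poly complex_of_real r) z = 0"
    using root hz by (metis add.left_neutral map_poly_of_real_add map_poly_of_real_mult mult_zero_left poly_add poly_mult)
  then have "complex_of_real a + z * of_real b = 0"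
    by (simp add: r map_poly_pCons)
  then have "Im z * b = 0" "a + Re z * b = 0" by (auto simp: complex_eq_iff)
  with z have "r = 0" by (simp add: r)
  then have "h dvd p" by (simp add: r_def mod_eq_0_iff_dvd)
  moreover have "poly h x = (x - Re z)\<^sup>2 + (Im z)\<^sup>2" for x
    by (simp add: h_def power2_eq_square algebra_simps)
  ultimately show ?thesis using deg by auto
qed

text \<open>The condition excludes both ways of having too few roots: a nonreal root yields a
  nonnegative quadratic factor by the preceding lemma, and a multiple real root a yields the factor
  (x - a)^2.\<close>

lemma card_roots_eq_degree:
  fixes p :: "real poly"
  assumes "p \<noteq> 0" and "\<And>h. h dvd p \<Longrightarrow> degree h = 2 \<Longrightarrow> \<exists>x. poly h x < 0"
  shows "card {x. poly p x = 0} = degree p"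
  using assms
proof (induction "degree p" arbitrary: p)
  case 0
  then obtain c where "p = [:c:]" by (metis degree_eq_zeroE)
  with 0 show ?case by simp
next
  case (Suc d)
  have "\<not> constant (poly (map_poly complex_of_real p))"
    using Suc.hyps(2) by (simp add: constant_degree degree_map_poly)
  then obtain z where z: "poly (map_poly complex_of_real p) z = 0"
    using fundamental_theorem_of_algebra by blast
  have "Im z = 0"
    using nonreal_root_imp_quadratic_factor[OF z] Suc.prems(2) by (meson not_less)
  then obtain a where "z = of_real a" by (metis complex_is_Real_iff Reals_cases)
  with z have "poly p a = 0" by (simp add: poly_map_poly_of_real)
  then obtain q where q: "p = [:-a, 1:] * q" using poly_eq_0_iff_dvd by blast
  with Suc.prems have q0: "q \<noteq> 0" by auto
  have dq: "degree p = Suc (degree q)" unfolding q using q0 by (subst degree_mult_eq) auto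
  have "card {x. poly q x = 0} = degree q"
  proof (rule Suc.hyps(1))
    show "\<exists>x. poly h x < 0" if "h dvd q" "degree h = 2" for h
      using that by (intro Suc.prems(2)) (simp_all only: q dvd_mult)
  qed (use Suc.hyps(2) dq q0 in auto)
  moreover have "poly q a \<noteq> 0"
  proof
    assume "poly q a = 0"
    then have "[:-a, 1:] * [:-a, 1:] dvd p"
      unfolding q using poly_eq_0_iff_dvd by (intro mult_dvd_mono) auto
    moreover have "poly ([:-a, 1:] * [:-a, 1:]) x \<ge> 0" for x
      unfolding poly_mult by (rule zero_le_square)
    moreover have "degree ([:-a, 1:] * [:-a, 1:]) = 2" by simp
    ultimately show False using Suc.prems(2) by (meson not_less)
  qed
  moreover have "{x. poly p x = 0} = insert a {x. poly q x = 0}" by (auto simp: q)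
  moreover have "finite {x. poly q x = 0}" using q0 by (rule poly_roots_finite)
  ultimately show ?case using dq by simp
qed

section \<open>Lagrange interpolation\<close>

definition lagrange_basis :: "'a::field set \<Rightarrow> 'a \<Rightarrow> 'a poly" where
  "lagrange_basis S r = (\<Prod>s\<in>S - {r}. smult (1 / (r - s)) [:-s, 1:])"

lemma poly_lagrange_basis: "poly (lagrange_basis S r) y = (\<Prod>s\<in>S - {r}. (y - s) / (r - s))"
  by (simp add: lagrange_basis_def poly_prod diff_divide_distrib)

lemma poly_lagrange_basis_node:
  assumes "finite S" "r \<in> S" "s \<in> S"
  shows "poly (lagrange_basis S r) s = (if s = r then 1 else 0)"
  using assms by (auto simp: poly_lagrange_basis intro!: prod.neutral prod_zero)

lemma degree_lagrange_basis:
  assumes "finite S" "r \<in> S"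
  shows "degree (lagrange_basis S r) < card S"
proof -
  have "degree (lagrange_basis S r) \<le> (\<Sum>s\<in>S - {r}. degree (smult (1 / (r - s)) [:-s, 1:]))"
    unfolding lagrange_basis_def using assms by (intro degree_prod_sum_le[unfolded comp_def]) auto
  also have "\<dots> \<le> (\<Sum>s\<in>S - {r}. 1)" by (intro sum_mono) simp
  also have "\<dots> < card S" using card_Diff1_less[OF assms] by simp
  finally show ?thesis .
qed

lemma poly_zero_if_many_roots:
  fixes p :: "'a::idom poly"
  assumes "finite S" "\<And>s. s \<in> S \<Longrightarrow> poly p s = 0" "degree p < card S"
  shows "p = 0"
proof (rule ccontr)
  assume p: "p \<noteq> 0"
  then have "card S \<le> card {x. poly p x = 0}"
    using assms poly_roots_finite[OF p] by (intro card_mono) auto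
  also have "\<dots> \<le> degree p" using p by (rule card_poly_roots_bound)
  finally show False using assms by simp
qed

lemma degree_lagrange_sum:
  assumes "finite S" "S \<noteq> {}"
  shows "degree (\<Sum>r\<in>S. smult (f r) (lagrange_basis S r)) < card S"
  using assms degree_lagrange_basis[OF assms(1)]
  by (intro degree_sum_less) (auto simp: card_gt_0_iff intro: le_less_trans[OF degree_smult_le])

lemma lagrange_interpolation:
  fixes p :: "'a::field poly"
  assumes S: "finite S" and deg: "degree p < card S"
  shows "p = (\<Sum>r\<in>S. smult (poly p r) (lagrange_basis S r))"
proof -
  have "S \<noteq> {}" using deg by auto
  then have "degree (p - (\<Sum>r\<in>S. smult (poly p r) (lagrange_basis S r))) < card S"
    using degree_lagrange_sum[OF S, of "poly p"] deg by (intro degree_diff_less)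
  moreover have "poly (p - (\<Sum>r\<in>S. smult (poly p r) (lagrange_basis S r))) s = 0" if "s \<in> S" for s
    using S that by (simp add: poly_sum poly_lagrange_basis_node if_distrib cong: if_cong)
  ultimately have "p - (\<Sum>r\<in>S. smult (poly p r) (lagrange_basis S r)) = 0"
    by (intro poly_zero_if_many_roots[OF S])
  then show ?thesis by (rule right_minus_eq[THEN iffD1])
qed

text \<open>A Gauss--Radau type rule: a quasi-orthogonal polynomial \<open>R\<close> vanishing at the prescribed node
  cannot be divisible by a nonnegative quadratic, so it has the maximal number of distinct real
  roots, and these are the nodes.\<close>

lemma quadrature_with_node:
  assumes mu: "\<mu> \<in> M_star"
    and C: "\<And>p::real poly. (poly p x0)\<^sup>2 \<le> C * (\<integral>x. (poly p x)\<^sup>2 \<partial>\<mu>)"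
  shows "\<exists>S w. finite S \<and> x0 \<in> S \<and> (\<forall>r\<in>S. w r \<ge> 0) \<and> 1 \<le> C * w x0 \<and>
    (\<forall>p::real poly. degree p < 2 * n \<longrightarrow> (\<integral>x. poly p x \<partial>\<mu>) = (\<Sum>r\<in>S. w r * poly p r))"
proof -
  define P where "P = real_orth_poly \<mu>"
  note P = orthonormal_polysD[OF orthonormal_real_orth_poly[OF mu], folded P_def]
  have perpP: "(\<integral>x. poly q x * poly (P k) x \<partial>\<mu>) = 0" if low: "\<And>i. i \<ge> n \<Longrightarrow> coeff q i = 0" and "n \<le> k" for q k
  proof -
    obtain c where c: "q = (\<Sum>k<n. smult (c k) (P k))"
      using poly_graded_expansion[of P n q, OF P(1,3) low] by blast
    show ?thesis using \<open>n \<le> k\<close>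
      unfolding c by (simp add: poly_sum sum_distrib_right mult.assoc integrable_poly_real_mult[OF mu] P)
  qed
  \<comment> \<open>Subtracting a multiple of \<open>P n\<close> from \<open>P (Suc n)\<close>
    produces a zero at x0 unless \<open>P n\<close> vanishes there, and in that case
    \<open>P n\<close> itself serves. Both choices are orthogonal to all polynomials of degree below
    n.\<close>
  obtain R where R0: "R \<noteq> 0" and Rx: "poly R x0 = 0" and Rd: "n \<le> degree R" "degree R \<le> Suc n"
    and perp: "\<And>q. (\<And>i. i \<ge> n \<Longrightarrow> coeff q i = 0) \<Longrightarrow> (\<integral>x. poly q x * poly R x \<partial>\<mu>) = 0"
  proof (cases "poly (P n) x0 = 0")
    case True
    then show ?thesis using that[of "P n"] P perpP by auto
  next
    case False
    define c where "c = poly (P (Suc n)) x0 / poly (P n) x0"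
    define R where "R = P (Suc n) - smult c (P n)"
    have d: "degree R = Suc n"
      unfolding R_def using P(1)[of n] P(1)[of "Suc n"]
      by (subst diff_conv_add_uminus, subst degree_add_eq_left) (auto intro: le_less_trans[OF degree_smult_le])
    show ?thesis
    proof (rule that)
      show "R \<noteq> 0" using d by auto
      show "poly R x0 = 0" using False by (simp add: R_def c_def)
      show "(\<integral>x. poly q x * poly R x \<partial>\<mu>) = 0" if "\<And>i. i \<ge> n \<Longrightarrow> coeff q i = 0" for q
      proof -
        have "poly q x * poly R x = poly q x * poly (P (Suc n)) x - c * (poly q x * poly (P n) x)" for x
          by (simp add: R_def algebra_simps)
        then show ?thesis using that perpP by (simp add: integrable_poly_real_mult[OF mu])
      qed
    qed (use d in auto)
  qed
  define S where "S = {x. poly R x = 0}"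
  have S: "finite S" unfolding S_def using R0 by (rule poly_roots_finite)
  have xS: "x0 \<in> S" using Rx by (simp add: S_def)
  have card: "card S = degree R"
    unfolding S_def
  proof (rule card_roots_eq_degree[OF R0], rule ccontr)
    \<comment> \<open>If R = h q with h nonnegative quadratic, then q has degree below n and is
      orthogonal to R, although q R = h q^2 is nonnegative with finitely many zeros.\<close>
    fix h assume h: "h dvd R" "degree h = 2" and "\<nexists>x. poly h x < 0"
    then have h0: "poly h x \<ge> 0" for x by (meson not_less)
    obtain q where q: "R = h * q" using h by blast
    with R0 have hq: "h \<noteq> 0" "q \<noteq> 0" by auto
    then have dq: "degree R = 2 + degree q" using q h by (simp add: degree_mult_eq)
    have "coeff q i = 0" if "i \<ge> n" for i using that dq Rd by (intro coeff_eq_0) auto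
    then have "(\<integral>x. poly q x * poly R x \<partial>\<mu>) = 0" by (rule perp)
    moreover have "(\<integral>x. poly q x * poly R x \<partial>\<mu>) > 0"
    proof (rule integral_pos_if_finite_zeros[OF mu])
      show "integrable \<mu> (\<lambda>x. poly q x * poly R x)" by (rule integrable_poly_real_mult[OF mu])
      show "poly q x * poly R x \<ge> 0" for x
        using mult_nonneg_nonneg[OF h0[of x] zero_le_square[of "poly q x"]] by (simp add: q mult_ac)
      show "finite {x. poly q x * poly R x = 0}"
        using poly_roots_finite[of "q * R"] hq R0 by simp
    qed
    ultimately show False by simp
  qed
  define w where "w r = (\<integral>x. poly (lagrange_basis S r) x \<partial>\<mu>)" for r
  \<comment> \<open>Gauss's argument: p minus its interpolant at the roots of R is q R with q of
    degree below n, so the difference integrates to 0.\<close>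
  have exact: "(\<integral>x. poly p x \<partial>\<mu>) = (\<Sum>r\<in>S. w r * poly p r)" if dp: "degree p < degree R + n" for p
  proof -
    define L where "L = (\<Sum>r\<in>S. smult (poly p r) (lagrange_basis S r))"
    have dL: "degree L < degree R"
      unfolding L_def card[symmetric] using S xS by (intro degree_lagrange_sum) auto
    have van: "poly (p - L) s = 0" if "s \<in> S" for s
      using S that by (simp add: L_def poly_sum poly_lagrange_basis_node if_distrib cong: if_cong)
    have "(p - L) mod R = 0"
    proof (rule poly_zero_if_many_roots[OF S])
      show "degree ((p - L) mod R) < card S"
        using degree_mod_less[OF R0, of "p - L"] dL card by auto
      show "poly ((p - L) mod R) s = 0" if "s \<in> S" for s
      proof -
        have "poly (p - L) s = poly ((p - L) div R) s * poly R s + poly ((p - L) mod R) s"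
          by (metis div_mult_mod_eq poly_add poly_mult)
        then show ?thesis using van[OF that] that by (simp add: S_def)
      qed
    qed
    then obtain q where q: "p - L = q * R" by (metis add.right_neutral div_mult_mod_eq)
    have "coeff q i = 0" if "i \<ge> n" for i
    proof (cases "q = 0")
      case False
      then have "degree (p - L) = degree q + degree R" using R0 by (simp add: q degree_mult_eq)
      moreover have "degree (p - L) < degree R + n" using dp dL by (intro degree_diff_less) auto
      ultimately show ?thesis using that by (intro coeff_eq_0) auto
    qed simp
    from perp[OF this] have "(\<integral>x. poly (p - L) x \<partial>\<mu>) = 0" by (simp add: q)
    then have "(\<integral>x. poly p x \<partial>\<mu>) = (\<integral>x. poly L x \<partial>\<mu>)"
      by (simp add: integrable_poly_real[OF mu])
    also have "\<dots> = (\<Sum>r\<in>S. w r * poly p r)"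
      by (simp add: L_def poly_sum w_def integrable_poly_real[OF mu] mult.commute)
    finally show ?thesis .
  qed
  have w: "w r = (\<integral>x. (poly (lagrange_basis S r) x)\<^sup>2 \<partial>\<mu>)" if r: "r \<in> S" for r
  proof -
    let ?l = "lagrange_basis S r"
    \<comment> \<open>The square has degree at most 2 deg R - 2, which is below deg R + n because
      deg R \<le> n + 1. So the rule is exact for it and gives the weight as an integral of a
      square.\<close>
    have "degree (?l * ?l) < degree R + n"
      using degree_lagrange_basis[OF S r] degree_mult_le[of ?l ?l] Rd card by linarith
    from exact[OF this] show ?thesis
      using r S by (simp add: power2_eq_square poly_lagrange_basis_node if_distrib cong: if_cong)
  qed
  \<comment> \<open>The basis polynomial of x0 has value 1 there and squared norm w x0, so the
    evaluation bound becomes a lower bound on this weight that does not depend on n.\<close>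
  have "1 \<le> C * w x0"
    using C[of "lagrange_basis S x0"] w[OF xS] poly_lagrange_basis_node[OF S xS xS] by simp
  moreover have "\<forall>r\<in>S. w r \<ge> 0" using w by simp
  moreover have "\<forall>p::real poly. degree p < 2 * n \<longrightarrow> (\<integral>x. poly p x \<partial>\<mu>) = (\<Sum>r\<in>S. w r * poly p r)"
    using exact Rd by auto
  ultimately show ?thesis using S xS by blast
qed

section \<open>Weak limits of measures with convergent moments\<close>

text \<open>The common second moment gives tightness, and Helly selection a weak limit. Moments
  survive the limit because the moment of order 2k controls the tail of x^k uniformly. Mass at a
  point survives because it is a decreasing limit of integrals of bounded continuous functions, each
  at least c.\<close>

lemma weak_limit_of_moments:
  fixes \<nu> :: "nat \<Rightarrow> real measure" and m :: "nat \<Rightarrow> real"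
  assumes distr: "\<And>n. real_distribution (\<nu> n)"
    and int: "\<And>n k. integrable (\<nu> n) (\<lambda>x. x ^ k)"
    and mom: "\<And>k. eventually (\<lambda>n. (\<integral>x. x ^ k \<partial>\<nu> n) = m k) sequentially"
    and second: "\<And>n. (\<integral>x. x\<^sup>2 \<partial>\<nu> n) = m 2"
    and mass: "\<And>n. c \<le> measure (\<nu> n) {x0}"
  shows "\<exists>N. real_distribution N \<and> (\<forall>k. integrable N (\<lambda>x. x ^ k) \<and> (\<integral>x. x ^ k \<partial>N) = m k)
    \<and> c \<le> measure N {x0}"
proof -
  have fin: "finite_measure (\<nu> n)" for n using distr[of n] by (simp add: real_distribution_def prob_space_def)
  have sets: "sets (\<nu> n) = sets borel" "space (\<nu> n) = UNIV" for n
    using distr[of n] by (auto simp: real_distribution_def real_distribution_axioms_def dest: sets_eq_imp_space_eq)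
  have meas: "f \<in> borel_measurable (\<nu> n)" if "f \<in> borel_measurable borel" for f :: "real \<Rightarrow> real" and n
    using that measurable_cong_sets[OF sets(1) refl] by blast
  have bint: "integrable (\<nu> n) f" if "f \<in> borel_measurable borel" "\<And>x. \<bar>f x\<bar> \<le> B" for f :: "real \<Rightarrow> real" and B n
    using that(2) by (intro finite_measure.integrable_const_bound[OF fin, where B = B] meas that(1) AE_I2) simp
  have "tight \<nu>"
    unfolding tight_def
  proof (intro conjI allI impI distr)
    fix e :: real assume e: "e > 0"
    have m2: "m 2 \<ge> 0" using second[of 0, symmetric] by simp
    obtain a where a: "a > 0" "m 2 / a\<^sup>2 < e"
    proof
      show "sqrt ((m 2 + 1) / e) > 0" using e m2 by simp
      show "m 2 / (sqrt ((m 2 + 1) / e))\<^sup>2 < e" using e m2 by (simp add: field_simps)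
    qed
    have "1 - e < measure (\<nu> n) {- a<..a}" for n
    proof -
      \<comment> \<open>Chebyshev's inequality, obtained by integrating 1 - x^2/a^2 \<le>
        \<open>indicator {- a<..a} x\<close>.\<close>
      interpret real_distribution "\<nu> n" by (rule distr)
      have i2: "integrable (\<nu> n) (\<lambda>x. 1 - x\<^sup>2 / a\<^sup>2)" using int[of n 2] by simp
      have "1 - m 2 / a\<^sup>2 = (\<integral>x. 1 - x\<^sup>2 / a\<^sup>2 \<partial>\<nu> n)"
        using int[of n 2] prob_space by (simp add: second sets)
      also have "\<dots> \<le> (\<integral>x. indicator {- a<..a} x \<partial>\<nu> n)"
      proof (rule integral_mono[OF i2])
        show "integrable (\<nu> n) (indicator {- a<..a} :: real \<Rightarrow> real)"
          by (rule bint[where B = 1]) (auto simp: indicator_def)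
        fix x
        show "1 - x\<^sup>2 / a\<^sup>2 \<le> indicator {- a<..a} x"
        proof (cases "x \<in> {- a<..a}")
          case False
          then have "a \<le> \<bar>x\<bar>" by auto
          then have "a\<^sup>2 \<le> x\<^sup>2" using a(1) by (simp add: abs_le_square_iff[symmetric])
          then show ?thesis using False a(1) by simp
        qed simp
      qed
      also have "\<dots> = measure (\<nu> n) {- a<..a}" by (simp add: sets)
      finally show ?thesis using a(2) by linarith
    qed
    then show "\<exists>a b. a < b \<and> (\<forall>n. 1 - e < measure (\<nu> n) {a<..b})" using a(1) by (intro exI[of _ "-a"] exI[of _ a]) auto
  qed
  from tight_imp_convergent_subsubsequence[OF this strict_mono_id]
  obtain r N where r: "strict_mono r" and N: "real_distribution N" and conv: "weak_conv_m (\<nu> \<circ> r) N" by auto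
  interpret N: real_distribution N by fact
  have lim: "(\<lambda>j. \<integral>x. f x \<partial>\<nu> (r j)) \<longlonglongrightarrow> (\<integral>x. f x \<partial>N)"
    if "continuous_on UNIV f" "\<And>x. \<bar>f x\<bar> \<le> B" for f :: "real \<Rightarrow> real" and B
    using weak_conv_imp_integral_bdd_continuous_conv[of "\<nu> \<circ> r" N f B] distr N conv that
    by (auto simp: continuous_on_eq_continuous_at)
  have mom': "eventually (\<lambda>j. (\<integral>x. x ^ k \<partial>\<nu> (r j)) = m k) sequentially" for k
    using mom[of k] filterlim_subseq[OF r] by (auto simp: filterlim_iff)
  have m_even: "m (2 * k) \<ge> 0" for k
  proof -
    obtain n where "(\<integral>x. x ^ (2 * k) \<partial>\<nu> n) = m (2 * k)"
      using mom[of "2 * k"] by (meson eventually_sequentially order_refl)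
    then show ?thesis by (metis (no_types, lifting) Bochner_Integration.integral_nonneg zero_le_even_power even_mult_iff even_numeral)
  qed
  \<comment> \<open>Only an inequality at this stage: the truncations are bounded and continuous, so
    they pass to the weak limit, and monotone convergence in T gives finite even moments of N.
    Equality follows from the tail estimate below.\<close>
  have even: "integrable N (\<lambda>x. x ^ (2 * k))" "(\<integral>x. x ^ (2 * k) \<partial>N) \<le> m (2 * k)" for k
  proof -
    let ?f = "\<lambda>T x. min (real T) (x ^ (2 * k))"
    have b: "\<bar>?f T x\<bar> \<le> real T" for T x by (auto simp: min_def)
    have le: "(\<integral>x. ?f T x \<partial>N) \<le> m (2 * k)" for T
    proof (rule tendsto_upperbound[OF lim[of "?f T" "real T"]])
      show "eventually (\<lambda>j. (\<integral>x. ?f T x \<partial>\<nu> (r j)) \<le> m (2 * k)) sequentially"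
        using mom'[of "2 * k"]
      proof eventually_elim
        case (elim j)
        have "(\<integral>x. ?f T x \<partial>\<nu> (r j)) \<le> (\<integral>x. x ^ (2 * k) \<partial>\<nu> (r j))"
          using b by (intro integral_mono bint[where B = "real T"] int) auto
        then show ?case using elim by simp
      qed
    qed (use b in \<open>auto intro!: continuous_intros\<close>)
    have i: "integrable N (?f T)" for T
      using b by (intro N.integrable_const_bound[where B = "real T"]) auto
    have inc: "incseq (\<lambda>T. \<integral>x. ?f T x \<partial>N)"
      by (intro incseq_SucI integral_mono i) (auto simp: min_def)
    obtain l where l: "(\<lambda>T. \<integral>x. ?f T x \<partial>N) \<longlonglongrightarrow> l"
      using incseq_convergent[OF inc, of "m (2 * k)"] le by blast
    have l_le: "l \<le> m (2 * k)" using LIMSEQ_le_const2[OF l] le by blast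
    have ev: "(\<lambda>T. ?f T x) \<longlonglongrightarrow> x ^ (2 * k)" for x
    proof (rule tendsto_eventually)
      obtain T0 :: nat where "x ^ (2 * k) \<le> real T0" using real_arch_simple by blast
      then show "eventually (\<lambda>T. ?f T x = x ^ (2 * k)) sequentially"
        by (intro eventually_sequentiallyI[of T0]) (auto simp: min_def)
    qed
    have mono: "AE x in N. mono (\<lambda>T. ?f T x)"
      by (intro AE_I2 monoI) (auto simp: min_def)
    show "integrable N (\<lambda>x. x ^ (2 * k))" "(\<integral>x. x ^ (2 * k) \<partial>N) \<le> m (2 * k)"
      using integral_monotone_convergence_nonneg[of N ?f "\<lambda>x. x ^ (2 * k)" l, OF i mono] ev l l_le by auto
  qed
  have pow: "integrable N (\<lambda>x. x ^ k)" for k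
  proof (rule Bochner_Integration.integrable_bound)
    show "integrable N (\<lambda>x. 1 + x ^ (2 * k))" using even(1)[of k] by simp
    have "\<bar>x ^ k\<bar> \<le> 1 + x ^ (2 * k)" for x :: real
    proof -
      have "2 * 1 * \<bar>x ^ k\<bar> \<le> 1\<^sup>2 + \<bar>x ^ k\<bar>\<^sup>2" by (rule sum_squares_bound)
      moreover have "\<bar>x ^ k\<bar>\<^sup>2 = x ^ (2 * k)" by (simp only: power2_abs power_even_eq)
      ultimately show ?thesis using abs_ge_zero[of "x ^ k"] by (simp only: one_power2)
    qed
    then show "AE x in N. norm (x ^ k) \<le> norm (1 + x ^ (2 * k))" by force
  qed simp
  have "(\<integral>x. x ^ k \<partial>N) = m k" for k
  proof -
    define d where "d = \<bar>(\<integral>x. x ^ k \<partial>N) - m k\<bar>"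
    \<comment> \<open>Clamping x^k to [-T, T] changes it only where |x^k| > T, by at most |x^k|
      \<le> x^(2k)/T. The clamped function is bounded and continuous, so the two clamping errors are
      all that separates the moment of N from m k.\<close>
    have bound: "d \<le> 2 * m (2 * k) / real (Suc T)" for T
    proof -
      let ?T = "real (Suc T)"
      define g where "g = (\<lambda>x. max (- ?T) (min ?T (x ^ k)))"
      have gb: "\<bar>g x\<bar> \<le> ?T" for x by (auto simp: g_def)
      have gm: "g \<in> borel_measurable borel" unfolding g_def by measurable
      have gc: "continuous_on UNIV g" unfolding g_def by (intro continuous_intros)
      have close: "\<bar>x ^ k - g x\<bar> \<le> x ^ (2 * k) / ?T" for x
      proof (cases "\<bar>x ^ k\<bar> \<le> ?T")
        case True
        then have "g x = x ^ k" by (auto simp: g_def)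
        then show ?thesis by simp
      next
        case False
        then have "\<bar>x ^ k - g x\<bar> \<le> \<bar>x ^ k\<bar>" by (auto simp: g_def)
        moreover have "\<bar>x ^ k\<bar> * ?T \<le> \<bar>x ^ k\<bar> * \<bar>x ^ k\<bar>" using False by (intro mult_left_mono) auto
        then have "\<bar>x ^ k\<bar> \<le> x ^ (2 * k) / ?T"
          by (simp add: pos_le_divide_eq power_even_eq power2_eq_square abs_mult_self_eq del: of_nat_Suc)
        ultimately show ?thesis by linarith
      qed
      have est: "\<bar>(\<integral>x. x ^ k \<partial>L) - (\<integral>x. g x \<partial>L)\<bar> \<le> (\<integral>x. x ^ (2 * k) \<partial>L) / ?T"
        if "integrable L (\<lambda>x. x ^ k)" "integrable L (\<lambda>x. x ^ (2 * k))" "integrable L g" for L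
      proof -
        have "\<bar>(\<integral>x. x ^ k \<partial>L) - (\<integral>x. g x \<partial>L)\<bar> = \<bar>\<integral>x. x ^ k - g x \<partial>L\<bar>" using that by simp
        also have "\<dots> \<le> (\<integral>x. x ^ (2 * k) / ?T \<partial>L)"
          using that close by (intro order_trans[OF integral_abs_bound] integral_mono) auto
        finally show ?thesis by simp
      qed
      have "\<bar>m k - (\<integral>x. g x \<partial>N)\<bar> \<le> m (2 * k) / ?T"
      proof (rule tendsto_upperbound)
        show "(\<lambda>j. \<bar>m k - (\<integral>x. g x \<partial>\<nu> (r j))\<bar>) \<longlonglongrightarrow> \<bar>m k - (\<integral>x. g x \<partial>N)\<bar>"
          by (intro tendsto_intros lim[OF gc gb])
        show "eventually (\<lambda>j. \<bar>m k - (\<integral>x. g x \<partial>\<nu> (r j))\<bar> \<le> m (2 * k) / ?T) sequentially"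
          using mom'[of k] mom'[of "2 * k"]
        proof eventually_elim
          case (elim j)
          show ?case using est[OF int int bint[OF gm gb], of "r j"] elim by simp
        qed
      qed simp
      moreover have "\<bar>(\<integral>x. x ^ k \<partial>N) - (\<integral>x. g x \<partial>N)\<bar> \<le> m (2 * k) / ?T"
      proof -
        have "integrable N g" using gb gm by (intro N.integrable_const_bound[where B = ?T]) auto
        from est[OF pow pow this] have "\<bar>(\<integral>x. x ^ k \<partial>N) - (\<integral>x. g x \<partial>N)\<bar> \<le> (\<integral>x. x ^ (2 * k) \<partial>N) / ?T" .
        also have "\<dots> \<le> m (2 * k) / ?T" using even(2)[of k] by (intro divide_right_mono) auto
        finally show ?thesis .
      qed
      ultimately have "d \<le> m (2 * k) / ?T + m (2 * k) / ?T" unfolding d_def by linarith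
      then show ?thesis by (simp add: add_divide_distrib[symmetric])
    qed
    have "(\<lambda>T. 2 * m (2 * k) / real (Suc T)) \<longlonglongrightarrow> 0" by real_asymp
    then have "d \<le> 0" using bound by (intro LIMSEQ_le_const) auto
    then show ?thesis by (simp add: d_def)
  qed
  moreover have "c \<le> measure N {x0}"
  proof -
    \<comment> \<open>Tent functions of height 1 and width shrinking to 0 around x0; each dominates
      the indicator of x0 and is continuous.\<close>
    let ?h = "\<lambda>T x. max 0 (1 - real T * \<bar>x - x0\<bar>)"
    have hb: "\<bar>?h T x\<bar> \<le> 1" for T x by auto
    have "(\<lambda>T. \<integral>x. ?h T x \<partial>N) \<longlonglongrightarrow> (\<integral>x. indicator {x0} x \<partial>N)"
    proof (rule integral_dominated_convergence[where w = "\<lambda>_. 1"])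
      show "AE x in N. (\<lambda>T. ?h T x) \<longlonglongrightarrow> indicator {x0} x"
      proof (intro AE_I2 tendsto_eventually)
        fix x
        show "eventually (\<lambda>T. ?h T x = indicator {x0} x) sequentially"
        proof (cases "x = x0")
          case False
          then obtain T0 :: nat where "1 / \<bar>x - x0\<bar> \<le> real T0" using real_arch_simple by blast
          then have "1 \<le> real T0 * \<bar>x - x0\<bar>" using False by (simp add: field_simps)
          then have "1 \<le> real T * \<bar>x - x0\<bar>" if "T0 \<le> T" for T
            using that mult_right_mono[of "real T0" "real T" "\<bar>x - x0\<bar>"] by simp
          then show ?thesis using False by (intro eventually_sequentiallyI[of T0]) auto
        qed simp
      qed
    qed (use hb in auto)
    moreover have "c \<le> (\<integral>x. ?h T x \<partial>N)" for T
    proof (rule tendsto_lowerbound[OF lim[of "?h T" 1]])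
      have "c \<le> (\<integral>x. ?h T x \<partial>\<nu> n)" for n
      proof -
        have "measure (\<nu> n) {x0} = (\<integral>x. indicator {x0} x \<partial>\<nu> n)" using sets by simp
        also have "\<dots> \<le> (\<integral>x. ?h T x \<partial>\<nu> n)"
          using hb by (intro integral_mono bint[where B = 1]) (auto simp: indicator_def)
        finally show ?thesis using mass[of n] by linarith
      qed
      then show "eventually (\<lambda>j. c \<le> (\<integral>x. ?h T x \<partial>\<nu> (r j))) sequentially" by simp
    qed (use hb in \<open>auto intro!: continuous_intros\<close>)
    ultimately have "c \<le> (\<integral>x. indicator {x0} x \<partial>N)" by (intro LIMSEQ_le_const) auto
    then show ?thesis by simp
  qed
  ultimately show ?thesis using N pow by blast
qed

section \<open>Bounded point evaluations imply indeterminacy\<close>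

text \<open>A push-forward of a weighted counting measure, so that one encoding serves the finite
  quadrature rules and the infinite sums on the powers of two.\<close>

definition atomic :: "'i set \<Rightarrow> ('i \<Rightarrow> real) \<Rightarrow> ('i \<Rightarrow> real) \<Rightarrow> real measure" where
  "atomic I w a = distr (density (count_space I) (\<lambda>i. ennreal (w i))) borel a"

lemma sets_atomic [simp, measurable_cong]: "sets (atomic I w a) = sets borel"
  by (simp add: atomic_def)

lemma space_atomic [simp]: "space (atomic I w a) = UNIV"
  by (simp add: atomic_def)

lemma emeasure_atomic:
  assumes "A \<in> sets borel"
  shows "emeasure (atomic I w a) A = (\<integral>\<^sup>+i. ennreal (w i) * indicator A (a i) \<partial>count_space I)"
  unfolding atomic_def using assms
  by (subst emeasure_distr) (auto simp: emeasure_density intro!: nn_integral_cong split: split_indicator)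

lemma integral_atomic:
  fixes f :: "real \<Rightarrow> 'b::{banach, second_countable_topology}"
  assumes w: "\<And>i. i \<in> I \<Longrightarrow> w i \<ge> 0" and f: "f \<in> borel_measurable borel"
  shows "(\<integral>x. f x \<partial>atomic I w a) = (\<integral>i. w i *\<^sub>R f (a i) \<partial>count_space I)"
    and "integrable (atomic I w a) f \<longleftrightarrow> integrable (count_space I) (\<lambda>i. w i *\<^sub>R f (a i))"
  unfolding atomic_def using w f
  by (simp_all add: integral_distr integrable_distr_eq integral_density integrable_density AE_count_space)

text \<open>By the Lindelof property the complement of the support is null. Were the support finite,
  the polynomial with these points as roots would vanish almost everywhere, against
  positivity.\<close>

lemma infinite_msupport:
  fixes \<nu> :: "real measure"
  assumes sets: "sets \<nu> = sets borel"
    and pos: "\<And>p::real poly. p \<noteq> 0 \<Longrightarrow> (\<integral>x. (poly p x)\<^sup>2 \<partial>\<nu>) > 0"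
  shows "infinite (msupport \<nu>)"
proof
  assume fin: "finite (msupport \<nu>)"
  define F where "F = {U. open U \<and> emeasure \<nu> U = 0}"
  obtain F' where F': "F' \<subseteq> F" "countable F'" "\<Union>F' = \<Union>F"
    using Lindelof[of F] unfolding F_def by (auto)
  have "(\<Union>U\<in>F'. U) \<in> null_sets \<nu>"
    using F' sets by (intro null_sets_UN') (auto simp: F_def null_sets_def)
  then have null: "\<Union>F \<in> null_sets \<nu>" using F' by simp
  have sub: "x \<in> \<Union>F" if "x \<notin> msupport \<nu>" for x
    using that by (auto simp: msupport_def F_def not_gr_zero)
  define p where "p = (\<Prod>s\<in>msupport \<nu>. [:-s, 1:])"
  have p0: "p \<noteq> 0" using fin by (simp add: p_def)
  have "poly p x = 0" if "x \<in> msupport \<nu>" for x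
    using fin that by (auto simp: p_def poly_prod)
  then have "AE x in \<nu>. (poly p x)\<^sup>2 = 0"
    using sub by (intro AE_I'[OF null]) auto
  then have "(\<integral>x. (poly p x)\<^sup>2 \<partial>\<nu>) = 0" by (rule integral_eq_zero_AE)
  with pos[OF p0] show False by simp
qed

lemma integral_poly_real_eq:
  fixes \<mu> \<nu> :: "real measure"
  assumes "\<And>n. integrable \<mu> (\<lambda>x. x ^ n)" "\<And>n. integrable \<nu> (\<lambda>x. x ^ n)"
    and "\<And>n. moment \<nu> n = moment \<mu> n"
  shows "(\<integral>x. poly p x \<partial>\<nu>) = (\<integral>x. poly p x \<partial>\<mu>)"
  using assms by (simp add: poly_altdef moment_def)

text \<open>The quadrature rules of growing order all have mass at least 1/C at x0, and their weak
  limit keeps it. After rescaling this is a solution with an atom at x0, where \<mu> has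
  none.\<close>

lemma bounded_eval_nonatom_imp_indeterminate:
  assumes mu: "\<mu> \<in> M_star" and x0: "emeasure \<mu> {x0} = 0"
    and C: "\<And>p::real poly. (poly p x0)\<^sup>2 \<le> C * (\<integral>x. (poly p x)\<^sup>2 \<partial>\<mu>)"
  shows "\<mu> \<in> M_star_i"
proof -
  have imu: "integrable \<mu> (\<lambda>x. x ^ k)" for k using mu by (simp add: M_star_def)
  define M :: real where "M = (\<integral>x. 1 \<partial>\<mu>)"
  have M: "M > 0" unfolding M_def using integral_poly_real_sq_pos[OF mu, of 1] by simp
  define Q where "Q n S w \<longleftrightarrow> finite S \<and> x0 \<in> S \<and> (\<forall>r\<in>S. w r \<ge> 0) \<and> 1 \<le> C * w x0 \<and>
    (\<forall>p::real poly. degree p < 2 * n \<longrightarrow> (\<integral>x. poly p x \<partial>\<mu>) = (\<Sum>r\<in>S. w r * poly p r))"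
    for n :: nat and S and w :: "real \<Rightarrow> real"
  \<comment> \<open>The shift by 2 makes every rule exact for x^2, as the tightness argument
    requires the second moment for all n.\<close>
  have "\<forall>n. \<exists>S w. Q (n + 2) S w" unfolding Q_def using quadrature_with_node[OF mu C] by blast
  then obtain S w where Q: "\<And>n. Q (n + 2) (S n) (w n)" by metis
  have S: "finite (S n)" "x0 \<in> S n" and w: "\<And>r. r \<in> S n \<Longrightarrow> w n r \<ge> 0" and wx: "1 \<le> C * w n x0"
    and exact: "\<And>p::real poly. degree p < 2 * (n + 2) \<Longrightarrow> (\<integral>x. poly p x \<partial>\<mu>) = (\<Sum>r\<in>S n. w n r * poly p r)" for n
    using Q[of n] by (auto simp: Q_def)
  have C0: "C > 0"
  proof (rule ccontr)
    assume "\<not> C > 0"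
    then have "C * w 0 x0 \<le> 0" using w[OF S(2), of 0] by (simp add: mult_nonpos_nonneg)
    then show False using wx[of 0] by simp
  qed
  \<comment> \<open>Division by the total mass M gives probability measures, to which Helly
    selection applies; \<rho> undoes it in the limit.\<close>
  define \<nu> where "\<nu> n = atomic (S n) (\<lambda>r. w n r / M) (\<lambda>r. r)" for n
  have w': "w n r / M \<ge> 0" if "r \<in> S n" for n r using w[OF that] M by simp
  have intnu: "integrable (\<nu> n) f" "(\<integral>x. f x \<partial>\<nu> n) = (\<Sum>r\<in>S n. w n r * f r) / M"
    if "f \<in> borel_measurable borel" for f :: "real \<Rightarrow> real" and n
    using integral_atomic[of "S n" "\<lambda>r. w n r / M" f "\<lambda>r. r"] w' that S(1)[of n]
    by (simp_all add: \<nu>_def integrable_count_space lebesgue_integral_count_space_finite sum_divide_distrib)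
  have mom: "(\<integral>x. x ^ k \<partial>\<nu> n) = moment \<mu> k / M" if "k < 2 * (n + 2)" for k n
    using exact[of "monom 1 k" n] that by (simp add: intnu moment_def degree_monom_eq poly_monom)
  have "\<exists>N. real_distribution N \<and> (\<forall>k. integrable N (\<lambda>x. x ^ k) \<and> (\<integral>x. x ^ k \<partial>N) = moment \<mu> k / M)
      \<and> 1 / (C * M) \<le> measure N {x0}"
  proof (rule weak_limit_of_moments)
    fix n
    show "real_distribution (\<nu> n)"
    proof (intro real_distribution.intro real_distribution_axioms.intro prob_spaceI)
      have "M = (\<Sum>r\<in>S n. w n r)" unfolding M_def using exact[of 1 n] by simp
      then have "(\<Sum>r\<in>S n. w n r / M) = 1" using M by (simp flip: sum_divide_distrib)
      then have "(\<Sum>r\<in>S n. ennreal (w n r / M)) = 1" using w' by (subst sum_ennreal) auto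
      then show "emeasure (\<nu> n) (space (\<nu> n)) = 1"
        using S(1)[of n] by (simp add: \<nu>_def emeasure_atomic nn_integral_count_space_finite)
    qed (simp add: \<nu>_def)
    show "integrable (\<nu> n) (\<lambda>x. x ^ k)" for k by (rule intnu) simp
    show "eventually (\<lambda>n. (\<integral>x. x ^ k \<partial>\<nu> n) = moment \<mu> k / M) sequentially" for k
      by (rule eventually_sequentiallyI[of k]) (simp add: mom)
    show "(\<integral>x. x\<^sup>2 \<partial>\<nu> n) = moment \<mu> 2 / M" by (simp add: mom)
    have "measure (\<nu> n) {x0} = (\<integral>x. indicator {x0} x \<partial>\<nu> n)" by (simp add: \<nu>_def)
    also have "\<dots> = (\<Sum>r\<in>S n. w n r * indicator {x0} r) / M" by (rule intnu) simp
    also have "\<dots> = w n x0 / M" using S[of n] by (simp add: indicator_def if_distrib cong: if_cong)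
    finally show "1 / (C * M) \<le> measure (\<nu> n) {x0}"
      using wx[of n] C0 M by (simp add: field_simps)
  qed
  then obtain N where N: "real_distribution N" and iN: "\<And>k. integrable N (\<lambda>x. x ^ k)"
    and mN: "\<And>k. (\<integral>x. x ^ k \<partial>N) = moment \<mu> k / M" and massN: "1 / (C * M) \<le> measure N {x0}" by blast
  have sN: "sets N = sets borel" using N by (simp add: real_distribution_def real_distribution_axioms_def)
  have bN: "f \<in> borel_measurable N" if "f \<in> borel_measurable borel" for f :: "real \<Rightarrow> real"
    using that measurable_cong_sets[OF sN refl] by blast
  define \<rho> where "\<rho> = density N (\<lambda>_. ennreal M)"
  have sr: "sets \<rho> = sets borel" by (simp add: \<rho>_def sN)
  have ir: "integrable \<rho> (\<lambda>x. x ^ k)" for k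
    unfolding \<rho>_def using M iN[of k] by (subst integrable_density) (auto intro: bN)
  have mr: "moment \<rho> k = moment \<mu> k" for k
    unfolding \<rho>_def moment_def[of "density N (\<lambda>_. ennreal M)"] using M mN[of k]
    by (subst integral_density) (auto intro: bN)
  have "infinite (msupport \<rho>)"
  proof (rule infinite_msupport[OF sr])
    fix p :: "real poly" assume "p \<noteq> 0"
    then show "(\<integral>x. (poly p x)\<^sup>2 \<partial>\<rho>) > 0"
      using integral_poly_real_sq_pos[OF mu, of p] integral_poly_real_eq[OF imu ir mr, of "p * p"]
      by (simp add: power2_eq_square)
  qed
  then have "\<rho> \<in> M_star" by (simp add: M_star_def sr ir)
  moreover have "\<rho> \<noteq> \<mu>"
  proof
    assume "\<rho> = \<mu>"
    then have "emeasure \<rho> {x0} = 0" using x0 by simp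
    then have "ennreal M * emeasure N {x0} = 0"
      by (simp add: \<rho>_def emeasure_density sN nn_integral_cmult_indicator)
    then have "emeasure N {x0} = 0" using M by simp
    then have "measure N {x0} = 0" by (simp add: measure_def)
    then show False using massN C0 M by (simp add: divide_le_0_iff mult_le_0_iff)
  qed
  ultimately show ?thesis using mu mr by (auto simp: M_star_i_def M_star_d_def)
qed

lemma bounded_eval_of_real:
  assumes "bounded_eval \<mu> (of_real x0)"
  shows "\<exists>C. \<forall>p::real poly. (poly p x0)\<^sup>2 \<le> C * (\<integral>x. (poly p x)\<^sup>2 \<partial>\<mu>)"
proof -
  obtain C where C: "\<And>p. (cmod (poly p (of_real x0)))\<^sup>2 \<le> C * (\<integral>x. (cmod (poly p (complex_of_real x)))\<^sup>2 \<partial>\<mu>)"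
    using assms unfolding bounded_eval_def by blast
  have "(poly p x0)\<^sup>2 \<le> C * (\<integral>x. (poly p x)\<^sup>2 \<partial>\<mu>)" for p
    using C[of "map_poly of_real p"] by (simp add: poly_map_poly_of_real)
  then show ?thesis by blast
qed

lemma finite_measure_ex_nonatom:
  fixes \<mu> :: "real measure"
  assumes "finite_measure \<mu>"
  shows "\<exists>x. emeasure \<mu> {x} = 0"
proof -
  interpret finite_measure \<mu> by fact
  have "countable {x. measure \<mu> {x} \<noteq> 0}" by (rule countable_support)
  then have "{x. measure \<mu> {x} \<noteq> 0} \<noteq> UNIV" using uncountable_UNIV_real by metis
  then show ?thesis by (auto simp: emeasure_eq_measure)
qed

text \<open>Boundedness at z spreads to every real point, and a finite measure has only countably
  many atoms, so the preceding criterion applies at some real point outside them.\<close>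

lemma determinate_imp_not_bounded_eval:
  assumes mu: "\<mu> \<in> M_star_d" and z: "z \<notin> \<real>"
  shows "\<not> bounded_eval \<mu> z"
proof
  assume "bounded_eval \<mu> z"
  have mu': "\<mu> \<in> M_star" using mu by (simp add: M_star_d_def)
  obtain x0 where x0: "emeasure \<mu> {x0} = 0"
    using finite_measure_ex_nonatom[OF M_star_finite_measure[OF mu']] by blast
  obtain C where "\<And>p::real poly. (poly p x0)\<^sup>2 \<le> C * (\<integral>x. (poly p x)\<^sup>2 \<partial>\<mu>)"
    using bounded_eval_of_real bounded_eval_nonreal_imp_bounded_eval[OF mu' z \<open>bounded_eval \<mu> z\<close>] by blast
  from bounded_eval_nonatom_imp_indeterminate[OF mu' x0 this] mu show False
    by (simp add: M_star_i_def)
qed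

section \<open>Approximation of the Cauchy kernel\<close>

definition kernel_approximable :: "real measure \<Rightarrow> complex \<Rightarrow> bool" where
  "kernel_approximable \<mu> z \<longleftrightarrow>
     (\<forall>e>0. \<exists>q. (\<integral>x. (cmod (1 / (complex_of_real x - z) - poly q (of_real x)))\<^sup>2 \<partial>\<mu>) < e)"

lemma nonreal_kernel_bound:
  assumes "z \<notin> \<real>"
  shows "1 + x\<^sup>2 \<le> (2 + (1 + 2 * (cmod z)\<^sup>2) / (Im z)\<^sup>2) * (cmod (complex_of_real x - z))\<^sup>2"
proof -
  let ?d = "(cmod (complex_of_real x - z))\<^sup>2"
  have y: "(Im z)\<^sup>2 > 0" using assms by (simp add: complex_is_Real_iff)
  have "(Im z)\<^sup>2 \<le> ?d" by (simp add: cmod_power2)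
  then have "1 \<le> ?d / (Im z)\<^sup>2" using y by simp
  then have "1 + 2 * (cmod z)\<^sup>2 \<le> (1 + 2 * (cmod z)\<^sup>2) * (?d / (Im z)\<^sup>2)"
    using mult_left_mono[of 1 "?d / (Im z)\<^sup>2" "1 + 2 * (cmod z)\<^sup>2"] by simp
  moreover have "x\<^sup>2 \<le> 2 * ?d + 2 * (cmod z)\<^sup>2"
  proof -
    have "\<bar>x\<bar> = cmod ((complex_of_real x - z) + z)" by simp
    also have "\<dots> \<le> cmod (complex_of_real x - z) + cmod z" by (rule norm_triangle_ineq)
    finally have "\<bar>x\<bar>\<^sup>2 \<le> (cmod (complex_of_real x - z) + cmod z)\<^sup>2" by (intro power_mono) auto
    also have "\<dots> \<le> 2 * ?d + 2 * (cmod z)\<^sup>2"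
      using sum_squares_bound[of "cmod (complex_of_real x - z)" "cmod z"] by (simp add: power2_sum)
    finally show ?thesis by simp
  qed
  ultimately show ?thesis by (simp add: algebra_simps)
qed

text \<open>For p(z) nonzero, (1 - p(x)/p(z))/(x - z) is a polynomial q, and the error 1/(x - z) -
  q(x) equals p(x)/(p(z)(x - z)). As |x - z|^(-2) is at most a constant times (1 + x^2)^(-1), and
  \<alpha> \<le> 1, the squared error is at most K times the weighted squared norm of p over
  |p(z)|^2. Unboundedness makes this ratio arbitrarily small.\<close>

lemma weighted_not_bounded_eval_imp_kernel_approximable:
  assumes mu: "\<mu> \<in> M_star" and a: "\<alpha> \<le> 1" "0 \<le> \<alpha>" and z: "z \<notin> \<real>"
    and nb: "\<not> bounded_eval (weighted \<alpha> \<mu>) z"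
  shows "kernel_approximable \<mu> z"
  unfolding kernel_approximable_def
proof (intro allI impI)
  fix e :: real assume e: "e > 0"
  define K where "K = 2 + (1 + 2 * (cmod z)\<^sup>2) / (Im z)\<^sup>2"
  have K: "K > 0" unfolding K_def by (intro add_pos_nonneg divide_nonneg_nonneg) auto
  let ?W = "\<lambda>x::real. (1 + x\<^sup>2) powr (- \<alpha>)"
  have mW: "?W \<in> borel_measurable \<mu>" unfolding M_star_measurable(1)[OF mu] by measurable
  have mp: "(\<lambda>x. (cmod (poly p (complex_of_real x)))\<^sup>2) \<in> borel_measurable \<mu>" for p
    unfolding M_star_measurable(1)[OF mu] by measurable
  \<comment> \<open>The constant K / e is the one whose failure as an evaluation bound makes the
    approximation error less than e.\<close>
  obtain p where p: "(cmod (poly p z))\<^sup>2 > K / e * (\<integral>x. (cmod (poly p (complex_of_real x)))\<^sup>2 \<partial>weighted \<alpha> \<mu>)"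
    using nb unfolding bounded_eval_def by (meson not_less)
  define I where "I = (\<integral>x. ?W x * (cmod (poly p (complex_of_real x)))\<^sup>2 \<partial>\<mu>)"
  have I: "(\<integral>x. (cmod (poly p (complex_of_real x)))\<^sup>2 \<partial>weighted \<alpha> \<mu>) = I"
    unfolding weighted_def I_def using mW mp by (subst integral_density) auto
  have I0: "I \<ge> 0" by (simp add: I_def)
  have W1: "?W x \<le> 1" for x using a powr_mono[of "- \<alpha>" 0 "1 + x\<^sup>2"] by (simp split: if_splits)
  have intW: "integrable \<mu> (\<lambda>x. ?W x * (cmod (poly p (complex_of_real x)))\<^sup>2)"
    using mW mp W1
    by (intro Bochner_Integration.integrable_bound[OF integrable_cmod_poly_squared[OF mu, of p]] AE_I2)
       (auto intro: mult_left_le_one_le)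
  have pz: "(cmod (poly p z))\<^sup>2 > 0"
  proof -
    have "K / e * I \<ge> 0" using I0 K e by (intro mult_nonneg_nonneg divide_nonneg_nonneg) auto
    then show ?thesis using p unfolding I by linarith
  qed
  define q where "q = smult (- 1 / poly p z) (synthetic_div p z)"
  have ptw: "(cmod (1 / (complex_of_real x - z) - poly q (of_real x)))\<^sup>2
      \<le> K / (cmod (poly p z))\<^sup>2 * (?W x * (cmod (poly p (complex_of_real x)))\<^sup>2)" for x
  proof -
    let ?d = "(cmod (complex_of_real x - z))\<^sup>2"
    have xz: "complex_of_real x - z \<noteq> 0" using z by (metis Reals_of_real eq_iff_diff_eq_0)
    have "1 / (complex_of_real x - z) - poly q (of_real x) = poly p (of_real x) / (poly p z * (complex_of_real x - z))"
      using xz pz poly_synthetic_div[of "of_real x" z p] by (simp add: q_def field_simps)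
    then have "(cmod (1 / (complex_of_real x - z) - poly q (of_real x)))\<^sup>2
        = (cmod (poly p (of_real x)))\<^sup>2 / ((cmod (poly p z))\<^sup>2 * ?d)"
      by (simp add: norm_divide norm_mult power_divide power_mult_distrib)
    also have "\<dots> \<le> (cmod (poly p (of_real x)))\<^sup>2 / (cmod (poly p z))\<^sup>2 * (K * ?W x)"
    proof -
      have "1 \<le> (1 + x\<^sup>2) * ?W x"
        using a powr_mono[of 0 "1 - \<alpha>" "1 + x\<^sup>2"] powr_add[of "1 + x\<^sup>2" 1 "- \<alpha>"]
        by (simp add: add_nonneg_eq_0_iff)
      also have "\<dots> \<le> K * ?d * ?W x"
        using nonreal_kernel_bound[OF z, of x] by (intro mult_right_mono) (auto simp: K_def)
      finally have "1 / ?d \<le> K * ?W x" using xz by (simp add: field_simps)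
      from mult_left_mono[OF this, of "(cmod (poly p (of_real x)))\<^sup>2 / (cmod (poly p z))\<^sup>2"]
      show ?thesis by simp
    qed
    finally show ?thesis by (simp add: mult_ac)
  qed
  have "(\<integral>x. (cmod (1 / (complex_of_real x - z) - poly q (of_real x)))\<^sup>2 \<partial>\<mu>)
      \<le> (\<integral>x. K / (cmod (poly p z))\<^sup>2 * (?W x * (cmod (poly p (complex_of_real x)))\<^sup>2) \<partial>\<mu>)"
    using intW ptw K by (intro integral_mono') auto
  also have "\<dots> = K / (cmod (poly p z))\<^sup>2 * I" by (simp add: I_def)
  also have "\<dots> < e" using p pz e K unfolding I by (simp add: field_simps)
  finally show "\<exists>q. (\<integral>x. (cmod (1 / (complex_of_real x - z) - poly q (of_real x)))\<^sup>2 \<partial>\<mu>) < e" by blast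
qed

text \<open>One approximable factor is enough: with the kernel at z replaced by a polynomial q the
  identity is exact as soon as n exceeds the degree of q. Bessel and Cauchy-Schwarz bound both
  replacement errors, squared, by E * G.\<close>

lemma kernel_parseval:
  assumes mu: "\<mu> \<in> M_star" and z: "z \<notin> \<real>" and zeta: "\<zeta> \<notin> \<real>" and app: "kernel_approximable \<mu> z"
  shows "(\<lambda>k. (pQ \<mu> k z + stieltjes \<mu> z * pP \<mu> k z) * (pQ \<mu> k \<zeta> + stieltjes \<mu> \<zeta> * pP \<mu> k \<zeta>))
    sums (\<integral>x. 1 / (complex_of_real x - z) * (1 / (complex_of_real x - \<zeta>)) \<partial>\<mu>)"
proof -
  let ?f = "\<lambda>z x. 1 / (complex_of_real x - z)"
  have [measurable]: "?f z \<in> borel_measurable \<mu>" "(\<lambda>x. poly q (complex_of_real x)) \<in> borel_measurable \<mu>" for z q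
    unfolding M_star_measurable(1)[OF mu] by measurable
  define c where "c z k = pQ \<mu> k z + stieltjes \<mu> z * pP \<mu> k z" for z k
  have c: "(\<integral>x. ?f z x * pP \<mu> k (of_real x) \<partial>\<mu>) = c z k" if "z \<notin> \<real>" for z k
    using integral_poly_cauchy_kernel[OF mu that, of "orth_poly \<mu> k"]
    by (simp add: c_def pQ_def mult.commute)
  define G where "G = (\<integral>x. (cmod (?f \<zeta> x))\<^sup>2 \<partial>\<mu>)"
  have G0: "G \<ge> 0" by (simp add: G_def)
  define J where "J = (\<integral>x. ?f z x * ?f \<zeta> x \<partial>\<mu>)"
  note if2 = integrable_cauchy_kernel(2)[OF mu]
  have "(\<lambda>n. \<Sum>k<n. c z k * c \<zeta> k) \<longlonglongrightarrow> J"
  proof (rule LIMSEQ_I)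
    fix e :: real assume e: "e > 0"
    \<comment> \<open>Chosen so that d * G < (e/2)^2; the added 1 keeps the quotient defined when G
      = 0.\<close>
    define d where "d = (e / 2)\<^sup>2 / (G + 1)"
    have "d > 0" unfolding d_def using e G0 by (intro divide_pos_pos) auto
    then obtain q where q: "(\<integral>x. (cmod (?f z x - poly q (of_real x)))\<^sup>2 \<partial>\<mu>) < d"
      using app unfolding kernel_approximable_def by blast
    define E where "E = (\<integral>x. (cmod (?f z x - poly q (of_real x)))\<^sup>2 \<partial>\<mu>)"
    have EG: "E * G < (e / 2)\<^sup>2"
    proof -
      have "E * G \<le> d * G" using q G0 unfolding E_def by (intro mult_right_mono) auto
      also have "\<dots> < (e / 2)\<^sup>2" unfolding d_def using e G0 by (simp add: field_simps)
      finally show ?thesis .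
    qed
    have iE: "integrable \<mu> (\<lambda>x. (cmod (?f z x - poly q (of_real x)))\<^sup>2)"
    proof (rule Bochner_Integration.integrable_bound)
      show "integrable \<mu> (\<lambda>x. 2 * (cmod (?f z x))\<^sup>2 + 2 * (cmod (poly q (complex_of_real x)))\<^sup>2)"
        using if2[OF z] integrable_cmod_poly_squared[OF mu, of q] by simp
      have "(cmod (a - b))\<^sup>2 \<le> 2 * (cmod a)\<^sup>2 + 2 * (cmod b)\<^sup>2" for a b
      proof -
        have "(cmod (a - b))\<^sup>2 \<le> (cmod a + cmod b)\<^sup>2" by (intro power_mono norm_triangle_ineq4) simp
        then show ?thesis using sum_squares_bound[of "cmod a" "cmod b"] by (simp add: power2_sum)
      qed
      then show "AE x in \<mu>. norm ((cmod (?f z x - poly q (of_real x)))\<^sup>2)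
          \<le> norm (2 * (cmod (?f z x))\<^sup>2 + 2 * (cmod (poly q (complex_of_real x)))\<^sup>2)" by (intro AE_I2) simp
    qed simp
    have ifp: "integrable \<mu> (\<lambda>x. ?f w x * poly p (of_real x))" if "w \<notin> \<real>" for w p
      using integrable_cauchy_kernel(3)[OF mu that, of p] by (simp add: mult.commute)
    define a where "a k = (\<integral>x. poly q (of_real x) * pP \<mu> k (of_real x) \<partial>\<mu>)" for k
    have diff: "(\<integral>x. (?f z x - poly q (of_real x)) * pP \<mu> k (of_real x) \<partial>\<mu>) = c z k - a k" for k
      unfolding left_diff_distrib a_def c[OF z, symmetric]
      by (rule Bochner_Integration.integral_diff[OF ifp[OF z] integrable_poly_complex_mult[OF mu]])
    show "\<exists>N. \<forall>n\<ge>N. norm ((\<Sum>k<n. c z k * c \<zeta> k) - J) < e"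
    proof (intro exI allI impI)
      fix n assume n: "n \<ge> Suc (degree q)"
      have low: "coeff q i = 0" if "i \<ge> n" for i using that n by (intro coeff_eq_0) simp
      have qx: "poly q y = (\<Sum>k<n. a k * pP \<mu> k y)" for y
        using arg_cong[OF orth_poly_expansion[of \<mu> n q, OF mu low], where f = "\<lambda>p. poly p y"]
        by (simp add: poly_sum a_def)
      have "(\<integral>x. poly q (of_real x) * ?f \<zeta> x \<partial>\<mu>) = (\<Sum>k<n. a k * c \<zeta> k)"
      proof -
        have "poly q (of_real x) * ?f \<zeta> x = (\<Sum>k<n. a k * (?f \<zeta> x * pP \<mu> k (of_real x)))" for x
          unfolding qx sum_distrib_right by (intro sum.cong refl) (simp only: mult_ac)
        then have "(\<integral>x. poly q (of_real x) * ?f \<zeta> x \<partial>\<mu>) = (\<Sum>k<n. a k * (\<integral>x. ?f \<zeta> x * pP \<mu> k (of_real x) \<partial>\<mu>))"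
          using ifp[OF zeta] by (simp only: Bochner_Integration.integral_sum integrable_mult_right integral_mult_right_zero)
        then show ?thesis by (simp only: c[OF zeta])
      qed
      then have split: "(\<Sum>k<n. c z k * c \<zeta> k) - J
          = (\<Sum>k<n. (c z k - a k) * c \<zeta> k) + - (\<integral>x. (?f z x - poly q (of_real x)) * ?f \<zeta> x \<partial>\<mu>)"
      proof -
        have "(\<integral>x. (?f z x - poly q (of_real x)) * ?f \<zeta> x \<partial>\<mu>)
            = J - (\<integral>x. poly q (of_real x) * ?f \<zeta> x \<partial>\<mu>)"
          unfolding left_diff_distrib J_def
          by (intro Bochner_Integration.integral_diff integrable_cauchy_kernel(3)[OF mu zeta]
              integral_Cauchy_Schwarz(1) if2 z zeta) simp_all
        then show ?thesis
          using \<open>(\<integral>x. poly q (of_real x) * ?f \<zeta> x \<partial>\<mu>) = (\<Sum>k<n. a k * c \<zeta> k)\<close>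
          by (simp add: left_diff_distrib sum_subtractf)
      qed
      have half: "t < e / 2" if "t\<^sup>2 \<le> E * G" for t
        using that EG e by (intro power2_less_imp_less[of t "e / 2"]) linarith+
      have "(cmod (\<Sum>k<n. (c z k - a k) * c \<zeta> k))\<^sup>2 \<le> (\<Sum>k<n. (cmod (c z k - a k))\<^sup>2) * (\<Sum>k<n. (cmod (c \<zeta> k))\<^sup>2)"
        by (rule sum_Cauchy_Schwarz_cmod)
      also have "\<dots> \<le> E * G"
      proof (rule mult_mono)
        show "(\<Sum>k<n. (cmod (c z k - a k))\<^sup>2) \<le> E"
          unfolding diff[symmetric] E_def by (rule orth_poly_bessel[OF mu _ iE]) measurable
        show "(\<Sum>k<n. (cmod (c \<zeta> k))\<^sup>2) \<le> G"
          unfolding c[OF zeta, symmetric] G_def by (rule orth_poly_bessel[OF mu _ if2[OF zeta]]) measurable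
      qed (auto simp: E_def sum_nonneg)
      finally have 1: "cmod (\<Sum>k<n. (c z k - a k) * c \<zeta> k) < e / 2" by (rule half)
      have 2: "cmod (\<integral>x. (?f z x - poly q (of_real x)) * ?f \<zeta> x \<partial>\<mu>) < e / 2"
        unfolding E_def G_def
        by (rule half, unfold E_def G_def, rule integral_Cauchy_Schwarz(2)[OF _ _ iE if2[OF zeta]]) simp_all
      show "norm ((\<Sum>k<n. c z k * c \<zeta> k) - J) < e"
        unfolding split using 1 2 norm_triangle_ineq4[of "\<Sum>k<n. (c z k - a k) * c \<zeta> k"
            "\<integral>x. (?f z x - poly q (of_real x)) * ?f \<zeta> x \<partial>\<mu>"] by simp
    qed
  qed
  then show ?thesis by (simp add: sums_def c_def J_def)
qed

lemma stieltjes_diff: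
  assumes mu: "\<mu> \<in> M_star" and z: "z \<notin> \<real>" and zeta: "\<zeta> \<notin> \<real>"
  shows "stieltjes \<mu> z - stieltjes \<mu> \<zeta>
    = (z - \<zeta>) * (\<integral>x. 1 / (complex_of_real x - z) * (1 / (complex_of_real x - \<zeta>)) \<partial>\<mu>)"
proof -
  have "1 / (complex_of_real x - z) - 1 / (complex_of_real x - \<zeta>)
      = (z - \<zeta>) * (1 / (complex_of_real x - z) * (1 / (complex_of_real x - \<zeta>)))" for x
  proof -
    have "complex_of_real x - z \<noteq> 0" "complex_of_real x - \<zeta> \<noteq> 0"
      using z zeta by (metis Reals_of_real eq_iff_diff_eq_0)+
    then show ?thesis by (simp add: field_simps)
  qed
  then show ?thesis unfolding stieltjes_def
    by (simp only: integral_mult_right_zero[symmetric]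
        Bochner_Integration.integral_diff[OF integrable_cauchy_kernel(1)[OF mu z] integrable_cauchy_kernel(1)[OF mu zeta], symmetric])
qed

lemma stieltjes_cnj: "stieltjes \<mu> (cnj z) = cnj (stieltjes \<mu> z)"
  unfolding stieltjes_def using Bochner_Integration.integral_cnj[of \<mu> "\<lambda>x. 1 / (complex_of_real x - z)"] by simp

section \<open>The Nevanlinna matrix\<close>

lemma synthetic_div_map_poly_of_real:
  "synthetic_div (map_poly complex_of_real p) (of_real c) = map_poly of_real (synthetic_div p c)"
  by (induction p) (simp_all add: map_poly_pCons poly_map_poly_of_real)

lemma pQ_0_real: "cnj (pQ \<mu> k 0) = pQ \<mu> k 0"
proof -
  have "pQ \<mu> k 0 = (\<integral>x. complex_of_real (poly (synthetic_div (real_orth_poly \<mu> k) 0) x) \<partial>\<mu>)"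
    unfolding pQ_def orth_poly_eq
    using synthetic_div_map_poly_of_real[of "real_orth_poly \<mu> k" 0] by (simp add: poly_map_poly_of_real)
  then show ?thesis by simp
qed

lemma pP_0_real: "cnj (pP \<mu> k 0) = pP \<mu> k 0"
  using pP_of_real[of \<mu> k 0] by simp

lemma pP_cnj: "pP \<mu> k (cnj z) = cnj (pP \<mu> k z)"
proof -
  have "map_poly cnj (orth_poly \<mu> k) = orth_poly \<mu> k"
    by (rule poly_eqI) (simp add: orth_poly_eq coeff_map_poly)
  then show ?thesis by (metis poly_cnj complex_cnj_cnj)
qed

lemma pP_0_nonzero:
  assumes "\<mu> \<in> M_star"
  shows "pP \<mu> 0 z \<noteq> 0"
proof -
  obtain a where "orth_poly \<mu> 0 = [:a:]" using degree_orth_poly(1)[OF assms, of 0] by (metis degree_eq_zeroE)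
  then show ?thesis using degree_orth_poly(2)[OF assms, of 0] by simp
qed

text \<open>The finite version telescopes because \<open>P\<^sub>n(z) = Q\<^sub>n(0) D\<^sub>n(z) - P\<^sub>n(0) B\<^sub>n(z)\<close>.\<close>

lemma nevB_nevD_wronskian:
  assumes mu: "\<mu> \<in> M_star" and P: "\<And>z. summable (\<lambda>k. (cmod (pP \<mu> k z))\<^sup>2)"
    and Q: "\<And>z. summable (\<lambda>k. (cmod (pQ \<mu> k z))\<^sup>2)"
  shows "nevB \<mu> z * nevD \<mu> \<zeta> - nevD \<mu> z * nevB \<mu> \<zeta> = (z - \<zeta>) * (\<Sum>k. pP \<mu> k z * pP \<mu> k \<zeta>)"
proof -
  define B where "B n z = - 1 + z * (\<Sum>k<n. pQ \<mu> k 0 * pP \<mu> k z)" for n z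
  define D where "D n z = z * (\<Sum>k<n. pP \<mu> k 0 * pP \<mu> k z)" for n z
  have rec: "pP \<mu> n z = pQ \<mu> n 0 * D n z - pP \<mu> n 0 * B n z" for n z
  proof -
    have eq: "(\<Sum>j<n. transfer_coeff \<mu> 0 n j * pP \<mu> j z)
        = pQ \<mu> n 0 * (\<Sum>j<n. pP \<mu> j 0 * pP \<mu> j z) - pP \<mu> n 0 * (\<Sum>j<n. pQ \<mu> j 0 * pP \<mu> j z)"
      by (simp add: transfer_coeff_def left_diff_distrib sum_subtractf sum_distrib_left mult.assoc)
    show ?thesis using pP_transfer[OF mu, of n z 0] unfolding eq by (simp add: B_def D_def algebra_simps)
  qed
  have fin: "B n z * D n \<zeta> - D n z * B n \<zeta> = (z - \<zeta>) * (\<Sum>k<n. pP \<mu> k z * pP \<mu> k \<zeta>)" for n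
  proof (induction n)
    case (Suc n)
    define p q x y where "p = pP \<mu> n 0" "q = pQ \<mu> n 0" "x = pP \<mu> n z" "y = pP \<mu> n \<zeta>"
    have B: "B (Suc n) w = B n w + w * (q * pP \<mu> n w)" for w
      by (simp add: B_def p_q_x_y_def algebra_simps)
    have D: "D (Suc n) w = D n w + w * (p * pP \<mu> n w)" for w
      by (simp add: D_def p_q_x_y_def algebra_simps)
    have x: "q * D n z - p * B n z = x" and y: "q * D n \<zeta> - p * B n \<zeta> = y"
      unfolding p_q_x_y_def by (rule rec[symmetric])+
    \<comment> \<open>The increments of B and D at one point are in the ratio q : p, independently
      of the point, so the product terms of two increments cancel.\<close>
    have "B (Suc n) z * D (Suc n) \<zeta> - D (Suc n) z * B (Suc n) \<zeta>
        = (B n z * D n \<zeta> - D n z * B n \<zeta>) + z * x * (q * D n \<zeta> - p * B n \<zeta>) - \<zeta> * y * (q * D n z - p * B n z)"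
      unfolding B D p_q_x_y_def(3,4)[symmetric] by (simp add: algebra_simps)
    also have "\<dots> = (z - \<zeta>) * (\<Sum>k<Suc n. pP \<mu> k z * pP \<mu> k \<zeta>)"
      unfolding Suc x y by (simp add: algebra_simps p_q_x_y_def(3,4))
    finally show ?case .
  qed (simp add: B_def D_def)
  have limB: "(\<lambda>n. B n z) \<longlonglongrightarrow> nevB \<mu> z" and limD: "(\<lambda>n. D n z) \<longlonglongrightarrow> nevD \<mu> z" for z
    unfolding B_def D_def nevB_def nevD_def
    by (intro tendsto_intros summable_LIMSEQ summable_mult_cmod P Q)+
  have "(\<lambda>n. B n z * D n \<zeta> - D n z * B n \<zeta>) \<longlonglongrightarrow> nevB \<mu> z * nevD \<mu> \<zeta> - nevD \<mu> z * nevB \<mu> \<zeta>"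
    by (intro tendsto_intros limB limD)
  moreover have "(\<lambda>n. B n z * D n \<zeta> - D n z * B n \<zeta>) \<longlonglongrightarrow> (z - \<zeta>) * (\<Sum>k. pP \<mu> k z * pP \<mu> k \<zeta>)"
    unfolding fin by (intro tendsto_intros summable_LIMSEQ summable_mult_cmod P)
  ultimately show ?thesis by (rule LIMSEQ_unique)
qed

text \<open>Put the conjugate of z for \<zeta> in the preceding identity: the right side becomes z
  minus its conjugate times the sum of |P_k(z)|^2, which is not 0. Since B and D commute with
  conjugation, B = 0 or D = r B with r real would make the left side 0.\<close>

lemma nev_denominator_nonzero:
  assumes mu: "\<mu> \<in> M_star" and P: "\<And>z. summable (\<lambda>k. (cmod (pP \<mu> k z))\<^sup>2)"
    and Q: "\<And>z. summable (\<lambda>k. (cmod (pQ \<mu> k z))\<^sup>2)" and z: "z \<notin> \<real>"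
  shows "nevB \<mu> z \<noteq> 0" "nevB \<mu> z * of_real r - nevD \<mu> z \<noteq> 0"
proof -
  have cB: "nevB \<mu> (cnj z) = cnj (nevB \<mu> z)"
  proof -
    have "(\<Sum>k. cnj (pQ \<mu> k 0 * pP \<mu> k z)) = cnj (\<Sum>k. pQ \<mu> k 0 * pP \<mu> k z)"
      by (intro sums_unique[symmetric] sums_cnj[THEN iffD2] summable_sums summable_mult_cmod P Q)
    then show ?thesis by (simp add: nevB_def pP_cnj pQ_0_real)
  qed
  have cD: "nevD \<mu> (cnj z) = cnj (nevD \<mu> z)"
  proof -
    have "(\<Sum>k. cnj (pP \<mu> k 0 * pP \<mu> k z)) = cnj (\<Sum>k. pP \<mu> k 0 * pP \<mu> k z)"
      by (intro sums_unique[symmetric] sums_cnj[THEN iffD2] summable_sums summable_mult_cmod P)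
    then show ?thesis by (simp add: nevD_def pP_cnj pP_0_real)
  qed
  have "(\<Sum>k. pP \<mu> k z * pP \<mu> k (cnj z)) = of_real (\<Sum>k. (cmod (pP \<mu> k z))\<^sup>2)"
    unfolding pP_cnj complex_norm_square[symmetric] suminf_of_real[OF P] ..
  moreover have "(\<Sum>k. (cmod (pP \<mu> k z))\<^sup>2) > 0"
    using pP_0_nonzero[OF mu, of z] by (intro suminf_pos2[OF P, of _ 0]) auto
  moreover have "z - cnj z \<noteq> 0" using z by (simp add: complex_eq_iff complex_is_Real_iff)
  ultimately have ne: "nevB \<mu> z * cnj (nevD \<mu> z) - nevD \<mu> z * cnj (nevB \<mu> z) \<noteq> 0"
    using nevB_nevD_wronskian[OF mu P Q, of z "cnj z"] unfolding cB cD by auto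
  then show "nevB \<mu> z \<noteq> 0" by auto
  show "nevB \<mu> z * of_real r - nevD \<mu> z \<noteq> 0"
  proof
    assume "nevB \<mu> z * of_real r - nevD \<mu> z = 0"
    then have "nevD \<mu> z = nevB \<mu> z * of_real r" by simp
    with ne show False by simp
  qed
qed

lemma tendsto_suminf_mult:
  fixes U :: "complex \<Rightarrow> nat \<Rightarrow> complex" and s :: "nat \<Rightarrow> complex"
  assumes v: "summable (\<lambda>k. (cmod (v k))\<^sup>2)"
    and U: "\<And>n. summable (\<lambda>k. (cmod (U (s n) k))\<^sup>2)" "summable (\<lambda>k. (cmod (U 0 k))\<^sup>2)"
    and d: "\<And>n. summable (\<lambda>k. (cmod (U (s n) k - U 0 k))\<^sup>2)"
    and K: "\<And>n. (\<Sum>k. (cmod (U (s n) k - U 0 k))\<^sup>2) \<le> (cmod (s n))\<^sup>2 * K"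
    and s: "s \<longlonglongrightarrow> 0"
  shows "(\<lambda>n. \<Sum>k. U (s n) k * v k) \<longlonglongrightarrow> (\<Sum>k. U 0 k * v k)"
proof -
  define V where "V = (\<Sum>k. (cmod (v k))\<^sup>2)"
  have bound: "(cmod ((\<Sum>k. U (s n) k * v k) - (\<Sum>k. U 0 k * v k)))\<^sup>2 \<le> (cmod (s n))\<^sup>2 * K * V" for n
  proof -
    have "(\<Sum>k. U (s n) k * v k) - (\<Sum>k. U 0 k * v k) = (\<Sum>k. (U (s n) k - U 0 k) * v k)"
      unfolding left_diff_distrib by (intro suminf_diff summable_mult_cmod U v)
    then have "(cmod ((\<Sum>k. U (s n) k * v k) - (\<Sum>k. U 0 k * v k)))\<^sup>2
        \<le> (\<Sum>k. (cmod (U (s n) k - U 0 k))\<^sup>2) * V"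
      unfolding V_def by (simp only: suminf_Cauchy_Schwarz_cmod[OF d v])
    also have "\<dots> \<le> (cmod (s n))\<^sup>2 * K * V"
      using K by (intro mult_right_mono) (auto simp: V_def intro!: suminf_nonneg v)
    finally show ?thesis .
  qed
  have "(\<lambda>n. (cmod (s n))\<^sup>2 * K * V) \<longlonglongrightarrow> (cmod 0)\<^sup>2 * K * V" by (intro tendsto_intros s)
  then have z: "(\<lambda>n. (cmod (s n))\<^sup>2 * K * V) \<longlonglongrightarrow> 0" by simp
  have "(\<lambda>n. (cmod ((\<Sum>k. U (s n) k * v k) - (\<Sum>k. U 0 k * v k)))\<^sup>2) \<longlonglongrightarrow> 0"
    by (rule Lim_null_comparison[OF always_eventually z]) (use bound in simp)
  from tendsto_real_sqrt[OF this] have "(\<lambda>n. cmod ((\<Sum>k. U (s n) k * v k) - (\<Sum>k. U 0 k * v k))) \<longlonglongrightarrow> 0"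
    by simp
  then show ?thesis by (rule LIM_zero_cancel[OF tendsto_norm_zero_cancel])
qed

text \<open>Letting \<open>\<zeta>\<close> tend to \<open>0\<close> in Parseval's identity for the Cauchy kernels at \<open>z\<close> and \<open>\<zeta>\<close> gives a
  linear relation between \<open>A + w B\<close> and \<open>C + w D\<close> whose coefficients are the homogeneous limit
  of \<open>(1, w(\<zeta>))\<close>; compactness makes it unnecessary to know how \<open>w\<close> behaves at \<open>0\<close>.\<close>

lemma nevanlinna_const_of_kernel_approximable:
  assumes mu: "\<mu> \<in> M_star" and c: "c \<notin> \<real>" "bounded_eval \<mu> c"
    and app: "\<And>z. z \<notin> \<real> \<Longrightarrow> kernel_approximable \<mu> z"
  shows "\<exists>t. \<forall>z. z \<notin> \<real> \<longrightarrow> stieltjes \<mu> z = nevanlinna_const \<mu> t z"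
proof -
  note P = bounded_eval_nonreal_imp_square_summable(1)[OF mu c]
  note Q = bounded_eval_nonreal_imp_square_summable(2)[OF mu c]
  let ?w = "stieltjes \<mu>"
  define s where "s n = \<i> * of_real (1 / real (Suc n))" for n
  have s_norm: "cmod (s n) = 1 / real (Suc n)" for n
    unfolding s_def norm_mult norm_of_real by simp
  have s_le: "cmod (s n - 0) \<le> 1" for n by (simp add: s_norm)
  have s_im: "Im (s n) = 1 / real (Suc n)" for n by (simp add: s_def)
  have s_nr: "s n \<notin> \<real>" for n using s_im[of n] by (auto simp: complex_is_Real_iff)
  have s0: "s \<longlonglongrightarrow> 0"
    by (rule tendsto_norm_zero_cancel) (unfold s_norm, real_asymp)
  note trP = transfer_square_summable[where p = "\<lambda>k. pP \<mu> k 0" and q = "\<lambda>k. pQ \<mu> k 0"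
      and u = "\<lambda>k. pP \<mu> k 0" and U = "\<lambda>k. pP \<mu> k z" and h = "z - 0" and r = 1 for z,
      OF P Q P pP_transfer[OF mu, unfolded transfer_coeff_def]]
  note trQ = transfer_square_summable[where p = "\<lambda>k. pP \<mu> k 0" and q = "\<lambda>k. pQ \<mu> k 0"
      and u = "\<lambda>k. pQ \<mu> k 0" and U = "\<lambda>k. pQ \<mu> k z" and h = "z - 0" and r = 1 for z,
      OF P Q Q pQ_transfer[OF mu, unfolded transfer_coeff_def]]
  \<comment> \<open>With r = 1 the constants in \<open>trP\<close> and \<open>trQ\<close> do not
    involve z, so bounds uniform on the unit disc can be read off by unification.\<close>
  obtain BP where BP: "\<And>z. cmod (z - 0) \<le> 1 \<Longrightarrow> (\<Sum>k. (cmod (pP \<mu> k z))\<^sup>2) \<le> BP" by (rule that, erule trP(2))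
  obtain BQ where BQ: "\<And>z. cmod (z - 0) \<le> 1 \<Longrightarrow> (\<Sum>k. (cmod (pQ \<mu> k z))\<^sup>2) \<le> BQ" by (rule that, erule trQ(2))
  obtain KP where KP: "\<And>z. cmod (z - 0) \<le> 1 \<Longrightarrow>
      (\<Sum>k. (cmod (pP \<mu> k z - pP \<mu> k 0))\<^sup>2) \<le> (cmod (z - 0))\<^sup>2 * KP" by (rule that, erule trP(4))
  obtain KQ where KQ: "\<And>z. cmod (z - 0) \<le> 1 \<Longrightarrow>
      (\<Sum>k. (cmod (pQ \<mu> k z - pQ \<mu> k 0))\<^sup>2) \<le> (cmod (z - 0))\<^sup>2 * KQ" by (rule that, erule trQ(4))
  have limP: "(\<lambda>n. \<Sum>k. pP \<mu> k (s n) * v k) \<longlonglongrightarrow> (\<Sum>k. pP \<mu> k 0 * v k)"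
    if "summable (\<lambda>k. (cmod (v k))\<^sup>2)" for v
    using KP[OF s_le] trP(3)[OF s_le]
    by (intro tendsto_suminf_mult[where U = "\<lambda>z k. pP \<mu> k z" and K = KP] that P s0) simp_all
  have limQ: "(\<lambda>n. \<Sum>k. pQ \<mu> k (s n) * v k) \<longlonglongrightarrow> (\<Sum>k. pQ \<mu> k 0 * v k)"
    if "summable (\<lambda>k. (cmod (v k))\<^sup>2)" for v
    using KQ[OF s_le] trQ(3)[OF s_le]
    by (intro tendsto_suminf_mult[where U = "\<lambda>z k. pQ \<mu> k z" and K = KQ] that Q s0) simp_all
  define PP where "PP \<zeta> z = (\<Sum>k. pP \<mu> k \<zeta> * pP \<mu> k z)" for \<zeta> z
  define PQ where "PQ \<zeta> z = (\<Sum>k. pP \<mu> k \<zeta> * pQ \<mu> k z)" for \<zeta> z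
  define QP where "QP \<zeta> z = (\<Sum>k. pQ \<mu> k \<zeta> * pP \<mu> k z)" for \<zeta> z
  define QQ where "QQ \<zeta> z = (\<Sum>k. pQ \<mu> k \<zeta> * pQ \<mu> k z)" for \<zeta> z
  define cf where "cf z k = pQ \<mu> k z + ?w z * pP \<mu> k z" for z k
  have cf2: "summable (\<lambda>k. (cmod (cf z k))\<^sup>2)" for z
    unfolding cf_def by (intro summable_cmod_add_sq Q) (simp only: norm_mult power_mult_distrib summable_mult P)
  have wdiff: "?w z - ?w \<zeta> = (z - \<zeta>) * (\<Sum>k. cf z k * cf \<zeta> k)" if "z \<notin> \<real>" "\<zeta> \<notin> \<real>" for z \<zeta>
    unfolding cf_def stieltjes_diff[OF mu that] sums_unique[OF kernel_parseval[OF mu that app[OF that(1)]]] ..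
  have expand: "(\<Sum>k. cf z k * cf \<zeta> k)
      = QQ \<zeta> z + ?w \<zeta> * PQ \<zeta> z + ?w z * QP \<zeta> z + ?w z * ?w \<zeta> * PP \<zeta> z" for z \<zeta>
  proof -
    note sm = summable_mult_cmod
    have "cf z k * cf \<zeta> k = pQ \<mu> k \<zeta> * pQ \<mu> k z + ?w \<zeta> * (pP \<mu> k \<zeta> * pQ \<mu> k z)
        + ?w z * (pQ \<mu> k \<zeta> * pP \<mu> k z) + ?w z * ?w \<zeta> * (pP \<mu> k \<zeta> * pP \<mu> k z)" for k
      by (simp add: cf_def algebra_simps)
    then have "(\<lambda>k. cf z k * cf \<zeta> k) sums (QQ \<zeta> z + ?w \<zeta> * PQ \<zeta> z + ?w z * QP \<zeta> z + ?w z * ?w \<zeta> * PP \<zeta> z)"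
      unfolding QQ_def PQ_def QP_def PP_def
      by (simp only:) (intro sums_add sums_mult summable_sums sm P Q)
    then show ?thesis by (rule sums_unique[symmetric])
  qed
  \<comment> \<open>The pair (1, w(s n)) scaled to the unit sphere of \<real> \<times> \<complex>.
    If w is unbounded along the sequence, u0 may be 0.\<close>
  define u where "u n = 1 / sqrt (1 + (cmod (?w (s n)))\<^sup>2)" for n
  define v where "v n = ?w (s n) * of_real (u n)" for n
  have u2: "(u n)\<^sup>2 * (1 + (cmod (?w (s n)))\<^sup>2) = 1" for n
    by (simp add: u_def power_divide add_nonneg_eq_0_iff)
  have sph: "(u n, v n) \<in> sphere 0 1" for n
  proof -
    have "(u n)\<^sup>2 + (cmod (v n))\<^sup>2 = 1"
      using u2[of n] by (simp add: v_def norm_mult power_mult_distrib algebra_simps)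
    then show ?thesis by (simp add: norm_prod_def)
  qed
  have sc: "seq_compact (sphere (0 :: real \<times> complex) 1)"
    by (simp add: compact_imp_seq_compact)
  obtain l r where l: "l \<in> sphere (0 :: real \<times> complex) 1" and r: "strict_mono r"
    and lim: "((\<lambda>n. (u n, v n)) \<circ> r) \<longlonglongrightarrow> l"
    by (rule seq_compactE[OF sc, of "\<lambda>n. (u n, v n)"]) (use sph in blast)+
  obtain u0 v0 where l_eq: "l = (u0, v0)" by (cases l)
  have limu: "(\<lambda>n. u (r n)) \<longlonglongrightarrow> u0" and limv: "(\<lambda>n. v (r n)) \<longlonglongrightarrow> v0"
    using tendsto_fst[OF lim] tendsto_snd[OF lim] by (simp_all add: l_eq o_def)
  have nz: "u0 \<noteq> 0 \<or> v0 \<noteq> 0" using l by (auto simp: l_eq zero_prod_def[symmetric])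
  have sub: "(\<lambda>n. X (r n)) \<longlonglongrightarrow> L" if "X \<longlonglongrightarrow> L" for X and L :: complex
    using LIMSEQ_subseq_LIMSEQ[OF that r] by (simp add: o_def)
  \<comment> \<open>The resolvent identity times u n, in the limit. The constants -1 in
    \<open>nevB\<close> and 1 in \<open>nevC\<close> account for the left side u0 w(z) - v0.\<close>
  have rel: "of_real u0 * (nevA \<mu> z + ?w z * nevB \<mu> z) + v0 * (nevC \<mu> z + ?w z * nevD \<mu> z) = 0"
    if z: "z \<notin> \<real>" for z
  proof -
    let ?R = "\<lambda>n. (z - s n) * (of_real (u n) * QQ (s n) z + v n * PQ (s n) z
        + ?w z * (of_real (u n) * QP (s n) z) + ?w z * (v n * PP (s n) z))"
    have "of_real (u n) * ?w z - v n = ?R n" for n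
    proof -
      have "of_real (u n) * ?w z - v n = of_real (u n) * (?w z - ?w (s n))"
        by (simp add: v_def algebra_simps)
      also have "\<dots> = ?R n"
        unfolding wdiff[OF z s_nr] expand v_def by (simp add: algebra_simps)
      finally show ?thesis .
    qed
    then have e: "(\<lambda>n. of_real (u (r n)) * ?w z - v (r n)) = (\<lambda>n. ?R (r n))" by simp
    have "(\<lambda>n. of_real (u (r n)) * ?w z - v (r n)) \<longlonglongrightarrow> of_real u0 * ?w z - v0"
      by (intro tendsto_intros limu limv)
    moreover have "(\<lambda>n. ?R (r n)) \<longlonglongrightarrow> (z - 0) * (of_real u0 * QQ 0 z + v0 * PQ 0 z
        + ?w z * (of_real u0 * QP 0 z) + ?w z * (v0 * PP 0 z))"
      unfolding QQ_def PQ_def QP_def PP_def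
      by (intro tendsto_intros limu limv sub[OF s0] sub[OF limP] sub[OF limQ] P Q)
    ultimately have "of_real u0 * ?w z - v0 = (z - 0) * (of_real u0 * QQ 0 z + v0 * PQ 0 z
        + ?w z * (of_real u0 * QP 0 z) + ?w z * (v0 * PP 0 z))"
      unfolding e by (rule LIMSEQ_unique)
    then show ?thesis
      unfolding nevA_def nevB_def nevC_def nevD_def QQ_def[symmetric] PQ_def[symmetric] QP_def[symmetric] PP_def[symmetric]
      by (simp add: algebra_simps)
  qed
  \<comment> \<open>The limiting ratio must be real. Parseval at s n and its conjugate gives Im w =
    Im(s n) * T up to sign, with |T| \<le> K (1 + |w|^2); the factor (u n)^2 removes this growth, so
    u n * Im (v n) is at most K / (n + 1) in absolute value.\<close>
  have "u0 * Im v0 = 0"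
  proof -
    have pos: "BP \<ge> 0" "BQ \<ge> 0"
      using order_trans[OF suminf_nonneg[OF P] BP[of 0]] order_trans[OF suminf_nonneg[OF Q] BQ[of 0]] by simp_all
    define K where "K = 2 * BQ + 2 * BP"
    have bound: "\<bar>u n * Im (v n)\<bar> \<le> 1 / real (Suc n) * K" for n
    proof -
      let ?W = "1 + (cmod (?w (s n)))\<^sup>2"
      have cb: "(\<Sum>k. (cmod (cf z k))\<^sup>2) \<le> K * ?W" if "cmod z \<le> 1" "cmod (?w z) = cmod (?w (s n))" for z
      proof -
        have "(\<Sum>k. (cmod (cf z k))\<^sup>2) \<le> (\<Sum>k. 2 * (cmod (pQ \<mu> k z))\<^sup>2 + 2 * (cmod (?w z))\<^sup>2 * (cmod (pP \<mu> k z))\<^sup>2)"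
        proof (rule suminf_le[OF _ cf2])
          fix k
          have "(cmod (cf z k))\<^sup>2 \<le> (cmod (pQ \<mu> k z) + cmod (?w z * pP \<mu> k z))\<^sup>2"
            unfolding cf_def by (intro power_mono norm_triangle_ineq) simp
          also have "\<dots> \<le> 2 * (cmod (pQ \<mu> k z))\<^sup>2 + 2 * (cmod (?w z * pP \<mu> k z))\<^sup>2"
            using sum_squares_bound[of "cmod (pQ \<mu> k z)" "cmod (?w z * pP \<mu> k z)"] by (simp add: power2_sum)
          finally show "(cmod (cf z k))\<^sup>2 \<le> 2 * (cmod (pQ \<mu> k z))\<^sup>2 + 2 * (cmod (?w z))\<^sup>2 * (cmod (pP \<mu> k z))\<^sup>2"
            by (simp add: norm_mult power_mult_distrib)
        qed (intro summable_add summable_mult P Q)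
        also have "\<dots> = 2 * (\<Sum>k. (cmod (pQ \<mu> k z))\<^sup>2) + 2 * (cmod (?w z))\<^sup>2 * (\<Sum>k. (cmod (pP \<mu> k z))\<^sup>2)"
          by (simp add: suminf_add[symmetric] suminf_mult summable_mult P Q)
        also have "\<dots> \<le> 2 * BQ + 2 * (cmod (?w z))\<^sup>2 * BP"
          using BP[of z] BQ[of z] that(1) by (intro add_mono mult_left_mono) auto
        also have "\<dots> \<le> K * ?W"
          using pos unfolding K_def that(2) by (simp add: algebra_simps)
        finally show ?thesis .
      qed
      have K0: "K * ?W \<ge> 0" unfolding K_def using pos by (intro mult_nonneg_nonneg) auto
      define T where "T = (\<Sum>k. cf (s n) k * cf (cnj (s n)) k)"
      have "(cmod T)\<^sup>2 \<le> (K * ?W) * (K * ?W)"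
        unfolding T_def
        using s_le[of n] by (intro order_trans[OF suminf_Cauchy_Schwarz_cmod[OF cf2 cf2]] mult_mono cb)
          (auto simp: stieltjes_cnj K0 intro!: suminf_nonneg cf2)
      then have T: "cmod T \<le> K * ?W"
        using K0 unfolding power2_eq_square[of "K * _", symmetric] by (rule power2_le_imp_le)
      have "cnj (s n) \<notin> \<real>" using s_nr[of n] by (simp add: complex_is_Real_iff)
      from wdiff[OF s_nr this] have "?w (s n) - cnj (?w (s n)) = (s n - cnj (s n)) * T"
        by (simp add: stieltjes_cnj T_def)
      moreover have "cmod (a - cnj a) = 2 * \<bar>Im a\<bar>" for a
        by (simp add: complex_diff_cnj norm_mult)
      ultimately have "2 * \<bar>Im (?w (s n))\<bar> = 2 * (1 / real (Suc n)) * cmod T"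
        by (metis norm_mult s_im abs_of_nonneg divide_nonneg_nonneg of_nat_0_le_iff zero_le_one)
      then have im: "\<bar>Im (?w (s n))\<bar> \<le> 1 / real (Suc n) * (K * ?W)"
        using mult_left_mono[OF T, of "1 / real (Suc n)"] by simp
      have "\<bar>u n * Im (v n)\<bar> = (u n)\<^sup>2 * \<bar>Im (?w (s n))\<bar>"
        by (simp add: v_def abs_mult power2_eq_square u_def)
      also have "\<dots> \<le> (u n)\<^sup>2 * (1 / real (Suc n) * (K * ?W))"
        by (intro mult_left_mono im) simp
      also have "\<dots> = 1 / real (Suc n) * K * ((u n)\<^sup>2 * ?W)" by (simp only: mult_ac)
      finally show ?thesis unfolding u2 by simp
    qed
    have "(\<lambda>n. u (r n) * Im (v (r n))) \<longlonglongrightarrow> u0 * Im v0"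
      by (intro tendsto_intros limu limv)
    moreover have "(\<lambda>n. u (r n) * Im (v (r n))) \<longlonglongrightarrow> 0"
    proof -
      have "(\<lambda>n. 1 / real (Suc n) * K) \<longlonglongrightarrow> 0" by real_asymp
      then have "(\<lambda>n. u n * Im (v n)) \<longlonglongrightarrow> 0"
        by (rule Lim_null_comparison[OF always_eventually, rotated]) (simp only: real_norm_def bound simp_thms)
      then show ?thesis using LIMSEQ_subseq_LIMSEQ[OF _ r] by (fastforce simp: o_def)
    qed
    ultimately show ?thesis by (rule LIMSEQ_unique)
  qed
  note den = nev_denominator_nonzero[OF mu P Q]
  show ?thesis
  proof (cases "v0 = 0")
    case True
    with nz have u0: "u0 \<noteq> 0" by simp
    show ?thesis
    proof (intro exI[of _ None] allI impI)
      fix z :: complex assume z: "z \<notin> \<real>"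
      have "nevA \<mu> z + ?w z * nevB \<mu> z = 0" using rel[OF z] True u0 by simp
      then have "?w z * nevB \<mu> z = - nevA \<mu> z" by (simp add: eq_neg_iff_add_eq_0 add.commute)
      then show "?w z = nevanlinna_const \<mu> None z"
        unfolding nevanlinna_const_def option.case using den(1)[OF z] by (simp only: eq_divide_eq) simp
    qed
  next
    case False
    \<comment> \<open>The parameter is t = - u0 / v0. For u0 = 0 it is 0 whatever the argument of
      v0; otherwise v0 is real by the previous step.\<close>
    obtain t where t: "- of_real u0 = v0 * of_real t"
    proof (cases "u0 = 0")
      case True
      then show ?thesis using that[of 0] by simp
    next
      case u: False
      then have "Im v0 = 0" using \<open>u0 * Im v0 = 0\<close> by simp
      then have v: "v0 = of_real (Re v0)" by (simp add: complex_eq_iff)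
      with False have "Re v0 \<noteq> 0" by auto
      then have "- of_real u0 = of_real (Re v0) * complex_of_real (- u0 / Re v0)" by simp
      then show ?thesis using that[of "- u0 / Re v0"] v by metis
    qed
    show ?thesis
    proof (intro exI[of _ "Some t"] allI impI)
      fix z :: complex assume z: "z \<notin> \<real>"
      have "v0 * (nevC \<mu> z + ?w z * nevD \<mu> z) = - of_real u0 * (nevA \<mu> z + ?w z * nevB \<mu> z)"
        using minus_unique[OF rel[OF z]] by (simp only: mult_minus_left)
      also have "\<dots> = v0 * (of_real t * (nevA \<mu> z + ?w z * nevB \<mu> z))" unfolding t by (simp only: mult_ac)
      finally have "nevC \<mu> z + ?w z * nevD \<mu> z = of_real t * (nevA \<mu> z + ?w z * nevB \<mu> z)"
        using False by simp
      then have "?w z * (nevB \<mu> z * of_real t - nevD \<mu> z) = - (nevA \<mu> z * of_real t - nevC \<mu> z)"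
        by (simp add: algebra_simps)
      then show "?w z = nevanlinna_const \<mu> (Some t) z"
        unfolding nevanlinna_const_def option.case using den(2)[OF z, of t] by (simp only: eq_divide_eq) simp
    qed
  qed
qed

section \<open>N-extremality\<close>

lemma density_const_integral:
  fixes \<mu> :: "real measure" and f :: "real \<Rightarrow> real"
  assumes "\<mu> \<in> M_star" "c > 0" "f \<in> borel_measurable borel"
  shows "(\<integral>x. f x \<partial>density \<mu> (\<lambda>_. ennreal c)) = c * (\<integral>x. f x \<partial>\<mu>)"
    and "integrable (density \<mu> (\<lambda>_. ennreal c)) f \<longleftrightarrow> integrable \<mu> f"
proof -
  have "f \<in> borel_measurable \<mu>" using assms by (simp add: M_star_measurable(1))
  then show "(\<integral>x. f x \<partial>density \<mu> (\<lambda>_. ennreal c)) = c * (\<integral>x. f x \<partial>\<mu>)"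
    "integrable (density \<mu> (\<lambda>_. ennreal c)) f \<longleftrightarrow> integrable \<mu> f"
    using assms(2) by (simp_all add: integral_density integrable_density)
qed

lemma M_star_density_const:
  assumes mu: "\<mu> \<in> M_star" and c: "c > 0"
  shows "density \<mu> (\<lambda>_. ennreal c) \<in> M_star"
proof -
  have sets: "sets \<mu> = sets borel" using mu by (simp add: M_star_def)
  have "emeasure (density \<mu> (\<lambda>_. ennreal c)) U = ennreal c * emeasure \<mu> U" if "open U" for U
    using that by (simp add: emeasure_density nn_integral_cmult_indicator sets)
  then have "msupport (density \<mu> (\<lambda>_. ennreal c)) = msupport \<mu>"
    using c by (auto simp: msupport_def ennreal_zero_less_mult_iff)
  then show ?thesis using mu c by (simp add: M_star_def density_const_integral(2)[OF mu c])
qed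

lemma normalized_eq_density:
  assumes mu: "\<mu> \<in> M_star"
  shows "\<exists>c>0. normalized \<mu> = density \<mu> (\<lambda>_. ennreal c)"
proof -
  interpret finite_measure \<mu> by (rule M_star_finite_measure[OF mu])
  have M: "measure \<mu> UNIV > 0"
    using integral_poly_real_sq_pos[OF mu, of 1] M_star_measurable(2)[OF mu] by simp
  define c where "c = inverse (measure \<mu> UNIV)"
  have c: "c > 0" "inverse (emeasure \<mu> UNIV) = ennreal c"
    using M by (simp_all add: c_def emeasure_eq_measure inverse_ennreal)
  have "normalized \<mu> = density \<mu> (\<lambda>_. ennreal c)"
    unfolding normalized_def c(2)
    by (rule measure_eqI) (simp_all add: emeasure_density nn_integral_cmult_indicator)
  with c show ?thesis by blast
qed

lemma bounded_eval_density_const: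
  assumes mu: "\<mu> \<in> M_star" and c: "c > 0" and b: "bounded_eval \<mu> z"
  shows "bounded_eval (density \<mu> (\<lambda>_. ennreal c)) z"
proof -
  obtain C where C: "\<And>p. (cmod (poly p z))\<^sup>2 \<le> C * (\<integral>x. (cmod (poly p (complex_of_real x)))\<^sup>2 \<partial>\<mu>)"
    using b unfolding bounded_eval_def by blast
  then have "(cmod (poly p z))\<^sup>2
      \<le> (C / c) * (\<integral>x. (cmod (poly p (complex_of_real x)))\<^sup>2 \<partial>density \<mu> (\<lambda>_. ennreal c))" for p
    using c C[of p] by (subst density_const_integral[OF mu c]) auto
  then show ?thesis unfolding bounded_eval_def by blast
qed

lemma kernel_approximable_density_const:
  assumes mu: "\<mu> \<in> M_star" and c: "c > 0" and k: "kernel_approximable \<mu> z"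
  shows "kernel_approximable (density \<mu> (\<lambda>_. ennreal c)) z"
  unfolding kernel_approximable_def
proof (intro allI impI)
  fix e :: real assume "e > 0"
  then have "e / c > 0" using c by simp
  then obtain q where "(\<integral>x. (cmod (1 / (complex_of_real x - z) - poly q (of_real x)))\<^sup>2 \<partial>\<mu>) < e / c"
    using k unfolding kernel_approximable_def by blast
  then have "(\<integral>x. (cmod (1 / (complex_of_real x - z) - poly q (of_real x)))\<^sup>2 \<partial>density \<mu> (\<lambda>_. ennreal c)) < e"
    using c by (subst density_const_integral[OF mu c]) (auto simp: field_simps)
  then show "\<exists>q. (\<integral>x. (cmod (1 / (complex_of_real x - z) - poly q (of_real x)))\<^sup>2 \<partial>density \<mu> (\<lambda>_. ennreal c)) < e"
    by blast
qed

lemma class_B_subset_N_extremal: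
  assumes a: "0 \<le> \<alpha>" "\<alpha> \<le> 1"
  shows "class_B \<alpha> \<subseteq> M_star_i0"
proof
  fix \<mu> assume "\<mu> \<in> class_B \<alpha>"
  then have mui: "\<mu> \<in> M_star_i" and nu: "weighted \<alpha> \<mu> \<in> M_star_d" by (auto simp: class_B_def)
  have mu: "\<mu> \<in> M_star" using mui by (simp add: M_star_i_def)
  obtain c where c: "c \<notin> \<real>" "bounded_eval \<mu> c" using indeterminate_imp_bounded_eval[OF mui] by blast
  have app: "kernel_approximable \<mu> z" if "z \<notin> \<real>" for z
    using weighted_not_bounded_eval_imp_kernel_approximable[OF mu a(2,1) that
        determinate_imp_not_bounded_eval[OF nu that]] .
  \<comment> \<open>\<open>N_extremal\<close> refers to the normalized measure, so bounded
    evaluation and approximability are carried over to a positive multiple of \<mu>.\<close>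
  obtain d where d: "d > 0" "normalized \<mu> = density \<mu> (\<lambda>_. ennreal d)"
    using normalized_eq_density[OF mu] by blast
  have "N_extremal \<mu>"
    unfolding N_extremal_def d(2)
    by (rule nevanlinna_const_of_kernel_approximable[OF M_star_density_const[OF mu d(1)] c(1)
          bounded_eval_density_const[OF mu d(1) c(2)] kernel_approximable_density_const[OF mu d(1) app]])
  then show "\<mu> \<in> M_star_i0" using mui by (simp add: M_star_i0_def)
qed

section \<open>Measures on the powers of two\<close>

definition dyadic :: "(nat \<Rightarrow> real) \<Rightarrow> real measure" where
  "dyadic c = atomic UNIV c (\<lambda>k. 2 ^ k)"

lemma integrable_dyadic:
  fixes f :: "real \<Rightarrow> real"
  assumes "\<And>k. c k \<ge> 0" "f \<in> borel_measurable borel"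
  shows "integrable (dyadic c) f \<longleftrightarrow> summable (\<lambda>k. c k * \<bar>f (2 ^ k)\<bar>)"
  using assms by (simp add: dyadic_def integral_atomic integrable_count_space_nat_iff abs_mult)

lemma integral_dyadic:
  fixes f :: "real \<Rightarrow> real"
  assumes c: "\<And>k. c k \<ge> 0" and f: "f \<in> borel_measurable borel" and i: "integrable (dyadic c) f"
  shows "(\<lambda>k. c k * f (2 ^ k)) sums (\<integral>x. f x \<partial>dyadic c)"
proof -
  have "integrable (count_space UNIV) (\<lambda>k. c k *\<^sub>R f (2 ^ k))"
    using i c f by (simp add: dyadic_def integral_atomic)
  from sums_integral_count_space_nat[OF this] show ?thesis
    using c f by (simp add: dyadic_def integral_atomic)
qed

lemma weighted_dyadic:
  assumes "\<And>k. c k \<ge> 0"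
  shows "weighted \<alpha> (dyadic c) = dyadic (\<lambda>k. c k * (1 + (2 ^ k)\<^sup>2) powr (- \<alpha>))"
  unfolding weighted_def dyadic_def atomic_def using assms
  by (subst density_distr) (auto simp: density_density_eq ennreal_mult')

lemma two_powr_mult_nat: "2 powr (a * real k) = (2 powr a) ^ k"
  by (simp add: powr_powr[symmetric] powr_realpow)

lemma dyadic_in_M_star:
  assumes c: "\<And>k. 0 < c k" "\<And>k. c k \<le> K * 2 powr (t * real k - real k * (real k + 1))"
  shows "dyadic c \<in> M_star"
proof -
  have c0: "c k \<ge> 0" for k using c(1)[of k] by simp
  have K: "K > 0" using less_le_trans[OF c(1)[of 0] c(2)[of 0]] by simp
  have "integrable (dyadic c) (\<lambda>x. x ^ n)" for n
  proof -
    define a where "a = t + real n"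
    have "summable (\<lambda>k. c k * \<bar>(2 ^ k) ^ n\<bar>)"
    proof (rule summable_comparison_test')
      show "summable (\<lambda>k. K * 2 powr (a\<^sup>2) * (1 / 2) ^ k)"
        by (intro summable_mult summable_geometric) simp
      fix k :: nat
      have "c k * \<bar>(2 ^ k) ^ n\<bar> = c k * 2 powr (real n * real k)"
        by (simp add: two_powr_mult_nat powr_realpow power_mult[symmetric] mult.commute)
      also have "\<dots> \<le> K * 2 powr (t * real k - real k * (real k + 1)) * 2 powr (real n * real k)"
        by (intro mult_right_mono c) simp
      also have "\<dots> = K * 2 powr (a * real k - real k * (real k + 1))"
        by (simp add: a_def powr_add[symmetric] algebra_simps)
      also have "\<dots> \<le> K * 2 powr (a\<^sup>2 - real k)"
      proof -
        \<comment> \<open>The quadratic exponent beats every power of 2^k: a^2 - a k + k^2 is a sum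
          of squares.\<close>
        have "0 \<le> (a - real k / 2)\<^sup>2 + 3 / 4 * (real k)\<^sup>2" by simp
        then have "a * real k - real k * (real k + 1) \<le> a\<^sup>2 - real k"
          by (simp add: power2_eq_square algebra_simps)
        then show ?thesis using K by simp
      qed
      also have "\<dots> = K * 2 powr (a\<^sup>2) * (1 / 2) ^ k"
        by (simp add: powr_diff powr_realpow power_one_over divide_simps)
      finally show "norm (c k * \<bar>(2 ^ k) ^ n\<bar>) \<le> K * 2 powr (a\<^sup>2) * (1 / 2) ^ k"
        using c0[of k] by simp
    qed
    then show ?thesis using c0 by (simp add: integrable_dyadic)
  qed
  moreover have "infinite (msupport (dyadic c))"
  proof -
    have "2 ^ k \<in> msupport (dyadic c)" for k
    proof -
      have "emeasure (dyadic c) U > 0" if "open U" "2 ^ k \<in> U" for U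
      proof (rule ccontr)
        assume "\<not> ?thesis"
        then have "(\<integral>\<^sup>+i. ennreal (c i) * indicator U (2 ^ i) \<partial>count_space UNIV) = 0"
          using that by (simp add: dyadic_def emeasure_atomic not_gr_zero)
        then have "ennreal (c k) * indicator U (2 ^ k) = 0"
          by (subst (asm) nn_integral_0_iff_AE) (auto simp: AE_count_space)
        then show False using that c(1)[of k] by simp
      qed
      then show ?thesis by (auto simp: msupport_def)
    qed
    then have "range (\<lambda>k. 2 ^ k) \<subseteq> msupport (dyadic c)" by blast
    moreover have "infinite (range (\<lambda>k::nat. (2::real) ^ k))"
      by (intro range_inj_infinite injI) simp
    ultimately show ?thesis using finite_subset by blast
  qed
  ultimately show ?thesis by (simp add: M_star_def dyadic_def)
qed


section \<open>Lagrange products at the powers of two\<close>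

lemma prod_one_minus_half_power:
  "(\<Prod>i=1..n. 1 - (1 / 2 :: real) ^ i) \<ge> 1 / 4"
proof (cases n)
  case (Suc m)
  \<comment> \<open>The bare bound 1/4 is not inductive; the extra term 2^(-m-2), with equality at m
    = 0, pays for the next factor.\<close>
  have "(\<Prod>i=1..Suc m. 1 - (1 / 2 :: real) ^ i) \<ge> 1 / 4 + (1 / 2) ^ (m + 2)"
  proof (induction m)
    case (Suc m)
    define y :: real where "y = (1 / 2) ^ m"
    have y: "0 < y" "y \<le> 1" by (auto simp: y_def power_le_one)
    have "1 / 4 + (1 / 2) ^ (Suc m + 2) \<le> (1 / 4 + (1 / 2) ^ (m + 2)) * (1 - (1 / 2 :: real) ^ Suc (Suc m))"
    proof -
      have "1 / 4 + y / 8 \<le> (1 / 4 + y / 4) * (1 - y / 4)"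
        using y mult_left_mono[OF y(2), of y] by (simp add: algebra_simps)
      then show ?thesis by (simp add: y_def)
    qed
    also have "\<dots> \<le> (\<Prod>i=1..Suc m. 1 - (1 / 2 :: real) ^ i) * (1 - (1 / 2) ^ Suc (Suc m))"
      using y by (intro mult_right_mono Suc) (auto simp: y_def[symmetric])
    finally show ?case by simp
  qed simp
  moreover have "(1 / 2 :: real) ^ (m + 2) \<ge> 0" by simp
  ultimately show ?thesis unfolding Suc by linarith
qed simp

text \<open>This is 2^(-k(k+1)/2), the size of the Lagrange basis polynomial of 2^k at 0. The
  product form allows comparison factor by factor.\<close>

definition half_power_prod :: "nat \<Rightarrow> real" where
  "half_power_prod k = (\<Prod>i=1..k. (1 / 2) ^ i)"

lemma half_power_prod_pos: "half_power_prod k > 0"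
  by (auto simp: half_power_prod_def intro!: prod_pos)

lemma half_power_prod_sq: "(half_power_prod k)\<^sup>2 = 2 powr (- (real k * (real k + 1)))"
proof (induction k)
  case (Suc k)
  have h: "((1 / 2 :: real) ^ m)\<^sup>2 = 2 powr (- (2 * real m))" for m
    using powr_realpow[of 2 "2 * m"] by (simp add: powr_minus_divide power_one_over power_even_eq)
  have "half_power_prod (Suc k) = half_power_prod k * (1 / 2) ^ Suc k" by (simp add: half_power_prod_def)
  then have "(half_power_prod (Suc k))\<^sup>2 = (half_power_prod k)\<^sup>2 * ((1 / 2) ^ Suc k)\<^sup>2"
    by (simp only: power_mult_distrib)
  also have "((1 / 2 :: real) ^ Suc k)\<^sup>2 = 2 powr (- (2 * real (Suc k)))"
    by (rule h)
  also have "(half_power_prod k)\<^sup>2 * \<dots> = 2 powr (- (real (Suc k) * (real (Suc k) + 1)))"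
    unfolding Suc by (simp add: powr_add[symmetric] algebra_simps)
  finally show ?case .
qed (simp add: half_power_prod_def)

text \<open>With i = |k - j|, a node below 2^k contributes 2^(-i)/(1 - 2^(-i)) and a node above it
  only 1/(1 - 2^(-i)). Each of the two products of denominators is at least 1/4, whence 16, for
  every N.\<close>

lemma dyadic_lagrange_bound:
  assumes "k \<le> N"
  shows "\<bar>\<Prod>j\<in>{..N} - {k}. (0 - 2 ^ j) / (2 ^ k - 2 ^ j :: real)\<bar> \<le> 16 * half_power_prod k"
proof -
  let ?f = "\<lambda>j. \<bar>(0 - 2 ^ j) / (2 ^ k - 2 ^ j :: real)\<bar>"
  let ?g = "\<lambda>i. 1 - (1 / 2 :: real) ^ i"
  have g0: "?g i > 0" if "i \<ge> 1" for i
    using that power_decreasing[of 1 i "1 / 2 :: real"] by simp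
  have un: "{..N} - {k} = {..<k} \<union> {k<..N}" using assms by auto
  have "\<bar>\<Prod>j\<in>{..N} - {k}. (0 - 2 ^ j) / (2 ^ k - 2 ^ j :: real)\<bar> = (\<Prod>j<k. ?f j) * (\<Prod>j\<in>{k<..N}. ?f j)"
    unfolding abs_prod un by (rule prod.union_disjoint) auto
  also have "(\<Prod>j<k. ?f j) = (\<Prod>i=1..k. (1 / 2) ^ i / ?g i)"
  proof (rule prod.reindex_bij_witness[of _ "\<lambda>i. k - i" "\<lambda>j. k - j"])
    fix j assume "j \<in> {..<k}"
    then have k: "k = j + (k - j)" and i: "k - j \<ge> 1" by auto
    have "(2::real) ^ k - 2 ^ j = 2 ^ j * (2 ^ (k - j) - 1)" by (subst k) (simp add: power_add algebra_simps)
    moreover have "(2::real) ^ (k - j) - 1 > 0" using i power_increasing[OF i, of "2::real"] by simp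
    ultimately show "(1 / 2) ^ (k - j) / ?g (k - j) = ?f j"
      by (simp add: abs_mult power_one_over divide_simps)
  qed auto
  also have "(\<Prod>j\<in>{k<..N}. ?f j) = (\<Prod>i=1..N - k. 1 / ?g i)"
  proof (rule prod.reindex_bij_witness[of _ "\<lambda>i. k + i" "\<lambda>j. j - k"])
    fix j assume "j \<in> {k<..N}"
    then have j: "j = k + (j - k)" and i: "j - k \<ge> 1" by auto
    have "(2::real) ^ k - 2 ^ j = - (2 ^ k * (2 ^ (j - k) - 1))" by (subst (1) j) (simp add: power_add algebra_simps)
    moreover have "(2::real) ^ j = 2 ^ k * 2 ^ (j - k)" by (subst j) (simp add: power_add)
    moreover have "(2::real) ^ (j - k) - 1 > 0" using i power_increasing[OF i, of "2::real"] by simp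
    ultimately show "1 / ?g (j - k) = ?f j"
      by (simp add: abs_mult power_one_over divide_simps)
  qed auto
  also have "(\<Prod>i=1..k. (1 / 2) ^ i / ?g i) * (\<Prod>i=1..N - k. 1 / ?g i)
      = half_power_prod k * (1 / (\<Prod>i=1..k. ?g i)) * (1 / (\<Prod>i=1..N - k. ?g i))"
    by (simp add: prod_dividef half_power_prod_def)
  also have "\<dots> \<le> half_power_prod k * 4 * 4"
  proof -
    have "1 / (\<Prod>i=1..n. ?g i) \<le> 4" "1 / (\<Prod>i=1..n. ?g i) \<ge> 0" for n
      using prod_one_minus_half_power[of n] le_imp_inverse_le[OF prod_one_minus_half_power[of n]]
      by (simp_all add: inverse_eq_divide)
    then show ?thesis using half_power_prod_pos[of k] by (intro mult_mono mult_nonneg_nonneg) auto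
  qed
  finally show ?thesis by simp
qed

text \<open>Interpolation at 2^0, ..., 2^N with N the degree of p recovers p(0) from the values at
  the atoms. Cauchy-Schwarz, with sqrt(c k) split off, bounds p(0)^2 by the squared norm times the
  sum of (16 \<open>half_power_prod k\<close>)^2 / c k, which is dominated by a geometric series of
  ratio 2^(-t). The point 0 is not an atom.\<close>

lemma dyadic_indeterminate:
  assumes M: "dyadic c \<in> M_star" and t: "t > 0" and K: "K > 0"
    and c: "\<And>k. c k \<ge> K * 2 powr (t * real k - real k * (real k + 1))"
  shows "dyadic c \<in> M_star_i"
proof -
  have cK: "c k \<ge> K * (2 powr t) ^ k * (half_power_prod k)\<^sup>2" for k
    using c[of k] by (simp add: half_power_prod_sq powr_diff powr_minus_divide two_powr_mult_nat)
  have cp: "c k > 0" for k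
    by (rule less_le_trans[OF _ cK]) (intro mult_pos_pos zero_less_power K half_power_prod_pos, simp)
  then have c0: "c k \<ge> 0" for k by (simp add: less_imp_le)
  define q where "q = 2 powr (- t)"
  have q: "0 < q" "q < 1" using t by (auto simp: q_def powr_less_one)
  have b: "(16 * half_power_prod k)\<^sup>2 / c k \<le> 256 / K * q ^ k" for k
  proof -
    have "(half_power_prod k)\<^sup>2 * 256 \<le> 256 / K * q ^ k * (K * (2 powr t) ^ k * (half_power_prod k)\<^sup>2)"
      using K by (simp add: q_def powr_minus power_mult_distrib[symmetric])
    also have "\<dots> \<le> 256 / K * q ^ k * c k" using q K by (intro mult_left_mono cK) auto
    finally show ?thesis using cp[of k] by (simp add: divide_le_eq power_mult_distrib)
  qed
  define L where "L = (\<Sum>k. 256 / K * q ^ k)"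
  have sL: "summable (\<lambda>k. 256 / K * q ^ k)" using q by (intro summable_mult summable_geometric) auto
  show ?thesis
  proof (rule bounded_eval_nonatom_imp_indeterminate[OF M])
    show "emeasure (dyadic c) {0} = 0" by (simp add: dyadic_def emeasure_atomic)
    fix p :: "real poly"
    define N where "N = degree p"
    have inj: "inj_on (\<lambda>k. (2::real) ^ k) A" for A by (auto simp: inj_on_def)
    define S where "S = (\<lambda>k. (2::real) ^ k) ` {..N}"
    have "degree p < card S" unfolding S_def by (simp add: card_image[OF inj] N_def)
    then have "p = (\<Sum>r\<in>S. smult (poly p r) (lagrange_basis S r))"
      by (intro lagrange_interpolation) (simp add: S_def)
    from arg_cong[OF this, where f = "\<lambda>p. poly p 0"]
    have "poly p 0 = (\<Sum>r\<in>S. poly p r * (\<Prod>s\<in>S - {r}. (0 - s) / (r - s)))"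
      by (simp add: poly_sum poly_lagrange_basis)
    also have "\<dots> = (\<Sum>k\<le>N. poly p (2 ^ k) * (\<Prod>s\<in>S - {2 ^ k}. (0 - s) / (2 ^ k - s)))"
      unfolding S_def by (subst sum.reindex[OF inj]) simp
    also have "\<dots> = (\<Sum>k\<le>N. poly p (2 ^ k) * (\<Prod>j\<in>{..N} - {k}. (0 - 2 ^ j) / (2 ^ k - 2 ^ j)))"
    proof (intro sum.cong refl arg_cong2[where f = times])
      fix k assume "k \<in> {..N}"
      have "S - {2 ^ k} = (\<lambda>k. 2 ^ k) ` ({..N} - {k})" by (auto simp: S_def)
      then show "(\<Prod>s\<in>S - {2 ^ k}. (0 - s) / (2 ^ k - s)) = (\<Prod>j\<in>{..N} - {k}. (0 - 2 ^ j) / (2 ^ k - 2 ^ j :: real))"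
        by (simp add: prod.reindex[OF inj])
    qed
    finally have "\<bar>poly p 0\<bar> \<le> (\<Sum>k\<le>N. \<bar>poly p (2 ^ k) * (\<Prod>j\<in>{..N} - {k}. (0 - 2 ^ j) / (2 ^ k - 2 ^ j))\<bar>)"
      by (simp only: sum_abs)
    also have "\<dots> \<le> (\<Sum>k\<le>N. \<bar>poly p (2 ^ k)\<bar> * (16 * half_power_prod k))"
      unfolding abs_mult by (intro sum_mono mult_left_mono dyadic_lagrange_bound) auto
    also have "\<dots> = (\<Sum>k\<le>N. (sqrt (c k) * \<bar>poly p (2 ^ k)\<bar>) * (16 * half_power_prod k / sqrt (c k)))"
    proof (rule sum.cong[OF refl])
      fix k
      have "sqrt (c k) \<noteq> 0" using cp[of k] by simp
      then show "\<bar>poly p (2 ^ k)\<bar> * (16 * half_power_prod k) = (sqrt (c k) * \<bar>poly p (2 ^ k)\<bar>) * (16 * half_power_prod k / sqrt (c k))"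
        by (simp add: field_simps)
    qed
    finally have "(poly p 0)\<^sup>2 \<le> (\<Sum>k\<le>N. (sqrt (c k) * \<bar>poly p (2 ^ k)\<bar>) * (16 * half_power_prod k / sqrt (c k)))\<^sup>2"
      using power_mono[OF _ abs_ge_zero, of "poly p 0" _ 2] by (simp only: power2_abs)
    also have "\<dots> \<le> (\<Sum>k\<le>N. (sqrt (c k) * \<bar>poly p (2 ^ k)\<bar>)\<^sup>2) * (\<Sum>k\<le>N. (16 * half_power_prod k / sqrt (c k))\<^sup>2)"
      by (rule Cauchy_Schwarz_ineq_sum)
    also have "\<dots> = (\<Sum>k\<le>N. c k * (poly p (2 ^ k))\<^sup>2) * (\<Sum>k\<le>N. (16 * half_power_prod k)\<^sup>2 / c k)"
      using c0 by (simp add: power_mult_distrib power_divide)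
    also have "\<dots> \<le> (\<integral>x. (poly p x)\<^sup>2 \<partial>dyadic c) * L"
    proof (rule mult_mono)
      have "integrable (dyadic c) (\<lambda>x. (poly p x)\<^sup>2)"
        using integrable_poly_real_mult[OF M, of p p] by (simp add: power2_eq_square)
      from integral_dyadic[OF c0 _ this] have s: "(\<lambda>k. c k * (poly p (2 ^ k))\<^sup>2) sums (\<integral>x. (poly p x)\<^sup>2 \<partial>dyadic c)" by simp
      show "(\<Sum>k\<le>N. c k * (poly p (2 ^ k))\<^sup>2) \<le> (\<integral>x. (poly p x)\<^sup>2 \<partial>dyadic c)"
        unfolding sums_unique[OF s] using c0 by (intro sum_le_suminf sums_summable[OF s]) auto
      have "(\<Sum>k\<le>N. (16 * half_power_prod k)\<^sup>2 / c k) \<le> (\<Sum>k\<le>N. 256 / K * q ^ k)" by (intro sum_mono b)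
      also have "\<dots> \<le> L" unfolding L_def using q K by (intro sum_le_suminf sL) auto
      finally show "(\<Sum>k\<le>N. (16 * half_power_prod k)\<^sup>2 / c k) \<le> L" .
    qed (auto intro!: sum_nonneg divide_nonneg_nonneg c0)
    finally show "(poly p 0)\<^sup>2 \<le> L * (\<integral>x. (poly p x)\<^sup>2 \<partial>dyadic c)" by (simp only: mult.commute)
  qed
qed

text \<open>The test polynomials F n have value 1 at 0 and vanish at the first n atoms; at a later
  atom 2^k their size is at most the reciprocal of \<open>half_power_prod k\<close>. So their
  squared norm is at most the tail of a geometric series and tends to 0. Evaluation at 0 is
  therefore unbounded, which indeterminacy would forbid.\<close>

lemma dyadic_determinate:
  assumes M: "dyadic c \<in> M_star" and t: "t > 0" and c0: "\<And>k. c k \<ge> 0"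
    and c: "\<And>k. c k \<le> K * 2 powr (- t * real k - real k * (real k + 1))"
  shows "dyadic c \<in> M_star_d"
proof (rule ccontr)
  assume "dyadic c \<notin> M_star_d"
  with M have "dyadic c \<in> M_star_i" by (simp add: M_star_i_def)
  then obtain z where "z \<notin> \<real>" "bounded_eval (dyadic c) z"
    using indeterminate_imp_bounded_eval by blast
  then have "bounded_eval (dyadic c) (of_real 0)" by (rule bounded_eval_nonreal_imp_bounded_eval[OF M])
  from bounded_eval_of_real[OF this] obtain C where
    C: "\<And>p::real poly. (poly p 0)\<^sup>2 \<le> C * (\<integral>x. (poly p x)\<^sup>2 \<partial>dyadic c)" by blast
  define q where "q = 2 powr (- t)"
  have q: "0 < q" "q < 1" using t by (auto simp: q_def powr_less_one)
  have cq: "c k \<le> K * q ^ k * (half_power_prod k)\<^sup>2" for k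
    using c[of k] unfolding half_power_prod_sq q_def two_powr_mult_nat[symmetric]
    by (simp add: powr_add[symmetric] mult.assoc)
  have K: "K \<ge> 0" using order_trans[OF c0[of 0] cq[of 0]] by (simp add: half_power_prod_def)
  define F where "F n = (\<Prod>j<n. [:1, - 1 / 2 ^ j:] :: real poly)" for n
  have F: "poly (F n) x = (\<Prod>j<n. 1 - x / 2 ^ j)" for n x by (simp add: F_def poly_prod)
  have Fz: "poly (F n) (2 ^ k) = 0" if "k < n" for k n
    unfolding F using that by (intro prod_zero bexI[of _ k]) auto
  have Fb: "(poly (F n) (2 ^ k))\<^sup>2 * (half_power_prod k)\<^sup>2 \<le> 1" if "n \<le> k" for k n
  proof -
    have "\<bar>poly (F n) (2 ^ k)\<bar> \<le> (\<Prod>j<n. 2 ^ (k - j))"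
      unfolding F abs_prod
    proof (rule prod_mono)
      fix j assume "j \<in> {..<n}"
      then have "j \<le> k" using that by simp
      then have "(2::real) ^ k / 2 ^ j = 2 ^ (k - j)" by (simp add: power_diff)
      moreover have "(2::real) ^ (k - j) \<ge> 1" by simp
      ultimately show "0 \<le> \<bar>1 - (2::real) ^ k / 2 ^ j\<bar> \<and> \<bar>1 - 2 ^ k / 2 ^ j\<bar> \<le> (2::real) ^ (k - j)" by simp
    qed
    also have "\<dots> \<le> (\<Prod>j<k. 2 ^ (k - j))"
      using that by (intro prod_mono2) auto
    also have "\<dots> = (\<Prod>i=1..k. (2::real) ^ i)"
      by (rule prod.reindex_bij_witness[of _ "\<lambda>i. k - i" "\<lambda>j. k - j"]) auto
    finally have "\<bar>poly (F n) (2 ^ k)\<bar> * half_power_prod k \<le> (\<Prod>i=1..k. (2::real) ^ i) * half_power_prod k"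
      using half_power_prod_pos[of k] by (intro mult_right_mono) auto
    also have "\<dots> = 1" by (simp add: half_power_prod_def prod.distrib[symmetric] power_mult_distrib[symmetric])
    finally have "(\<bar>poly (F n) (2 ^ k)\<bar> * half_power_prod k)\<^sup>2 \<le> 1"
      using half_power_prod_pos[of k] by (intro power_le_one) auto
    then show ?thesis by (simp add: power_mult_distrib)
  qed
  have int: "(\<integral>x. (poly (F n) x)\<^sup>2 \<partial>dyadic c) \<le> K * q ^ n / (1 - q)" for n
  proof -
    let ?a = "\<lambda>k. c k * (poly (F n) (2 ^ k))\<^sup>2"
    have "integrable (dyadic c) (\<lambda>x. (poly (F n) x)\<^sup>2)"
      using integrable_poly_real_mult[OF M, of "F n" "F n"] by (simp add: power2_eq_square)
    from integral_dyadic[OF c0 _ this] have s: "?a sums (\<integral>x. (poly (F n) x)\<^sup>2 \<partial>dyadic c)" by simp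
    note sa = sums_summable[OF s]
    have "(\<integral>x. (poly (F n) x)\<^sup>2 \<partial>dyadic c) = (\<Sum>k. ?a (k + n)) + (\<Sum>k<n. ?a k)"
      unfolding sums_unique[OF s] by (rule suminf_split_initial_segment[OF sa])
    also have "(\<Sum>k<n. ?a k) = 0" by (rule sum.neutral) (simp add: Fz)
    also have "(\<Sum>k. ?a (k + n)) \<le> (\<Sum>k. K * q ^ n * q ^ k)"
    proof (rule suminf_le)
      fix k
      have "?a (k + n) \<le> K * q ^ (k + n) * (half_power_prod (k + n))\<^sup>2 * (poly (F n) (2 ^ (k + n)))\<^sup>2"
        by (intro mult_right_mono cq) simp
      also have "\<dots> = K * q ^ (k + n) * ((poly (F n) (2 ^ (k + n)))\<^sup>2 * (half_power_prod (k + n))\<^sup>2)"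
        by (simp only: mult_ac)
      also have "\<dots> \<le> K * q ^ (k + n) * 1"
        using K q by (intro mult_left_mono Fb) auto
      finally show "?a (k + n) \<le> K * q ^ n * q ^ k" by (simp add: power_add mult_ac)
    qed (use q sa in \<open>auto intro!: summable_mult summable_geometric summable_ignore_initial_segment\<close>)
    also have "\<dots> = K * q ^ n * (1 / (1 - q))"
      using q by (subst suminf_mult) (auto simp: suminf_geometric intro!: summable_geometric)
    finally show ?thesis by simp
  qed
  have "1 \<le> \<bar>C\<bar> * (K * q ^ n / (1 - q))" for n
  proof -
    have "1 \<le> C * (\<integral>x. (poly (F n) x)\<^sup>2 \<partial>dyadic c)" using C[of "F n"] by (simp add: F)
    also have "\<dots> \<le> \<bar>C\<bar> * (\<integral>x. (poly (F n) x)\<^sup>2 \<partial>dyadic c)" by (intro mult_right_mono) auto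
    also have "\<dots> \<le> \<bar>C\<bar> * (K * q ^ n / (1 - q))" by (intro mult_left_mono int) simp
    finally show ?thesis .
  qed
  moreover have "(\<lambda>n. \<bar>C\<bar> * (K * q ^ n / (1 - q))) \<longlonglongrightarrow> \<bar>C\<bar> * (K * 0 / (1 - q))"
    using q by (intro tendsto_intros LIMSEQ_power_zero) auto
  ultimately have "1 \<le> \<bar>C\<bar> * (K * 0 / (1 - q))" by (intro LIMSEQ_le_const) auto
  then show False by simp
qed

section \<open>The one-parameter family of examples\<close>

definition model_weight :: "real \<Rightarrow> nat \<Rightarrow> real" where
  "model_weight t k = 2 powr (t * real k - real k * (real k + 1))"

text \<open>From 4^k \<le> 1 + 4^k \<le> 2 * 4^k. Both directions matter: determinacy is tested with
  an upper bound on the masses, indeterminacy with a lower one.\<close>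

lemma weighted_model_weight_bounds:
  assumes "\<alpha> \<ge> 0"
  shows "2 powr (- \<alpha>) * model_weight (t - 2 * \<alpha>) k \<le> model_weight t k * (1 + (2 ^ k)\<^sup>2) powr (- \<alpha>)"
    and "model_weight t k * (1 + (2 ^ k)\<^sup>2) powr (- \<alpha>) \<le> model_weight (t - 2 * \<alpha>) k"
proof -
  have sq: "((2::real) ^ k)\<^sup>2 = 2 powr (2 * real k)"
    by (simp add: powr_realpow[symmetric] power2_eq_square powr_add[symmetric])
  have split: "model_weight (t - 2 * \<alpha>) k = model_weight t k * (2 powr (2 * real k)) powr (- \<alpha>)"
    by (simp add: model_weight_def powr_powr powr_add[symmetric] algebra_simps)
  have anti: "y powr (- \<alpha>) \<le> x powr (- \<alpha>)" if "0 < x" "x \<le> y" for x y :: real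
    using that assms by (intro powr_mono2') auto
  show "model_weight t k * (1 + (2 ^ k)\<^sup>2) powr (- \<alpha>) \<le> model_weight (t - 2 * \<alpha>) k"
    unfolding split sq by (intro mult_left_mono anti) (auto simp: model_weight_def)
  have "2 powr (- \<alpha>) * (2 powr (2 * real k)) powr (- \<alpha>) = (2 * 2 powr (2 * real k)) powr (- \<alpha>)"
    by (simp add: powr_mult)
  also have "\<dots> \<le> (1 + 2 powr (2 * real k)) powr (- \<alpha>)"
    by (intro anti) (auto simp: add_pos_pos ge_one_powr_ge_zero)
  finally show "2 powr (- \<alpha>) * model_weight (t - 2 * \<alpha>) k \<le> model_weight t k * (1 + (2 ^ k)\<^sup>2) powr (- \<alpha>)"
    unfolding split sq using mult_left_mono[of _ _ "model_weight t k"]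
    by (simp add: model_weight_def mult.left_commute)
qed

lemma model_weight_M_star_i: "t > 0 \<Longrightarrow> dyadic (model_weight t) \<in> M_star_i"
  using dyadic_in_M_star[of "model_weight t" 1 t]
  by (intro dyadic_indeterminate[of _ t 1]) (auto simp: model_weight_def)

lemma weighted_model_weight:
  assumes "\<alpha> \<ge> 0"
  shows "t > 2 * \<alpha> \<Longrightarrow> weighted \<alpha> (dyadic (model_weight t)) \<in> M_star_i"
    and "t < 2 * \<alpha> \<Longrightarrow> weighted \<alpha> (dyadic (model_weight t)) \<in> M_star_d"
proof -
  define c where "c = (\<lambda>k. model_weight t k * (1 + (2 ^ k)\<^sup>2) powr (- \<alpha>))"
  have w: "weighted \<alpha> (dyadic (model_weight t)) = dyadic c"
    unfolding c_def by (rule weighted_dyadic) (simp add: model_weight_def)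
  have cp: "c k > 0" for k
    unfolding c_def by (intro mult_pos_pos) (auto simp: model_weight_def add_nonneg_eq_0_iff)
  have up: "c k \<le> 1 * 2 powr ((t - 2 * \<alpha>) * real k - real k * (real k + 1))" for k
    using weighted_model_weight_bounds(2)[OF assms, of t k] by (simp add: c_def model_weight_def)
  have low: "2 powr (- \<alpha>) * 2 powr ((t - 2 * \<alpha>) * real k - real k * (real k + 1)) \<le> c k" for k
    using weighted_model_weight_bounds(1)[OF assms, of t k] by (simp add: c_def model_weight_def)
  note M = dyadic_in_M_star[OF cp up]
  show "weighted \<alpha> (dyadic (model_weight t)) \<in> M_star_i" if "t > 2 * \<alpha>"
    unfolding w using that by (intro dyadic_indeterminate[OF M _ _ low]) auto
  show "weighted \<alpha> (dyadic (model_weight t)) \<in> M_star_d" if "t < 2 * \<alpha>"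
    unfolding w using that up less_imp_le[OF cp] by (intro dyadic_determinate[OF M, of "2 * \<alpha> - t" 1]) auto
qed

theorem theorem1p6:
  fixes \<alpha> :: real
  assumes "0 < \<alpha>" and "\<alpha> < 1"
  shows "class_A \<alpha> \<inter> M_star_i0 \<noteq> {} \<and> class_B \<alpha> \<noteq> {} \<and> class_B \<alpha> \<subseteq> M_star_i0"
proof (intro conjI)
  \<comment> \<open>The parameter has to exceed 2\<alpha>, to stay indeterminate after the weight
    with exponent \<alpha>, and to be below 2, to become determinate after exponent 1. The midpoint
    1 + \<alpha> qualifies because \<alpha> < 1.\<close>
  let ?\<mu> = "dyadic (model_weight (1 + \<alpha>))"
  have "?\<mu> \<in> class_A \<alpha>"
    using assms by (simp add: class_A_def model_weight_M_star_i weighted_model_weight)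
  \<comment> \<open>Exponent 1 is still admissible for \<open>class_B_subset_N_extremal\<close>; it
    serves only to certify N-extremality.\<close>
  moreover have "?\<mu> \<in> class_B 1"
    using assms by (simp add: class_B_def model_weight_M_star_i weighted_model_weight)
  then have "?\<mu> \<in> M_star_i0" using class_B_subset_N_extremal[of 1] by auto
  ultimately show "class_A \<alpha> \<inter> M_star_i0 \<noteq> {}" by blast
  \<comment> \<open>Any parameter strictly between 0 and 2\<alpha> would do; \<alpha> is the
    midpoint.\<close>
  have "dyadic (model_weight \<alpha>) \<in> class_B \<alpha>"
    using assms by (simp add: class_B_def model_weight_M_star_i weighted_model_weight)
  then show "class_B \<alpha> \<noteq> {}" by blast
  show "class_B \<alpha> \<subseteq> M_star_i0" using assms by (intro class_B_subset_N_extremal) auto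
qed

end
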